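(* The maps $\mu^\star:\mathbf H_{\widehat\Omega}\to\mathbf H^\heartsuit_\Omega$ and $j_!:\mathbf H^\heartsuit_\Omega\to\mathbf H_\Omega$ are algebra homomorphisms, and so the composition $\psi_\Omega=j_!\mu^\star:\mathbf H_{\widehat\Omega}\to\mathbf H_\Omega$ is an embedding of Hall algebras. Moreover, they are compatible with the restriction maps: for all $\nu,\tau,\omega\in\mathbb N[\widehat I]$ with $\tau+\omega=\nu$, $$\mathrm{Res}^{\nu,\heartsuit}_{\tau,\omega}\,\mu^\star_\nu=(\mu^\star_\tau\otimes\mu^\star_\omega)\,\widehat{\mathrm{Res}}{}^\nu_{\tau,\omega},\qquad \mathrm{Res}^{\nu}_{\tau,\omega}\,j_{\nu!}=(j_{\tau!}\otimes j_{\omega!})\,\mathrm{Res}^{\nu,\heartsuit}_{\tau,\omega}.$$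
   Context: GRAPHS. $(\mathbf I,\Omega)$ is a finite oriented graph without loops, each arrow $h\in\Omega$ going from $h'$ to $h''\ne h'$. An admissible automorphism $a$ consists of bijections of $\mathbf I$ and of $\Omega$ compatible with $h\mapsto h',h''$, such that no arrow joins two vertices of one $a$-orbit. $I=\mathbf I/a$ is a Cartan datum by $i\cdot i=2\#i$, $i\cdot j=-\#\{h\in\Omega:h',h''\in i\cup j\}$ ($i\ne j$). Fix orbits $i_+,i_-\in I$ such that $\#i_+=\#i_-=\#\{h\in\Omega:h',h''\in i_+\cup i_-\}$ and each of these arrows starts in $i_+$ (and ends in $i_-$). Put $i_0=i_++i_-$, $\widehat I=(I\setminus\{i_+,i_-\})\cup\{i_0\}$. For $\nu\in\mathbb N[I]$ write $\nu_{\mathbf i}=\nu_i$ for $\mathbf i\in i$; $\mathbb N[\widehat I]=\{\nu\in\mathbb N[I]:\nu_{i_+}=\nu_{i_-}\}$. The edge contraction $(\widehat{\mathbf I},\widehat\Omega,\widehat a)$ has vertex set $\widehat{\mathbf I}=\mathbf I\setminus i_-$ and arrow set $\widehat\Omega$ consisting of: the $h\in\Omega$ with $h',h''\notin i_-$; symbols $h_2h_1$ (from $h_1'$ to $h_2''$) with $h_1$ going from $i_+$ to $i_-$ and $h_2'=h_1''$; symbols $\bar h_1h_2$ (from $h_2'$ to $h_1'$) with $h_1$ going from $i_+$ to $i_-$, $h_2''=h_1''$, $h_2'\notin i_+$; $\widehat a$ is induced by $a$. $\widehat{\mathbf I}/\widehat a$ is identified with $\widehat I$ by $i\mapsto i$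 ($i\neq i_+$), $i_+\mapsto i_0$; so $\nu\in\mathbb N[\widehat I]$ is a dimension vector on $\widehat{\mathbf I}$ with value $\nu_{i_+}$ on $i_+$. HALL ALGEBRAS. Let $q$ be a power of a prime $p$, $\mathbf k=\overline{\mathbb F}_p$; fix $q^{1/2}\in\mathbb C$. For $\nu\in\mathbb N[I]$ let $V_{\mathbf i}=\mathbf k^{\nu_{\mathbf i}}$, $\mathbf E_{\nu,\Omega}=\bigoplus_{h\in\Omega}\mathrm{Hom}(V_{h'},V_{h''})$, $\mathbf G_\nu=\prod_{\mathbf i}\mathrm{GL}(V_{\mathbf i})$ acting by conjugation, and $\mathbf F$ the composition of the entrywise $q$-power map with the permutation induced by $a$ ($\mathbf F(x)_{a(h)}=x_h^{(q)}$, $\mathbf F(g)_{a(\mathbf i)}=g_{\mathbf i}^{(q)}$); superscript $\mathbf F$ means fixed points. $\mathbf H_{\nu,\Omega}$ is the space of $\mathbb Q(q^{1/2})$-valued $\mathbf G_\nu^{\mathbf F}$-invariant functions on $\mathbf E^{\mathbf F}_{\nu,\Omega}$; $\mathbf H_\Omega=\bigoplus_{\nu\in\mathbb N[I]}\mathbf H_{\nu,\Omega}$. For a map $\phi$ of finite sets, $\phi^*f=f\phi$, $\phi_!(f)(y)=\sum_{x\in\phi^{-1}(y)}f(x)$. For $\nu=\tau+\omega$ write $V=T\oplus W$ (coordinate decomposition with dimension vectors $\tau,\omega$), $S_W=\{x\in\mathbf E_{\nu,\Omega}:x\text{ leaves }W\text{ stable}\}$, $x^W,x^T$ the elements induced on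 $W$ and $V/W=T$, $\iota:S_W\to\mathbf E_{\nu,\Omega}$ the inclusion, $\kappa:S_W\to\mathbf E_{\tau,\Omega}\times\mathbf E_{\omega,\Omega}$, $x\mapsto(x^T,x^W)$; $Q\subset\mathbf G_\nu$ the stabilizer of $W$, $U$ its unipotent radical, $\mathbf E'=\mathbf G_\nu\times_US_W$, $\mathbf E''=\mathbf G_\nu\times_QS_W$; $p_1:[g,x]\mapsto(x^T,x^W)$, $p_2:\mathbf E'\to\mathbf E''$ the projection, $p_3:\mathbf E''\to\mathbf E_{\nu,\Omega}$, $[g,x]\mapsto g.x$. On $\mathbf F$-fixed points set $$\mathrm{Ind}^\nu_{\tau,\omega}=(q^{1/2})^{-m_\Omega(\tau,\omega)}\tfrac{1}{\#(\mathbf G_\tau^{\mathbf F}\times\mathbf G_\omega^{\mathbf F})}(p_3)_!(p_2)_!(p_1)^*,\qquad \mathrm{Res}^\nu_{\tau,\omega}=(q^{1/2})^{-m^*_\Omega(\tau,\omega)}\kappa_!\iota^*,$$ with $m_\Omega(\tau,\omega)=\sum_{\mathbf i}\tau_{\mathbf i}\omega_{\mathbf i}+\sum_{h\in\Omega}\tau_{h'}\omega_{h''}$, $m^*_\Omega(\tau,\omega)=-\sum_{\mathbf i}\tau_{\mathbf i}\omega_{\mathbf i}+\sum_{h\in\Omega}\tau_{h'}\omega_{h''}$. $\mathbf H_\Omega$ is an associative algebra under the maps $\mathrm{Ind}$. $\mathbf H_{\widehat\Omega}=\bigoplus_{\nu\in\mathbb N[\widehat I]}\mathbf H_{\nu,\widehat\Omega}$,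 $\widehat{\mathrm{Ind}}$, $\widehat{\mathrm{Res}}$ are the same objects for $(\widehat{\mathbf I},\widehat\Omega,\widehat a)$ (with twisted Frobenius $\widehat{\mathbf F}$). For $\nu\in\mathbb N[\widehat I]$ let $\mathbf E^\heartsuit_{\nu,\Omega}\subset\mathbf E_{\nu,\Omega}$ be the set of $x$ with $x_h$ invertible for each arrow $h$ from $i_+$ to $i_-$; $\mathbf H^\heartsuit_{\nu,\Omega}$ the space of $\mathbb Q(q^{1/2})$-valued $\mathbf G_\nu^{\mathbf F}$-invariant functions on $\mathbf E^{\heartsuit,\mathbf F}_{\nu,\Omega}$; $\mathbf H^\heartsuit_\Omega=\bigoplus_{\nu\in\mathbb N[\widehat I]}\mathbf H^\heartsuit_{\nu,\Omega}$, with product $\mathrm{Ind}^{\nu,\heartsuit}_{\tau,\omega}$ and maps $\mathrm{Res}^{\nu,\heartsuit}_{\tau,\omega}$ given by the same formulas as $\mathrm{Ind}^\nu_{\tau,\omega}$, $\mathrm{Res}^\nu_{\tau,\omega}$ with all spaces replaced by their open parts where the $x_h$ ($h$ from $i_+$ to $i_-$) are invertible. $j_{\nu!}:\mathbf H^\heartsuit_{\nu,\Omega}\to\mathbf H_{\nu,\Omega}$ is extension by zero, $j_!=\oplus j_{\nu!}$. The map $\mu_\nu:\mathbf E^{\heartsuit,\mathbf F}_{\nu,\Omega}\to\mathbf E^{\widehat{\mathbf F}}_{\nu,\widehat\Omega}$, $x\mapsto\widehat x$, is $\widehat x_h=x_h$ ($h\in\Omega\cap\widehat\Omega$), $\widehat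 x_{h_2h_1}=x_{h_2}x_{h_1}$, $\widehat x_{\bar h_1h_2}=x_{h_1}^{-1}x_{h_2}$; $\mu_\nu^\star=(q^{1/2})^{-\nu_{i_-}^2(i_-\cdot i_-)/2}\mu_\nu^*:\mathbf H_{\nu,\widehat\Omega}\to\mathbf H^\heartsuit_{\nu,\Omega}$ and $\mu^\star=\oplus_\nu\mu^\star_\nu$. *)

theory Defs
  imports
    Complex_Main
    "HOL-Library.FuncSet"
    "HOL-Combinatorics.Orbits"
    "HOL-Algebra.Algebraic_Closure_Type"
    "Jordan_Normal_Form.Gauss_Jordan_Elimination"
    "Berlekamp_Zassenhaus.Finite_Field"
begin

section \<open>Graphs with an admissible automorphism\<close>

record ('v, 'h) agraph =
  verts :: "'v set"
  arrs :: "'h set"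
  src :: "'h \<Rightarrow> 'v"
  tgt :: "'h \<Rightarrow> 'v"
  vaut :: "'v \<Rightarrow> 'v"
  haut :: "'h \<Rightarrow> 'h"

definition vorbit :: "('v, 'h) agraph \<Rightarrow> 'v \<Rightarrow> 'v set" where
  "vorbit \<Gamma> v = Orbits.orbit (vaut \<Gamma>) v"

definition vorbits :: "('v, 'h) agraph \<Rightarrow> 'v set set" where
  "vorbits \<Gamma> = vorbit \<Gamma> ` verts \<Gamma>"

definition admissible :: "('v, 'h) agraph \<Rightarrow> bool" where
  "admissible \<Gamma> \<longleftrightarrow>
     finite (verts \<Gamma>) \<and> finite (arrs \<Gamma>) \<and>
     (\<forall>h\<in>arrs \<Gamma>. src \<Gamma> h \<in> verts \<Gamma> \<and> tgt \<Gamma> h \<in> verts \<Gamma> \<and> src \<Gamma> h \<noteq> tgt \<Gamma> h) \<and>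
     bij_betw (vaut \<Gamma>) (verts \<Gamma>) (verts \<Gamma>) \<and>
     bij_betw (haut \<Gamma>) (arrs \<Gamma>) (arrs \<Gamma>) \<and>
     (\<forall>h\<in>arrs \<Gamma>. src \<Gamma> (haut \<Gamma> h) = vaut \<Gamma> (src \<Gamma> h) \<and>
                 tgt \<Gamma> (haut \<Gamma> h) = vaut \<Gamma> (tgt \<Gamma> h)) \<and>
     (\<forall>h\<in>arrs \<Gamma>. vorbit \<Gamma> (src \<Gamma> h) \<noteq> vorbit \<Gamma> (tgt \<Gamma> h))"

definition arrs_within :: "('v, 'h) agraph \<Rightarrow> 'v set \<Rightarrow> 'h set" where
  "arrs_within \<Gamma> A = {h \<in> arrs \<Gamma>. src \<Gamma> h \<in> A \<and> tgt \<Gamma> h \<in> A}"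

definition cartan :: "('v, 'h) agraph \<Rightarrow> 'v set \<Rightarrow> 'v set \<Rightarrow> int" where
  "cartan \<Gamma> i j = (if i = j then 2 * int (card i) else - int (card (arrs_within \<Gamma> (i \<union> j))))"

definition contractible_pair :: "('v, 'h) agraph \<Rightarrow> 'v set \<Rightarrow> 'v set \<Rightarrow> bool" where
  "contractible_pair \<Gamma> ip im \<longleftrightarrow>
     ip \<in> vorbits \<Gamma> \<and> im \<in> vorbits \<Gamma> \<and>
     card ip = card im \<and> card im = card (arrs_within \<Gamma> (ip \<union> im)) \<and>
     (\<forall>h\<in>arrs_within \<Gamma> (ip \<union> im). src \<Gamma> h \<in> ip \<and> tgt \<Gamma> h \<in> im)"

definition arrs_pm :: "('v, 'h) agraph \<Rightarrow> 'v set \<Rightarrow> 'v set \<Rightarrow> 'h set" where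
  "arrs_pm \<Gamma> ip im = {h \<in> arrs \<Gamma>. src \<Gamma> h \<in> ip \<and> tgt \<Gamma> h \<in> im}"

text \<open>
  \<open>Comp h2 h1\<close> is the symbol $h_2h_1$ and \<open>BarComp h1 h2\<close> the symbol $\bar h_1h_2$.
\<close>

datatype 'h carrow = Keep 'h | Comp 'h 'h | BarComp 'h 'h

definition contract :: "('v, 'h) agraph \<Rightarrow> 'v set \<Rightarrow> 'v set \<Rightarrow> ('v, 'h carrow) agraph" where
  "contract \<Gamma> ip im =
     \<lparr>verts = verts \<Gamma> - im,
      arrs =
        {Keep h | h. h \<in> arrs \<Gamma> \<and> src \<Gamma> h \<notin> im \<and> tgt \<Gamma> h \<notin> im} \<union>
        {Comp h2 h1 | h2 h1. h1 \<in> arrs_pm \<Gamma> ip im \<and> h2 \<in> arrs \<Gamma> \<and> src \<Gamma> h2 = tgt \<Gamma> h1} \<union>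
        {BarComp h1 h2 | h1 h2. h1 \<in> arrs_pm \<Gamma> ip im \<and> h2 \<in> arrs \<Gamma> \<and>
           tgt \<Gamma> h2 = tgt \<Gamma> h1 \<and> src \<Gamma> h2 \<notin> ip},
      src = (\<lambda>k. case k of Keep h \<Rightarrow> src \<Gamma> h | Comp h2 h1 \<Rightarrow> src \<Gamma> h1 | BarComp h1 h2 \<Rightarrow> src \<Gamma> h2),
      tgt = (\<lambda>k. case k of Keep h \<Rightarrow> tgt \<Gamma> h | Comp h2 h1 \<Rightarrow> tgt \<Gamma> h2 | BarComp h1 h2 \<Rightarrow> src \<Gamma> h1),
      vaut = vaut \<Gamma>,
      haut = map_carrow (haut \<Gamma>)\<rparr>"


section \<open>Dimension vectors\<close>

type_synonym 'v dimvec = "'v set \<Rightarrow> nat"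

definition dimvecs :: "('v, 'h) agraph \<Rightarrow> 'v dimvec set" where
  "dimvecs \<Gamma> = {\<nu>. \<forall>i. i \<notin> vorbits \<Gamma> \<longrightarrow> \<nu> i = 0}"

text \<open>
  A vertex of the contracted graph has the same orbit (as a set) in both graphs, so an element
  of \<open>cdimvecs\<close> serves without change as a dimension vector on the contracted graph: its value
  at the orbit \<open>im\<close> is then simply never looked at.
\<close>

definition cdimvecs :: "('v, 'h) agraph \<Rightarrow> 'v set \<Rightarrow> 'v set \<Rightarrow> 'v dimvec set" where
  "cdimvecs \<Gamma> ip im = {\<nu> \<in> dimvecs \<Gamma>. \<nu> ip = \<nu> im}"

definition vdim :: "('v, 'h) agraph \<Rightarrow> 'v dimvec \<Rightarrow> 'v \<Rightarrow> nat" where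
  "vdim \<Gamma> \<nu> v = \<nu> (vorbit \<Gamma> v)"

definition dplus :: "'v dimvec \<Rightarrow> 'v dimvec \<Rightarrow> 'v dimvec" where
  "dplus \<tau> \<omega> = (\<lambda>i. \<tau> i + \<omega> i)"


section \<open>Representation spaces, groups and Frobenius maps\<close>

type_synonym ('h, 'k) rep = "'h \<Rightarrow> 'k mat"

abbreviation minv :: "'k::field mat \<Rightarrow> 'k mat" where
  "minv A \<equiv> the (mat_inverse A)"

text \<open>
  All constructions carry a set \<open>J\<close> of arrows and use the open part of the representation space
  on which \<open>x h\<close> is invertible for \<open>h \<in> J\<close>. The choice \<open>J = {}\<close> gives the
  whole space, the choice \<open>J = arrs_pm \<Gamma> ip im\<close> the part denoted by a heart.
\<close>

definition Esp :: "('v, 'h) agraph \<Rightarrow> 'h set \<Rightarrow> 'v dimvec \<Rightarrow> ('h, 'k::field) rep set" where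
  "Esp \<Gamma> J \<nu> =
     {x \<in> (\<Pi>\<^sub>E h\<in>arrs \<Gamma>. carrier_mat (vdim \<Gamma> \<nu> (tgt \<Gamma> h)) (vdim \<Gamma> \<nu> (src \<Gamma> h))).
        \<forall>h\<in>J. invertible_mat (x h)}"

definition Grp :: "('v, 'h) agraph \<Rightarrow> 'v dimvec \<Rightarrow> ('v \<Rightarrow> 'k::field mat) set" where
  "Grp \<Gamma> \<nu> =
     (\<Pi>\<^sub>E v\<in>verts \<Gamma>. {g \<in> carrier_mat (vdim \<Gamma> \<nu> v) (vdim \<Gamma> \<nu> v). invertible_mat g})"

definition gmul ::
  "('v, 'h) agraph \<Rightarrow> ('v \<Rightarrow> 'k::field mat) \<Rightarrow> ('v \<Rightarrow> 'k mat) \<Rightarrow> ('v \<Rightarrow> 'k mat)" where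
  "gmul \<Gamma> g g' = (\<lambda>v\<in>verts \<Gamma>. g v * g' v)"

definition act ::
  "('v, 'h) agraph \<Rightarrow> ('v \<Rightarrow> 'k::field mat) \<Rightarrow> ('h, 'k) rep \<Rightarrow> ('h, 'k) rep" where
  "act \<Gamma> g x = (\<lambda>h\<in>arrs \<Gamma>. g (tgt \<Gamma> h) * x h * minv (g (src \<Gamma> h)))"

definition frobE :: "('v, 'h) agraph \<Rightarrow> nat \<Rightarrow> ('h, 'k::field) rep \<Rightarrow> ('h, 'k) rep" where
  "frobE \<Gamma> q x = (\<lambda>h\<in>arrs \<Gamma>. map_mat (\<lambda>z. z ^ q) (x (inv_into (arrs \<Gamma>) (haut \<Gamma>) h)))"

definition frobG :: "('v, 'h) agraph \<Rightarrow> nat \<Rightarrow> ('v \<Rightarrow> 'k::field mat) \<Rightarrow> ('v \<Rightarrow> 'k mat)" where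
  "frobG \<Gamma> q g = (\<lambda>v\<in>verts \<Gamma>. map_mat (\<lambda>z. z ^ q) (g (inv_into (verts \<Gamma>) (vaut \<Gamma>) v)))"

definition EF :: "('v, 'h) agraph \<Rightarrow> 'h set \<Rightarrow> nat \<Rightarrow> 'v dimvec \<Rightarrow> ('h, 'k::field) rep set" where
  "EF \<Gamma> J q \<nu> = {x \<in> Esp \<Gamma> J \<nu>. frobE \<Gamma> q x = x}"

definition GF :: "('v, 'h) agraph \<Rightarrow> nat \<Rightarrow> 'v dimvec \<Rightarrow> ('v \<Rightarrow> 'k::field mat) set" where
  "GF \<Gamma> q \<nu> = {g \<in> Grp \<Gamma> \<nu>. frobG \<Gamma> q g = g}"


section \<open>Spaces of invariant functions\<close>

text \<open>The subfield of the complex numbers generated by \<open>s\<close>.\<close>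

inductive_set Qadj :: "complex \<Rightarrow> complex set" for s :: complex where
  gen: "s \<in> Qadj s"
| one: "1 \<in> Qadj s"
| diff: "a \<in> Qadj s \<Longrightarrow> b \<in> Qadj s \<Longrightarrow> a - b \<in> Qadj s"
| mult: "a \<in> Qadj s \<Longrightarrow> b \<in> Qadj s \<Longrightarrow> a * b \<in> Qadj s"
| inv: "a \<in> Qadj s \<Longrightarrow> inverse a \<in> Qadj s"

text \<open>
  Functions on a set of fixed points are represented by functions on the whole type that vanish
  off that set. The parameter \<open>s\<close> is the chosen square root of \<open>q\<close>.
\<close>

definition Hsp ::
  "('v, 'h) agraph \<Rightarrow> 'h set \<Rightarrow> nat \<Rightarrow> complex \<Rightarrow> 'v dimvec \<Rightarrow> (('h, 'k::field) rep \<Rightarrow> complex) set" where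
  "Hsp \<Gamma> J q s \<nu> =
     {f. (\<forall>x. f x \<in> Qadj s) \<and> (\<forall>x. x \<notin> EF \<Gamma> J q \<nu> \<longrightarrow> f x = 0) \<and>
         (\<forall>g\<in>GF \<Gamma> q \<nu>. \<forall>x\<in>EF \<Gamma> J q \<nu>. f (act \<Gamma> g x) = f x)}"

definition pull :: "('a \<Rightarrow> 'b) \<Rightarrow> ('b \<Rightarrow> complex) \<Rightarrow> ('a \<Rightarrow> complex)" where
  "pull \<phi> f = (\<lambda>x. f (\<phi> x))"

definition push :: "'a set \<Rightarrow> ('a \<Rightarrow> 'b) \<Rightarrow> ('a \<Rightarrow> complex) \<Rightarrow> ('b \<Rightarrow> complex)" where
  "push A \<phi> f = (\<lambda>y. \<Sum>x\<in>{x \<in> A. \<phi> x = y}. f x)"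


section \<open>Tensor products of function spaces\<close>

text \<open>
  A tensor product of two spaces of functions is the space of functions on pairs spanned by the
  products \<open>tens f g\<close>, and \<open>tens_map A B S T\<close> is the tensor product of two linear maps
  \<open>S\<close>, \<open>T\<close> defined on \<open>A\<close>, \<open>B\<close>.
\<close>

definition tens :: "('a \<Rightarrow> complex) \<Rightarrow> ('b \<Rightarrow> complex) \<Rightarrow> ('a \<times> 'b \<Rightarrow> complex)" where
  "tens f g = (\<lambda>(x, y). f x * g y)"

definition tens_map ::
  "('a \<Rightarrow> complex) set \<Rightarrow> ('b \<Rightarrow> complex) set \<Rightarrow>
   (('a \<Rightarrow> complex) \<Rightarrow> ('c \<Rightarrow> complex)) \<Rightarrow> (('b \<Rightarrow> complex) \<Rightarrow> ('d \<Rightarrow> complex)) \<Rightarrow>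
   ('a \<times> 'b \<Rightarrow> complex) \<Rightarrow> ('c \<times> 'd \<Rightarrow> complex)" where
  "tens_map A B S T \<Phi> =
     (THE \<Psi>. \<exists>(n::nat) f g. (\<forall>k<n. f k \<in> A \<and> g k \<in> B) \<and>
        \<Phi> = (\<lambda>z. \<Sum>k<n. tens (f k) (g k) z) \<and>
        \<Psi> = (\<lambda>z. \<Sum>k<n. tens (S (f k)) (T (g k)) z))"


section \<open>Induction and restriction\<close>

text \<open>
  In \<open>V = T \<oplus> W\<close> the first \<open>\<tau>\<close> coordinates span \<open>T\<close>, the last
  \<open>\<omega>\<close> coordinates span \<open>W\<close>; \<open>diagT\<close> and \<open>diagW\<close> are the matrices
  induced on \<open>V/W = T\<close> and on \<open>W\<close> by a matrix that leaves \<open>W\<close> stable.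
\<close>

definition Wsub :: "nat \<Rightarrow> nat \<Rightarrow> 'k::field vec set" where
  "Wsub t w = {v \<in> carrier_vec (t + w). \<forall>j<t. v $ j = 0}"

definition diagT :: "nat \<Rightarrow> nat \<Rightarrow> 'k::field mat \<Rightarrow> 'k mat" where
  "diagT t' t A = mat t' t (\<lambda>(i, j). A $$ (i, j))"

definition diagW :: "nat \<Rightarrow> nat \<Rightarrow> nat \<Rightarrow> nat \<Rightarrow> 'k::field mat \<Rightarrow> 'k mat" where
  "diagW t' w' t w A = mat w' w (\<lambda>(i, j). A $$ (t' + i, t + j))"

definition SW ::
  "('v, 'h) agraph \<Rightarrow> 'h set \<Rightarrow> 'v dimvec \<Rightarrow> 'v dimvec \<Rightarrow> ('h, 'k::field) rep set" where
  "SW \<Gamma> J \<tau> \<omega> =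
     {x \<in> Esp \<Gamma> J (dplus \<tau> \<omega>). \<forall>h\<in>arrs \<Gamma>.
        \<forall>w\<in>Wsub (vdim \<Gamma> \<tau> (src \<Gamma> h)) (vdim \<Gamma> \<omega> (src \<Gamma> h)).
          x h *\<^sub>v w \<in> Wsub (vdim \<Gamma> \<tau> (tgt \<Gamma> h)) (vdim \<Gamma> \<omega> (tgt \<Gamma> h))}"

definition xT :: "('v, 'h) agraph \<Rightarrow> 'v dimvec \<Rightarrow> ('h, 'k::field) rep \<Rightarrow> ('h, 'k) rep" where
  "xT \<Gamma> \<tau> x =
     (\<lambda>h\<in>arrs \<Gamma>. diagT (vdim \<Gamma> \<tau> (tgt \<Gamma> h)) (vdim \<Gamma> \<tau> (src \<Gamma> h)) (x h))"

definition xW ::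
  "('v, 'h) agraph \<Rightarrow> 'v dimvec \<Rightarrow> 'v dimvec \<Rightarrow> ('h, 'k::field) rep \<Rightarrow> ('h, 'k) rep" where
  "xW \<Gamma> \<tau> \<omega> x =
     (\<lambda>h\<in>arrs \<Gamma>. diagW (vdim \<Gamma> \<tau> (tgt \<Gamma> h)) (vdim \<Gamma> \<omega> (tgt \<Gamma> h))
                      (vdim \<Gamma> \<tau> (src \<Gamma> h)) (vdim \<Gamma> \<omega> (src \<Gamma> h)) (x h))"

definition kappa ::
  "('v, 'h) agraph \<Rightarrow> 'v dimvec \<Rightarrow> 'v dimvec \<Rightarrow> ('h, 'k::field) rep \<Rightarrow>
   ('h, 'k) rep \<times> ('h, 'k) rep" where
  "kappa \<Gamma> \<tau> \<omega> x = (xT \<Gamma> \<tau> x, xW \<Gamma> \<tau> \<omega> x)"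

definition Qgrp :: "('v, 'h) agraph \<Rightarrow> 'v dimvec \<Rightarrow> 'v dimvec \<Rightarrow> ('v \<Rightarrow> 'k::field mat) set" where
  "Qgrp \<Gamma> \<tau> \<omega> =
     {g \<in> Grp \<Gamma> (dplus \<tau> \<omega>). \<forall>v\<in>verts \<Gamma>.
        (\<lambda>w. g v *\<^sub>v w) ` Wsub (vdim \<Gamma> \<tau> v) (vdim \<Gamma> \<omega> v) = Wsub (vdim \<Gamma> \<tau> v) (vdim \<Gamma> \<omega> v)}"

text \<open>
  The unipotent radical of the parabolic subgroup \<open>Qgrp\<close> is the kernel of its action on
  \<open>V/W\<close> and \<open>W\<close>.
\<close>

definition Ugrp :: "('v, 'h) agraph \<Rightarrow> 'v dimvec \<Rightarrow> 'v dimvec \<Rightarrow> ('v \<Rightarrow> 'k::field mat) set" where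
  "Ugrp \<Gamma> \<tau> \<omega> =
     {g \<in> Qgrp \<Gamma> \<tau> \<omega>. \<forall>v\<in>verts \<Gamma>.
        diagT (vdim \<Gamma> \<tau> v) (vdim \<Gamma> \<tau> v) (g v) = 1\<^sub>m (vdim \<Gamma> \<tau> v) \<and>
        diagW (vdim \<Gamma> \<tau> v) (vdim \<Gamma> \<omega> v) (vdim \<Gamma> \<tau> v) (vdim \<Gamma> \<omega> v) (g v)
          = 1\<^sub>m (vdim \<Gamma> \<omega> v)}"

text \<open>
  For a subgroup \<open>K\<close> of \<open>Qgrp\<close>, the twisted product of \<open>Grp\<close> and \<open>SW\<close> over
  \<open>K\<close> is the quotient by the relation identifying \<open>(g u, x)\<close> with \<open>(g, u.x)\<close>
  for \<open>u \<in> K\<close>.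
\<close>

definition twrel ::
  "('v, 'h) agraph \<Rightarrow> 'h set \<Rightarrow> 'v dimvec \<Rightarrow> 'v dimvec \<Rightarrow> ('v \<Rightarrow> 'k::field mat) set \<Rightarrow>
   (('v \<Rightarrow> 'k mat) \<times> ('h, 'k) rep) rel" where
  "twrel \<Gamma> J \<tau> \<omega> K =
     {((g', x), (g, x')) | g' x g x'.
        g' \<in> Grp \<Gamma> (dplus \<tau> \<omega>) \<and> g \<in> Grp \<Gamma> (dplus \<tau> \<omega>) \<and>
        x \<in> SW \<Gamma> J \<tau> \<omega> \<and> x' \<in> SW \<Gamma> J \<tau> \<omega> \<and>
        (\<exists>u\<in>K. g' = gmul \<Gamma> g u \<and> x' = act \<Gamma> u x)}"

definition twprod ::
  "('v, 'h) agraph \<Rightarrow> 'h set \<Rightarrow> 'v dimvec \<Rightarrow> 'v dimvec \<Rightarrow> ('v \<Rightarrow> 'k::field mat) set \<Rightarrow>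
   (('v \<Rightarrow> 'k mat) \<times> ('h, 'k) rep) set set" where
  "twprod \<Gamma> J \<tau> \<omega> K = (Grp \<Gamma> (dplus \<tau> \<omega>) \<times> SW \<Gamma> J \<tau> \<omega>) // twrel \<Gamma> J \<tau> \<omega> K"

text \<open>
  Frobenius-fixed points of the quotient itself: these are the classes stable under Frobenius,
  not only the classes of Frobenius-fixed pairs.
\<close>

definition twprodF ::
  "('v, 'h) agraph \<Rightarrow> 'h set \<Rightarrow> nat \<Rightarrow> 'v dimvec \<Rightarrow> 'v dimvec \<Rightarrow> ('v \<Rightarrow> 'k::field mat) set \<Rightarrow>
   (('v \<Rightarrow> 'k mat) \<times> ('h, 'k) rep) set set" where
  "twprodF \<Gamma> J q \<tau> \<omega> K =
     {C \<in> twprod \<Gamma> J \<tau> \<omega> K. map_prod (frobG \<Gamma> q) (frobE \<Gamma> q) ` C = C}"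

definition p1 ::
  "('v, 'h) agraph \<Rightarrow> 'v dimvec \<Rightarrow> 'v dimvec \<Rightarrow> (('v \<Rightarrow> 'k::field mat) \<times> ('h, 'k) rep) set \<Rightarrow>
   ('h, 'k) rep \<times> ('h, 'k) rep" where
  "p1 \<Gamma> \<tau> \<omega> C = the_elem ((\<lambda>(g, x). (xT \<Gamma> \<tau> x, xW \<Gamma> \<tau> \<omega> x)) ` C)"

definition p2 ::
  "('v, 'h) agraph \<Rightarrow> 'h set \<Rightarrow> 'v dimvec \<Rightarrow> 'v dimvec \<Rightarrow>
   (('v \<Rightarrow> 'k::field mat) \<times> ('h, 'k) rep) set \<Rightarrow> (('v \<Rightarrow> 'k mat) \<times> ('h, 'k) rep) set" where
  "p2 \<Gamma> J \<tau> \<omega> C = twrel \<Gamma> J \<tau> \<omega> (Qgrp \<Gamma> \<tau> \<omega>) `` C"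

definition p3 ::
  "('v, 'h) agraph \<Rightarrow> (('v \<Rightarrow> 'k::field mat) \<times> ('h, 'k) rep) set \<Rightarrow> ('h, 'k) rep" where
  "p3 \<Gamma> C = the_elem ((\<lambda>(g, x). act \<Gamma> g x) ` C)"

definition mOm :: "('v, 'h) agraph \<Rightarrow> 'v dimvec \<Rightarrow> 'v dimvec \<Rightarrow> int" where
  "mOm \<Gamma> \<tau> \<omega> =
     (\<Sum>v\<in>verts \<Gamma>. int (vdim \<Gamma> \<tau> v) * int (vdim \<Gamma> \<omega> v)) +
     (\<Sum>h\<in>arrs \<Gamma>. int (vdim \<Gamma> \<tau> (src \<Gamma> h)) * int (vdim \<Gamma> \<omega> (tgt \<Gamma> h)))"

definition mstarOm :: "('v, 'h) agraph \<Rightarrow> 'v dimvec \<Rightarrow> 'v dimvec \<Rightarrow> int" where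
  "mstarOm \<Gamma> \<tau> \<omega> =
     - (\<Sum>v\<in>verts \<Gamma>. int (vdim \<Gamma> \<tau> v) * int (vdim \<Gamma> \<omega> v)) +
     (\<Sum>h\<in>arrs \<Gamma>. int (vdim \<Gamma> \<tau> (src \<Gamma> h)) * int (vdim \<Gamma> \<omega> (tgt \<Gamma> h)))"

definition Ind ::
  "('v, 'h) agraph \<Rightarrow> 'h set \<Rightarrow> nat \<Rightarrow> complex \<Rightarrow> 'v dimvec \<Rightarrow> 'v dimvec \<Rightarrow>
   (('h, 'k::field) rep \<times> ('h, 'k) rep \<Rightarrow> complex) \<Rightarrow> (('h, 'k) rep \<Rightarrow> complex)" where
  "Ind \<Gamma> J q s \<tau> \<omega> \<Phi> = (\<lambda>y.
     s powi (- mOm \<Gamma> \<tau> \<omega>) *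
     (1 / of_nat (card ((GF \<Gamma> q \<tau> :: ('v \<Rightarrow> 'k mat) set) \<times> (GF \<Gamma> q \<omega> :: ('v \<Rightarrow> 'k mat) set)))) *
     push (twprodF \<Gamma> J q \<tau> \<omega> (Qgrp \<Gamma> \<tau> \<omega>)) (p3 \<Gamma>)
       (push (twprodF \<Gamma> J q \<tau> \<omega> (Ugrp \<Gamma> \<tau> \<omega>)) (p2 \<Gamma> J \<tau> \<omega>)
         (pull (p1 \<Gamma> \<tau> \<omega>) \<Phi>)) y)"

definition Res ::
  "('v, 'h) agraph \<Rightarrow> 'h set \<Rightarrow> nat \<Rightarrow> complex \<Rightarrow> 'v dimvec \<Rightarrow> 'v dimvec \<Rightarrow>
   (('h, 'k::field) rep \<Rightarrow> complex) \<Rightarrow> (('h, 'k) rep \<times> ('h, 'k) rep \<Rightarrow> complex)" where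
  "Res \<Gamma> J q s \<tau> \<omega> f = (\<lambda>z.
     s powi (- mstarOm \<Gamma> \<tau> \<omega>) *
     push {x \<in> SW \<Gamma> J \<tau> \<omega>. frobE \<Gamma> q x = x} (kappa \<Gamma> \<tau> \<omega>) (pull (\<lambda>x. x) f) z)"


section \<open>Hall algebras\<close>

type_synonym ('v, 'h, 'k) hall = "'v dimvec \<Rightarrow> ('h, 'k) rep \<Rightarrow> complex"

text \<open>The direct sum over the dimension vectors in \<open>D\<close>, as an algebra over
  \<open>Qadj s\<close>; its unit is the function 1 on the one-point space of dimension 0.\<close>

definition hall_algebra ::
  "('v, 'h) agraph \<Rightarrow> 'h set \<Rightarrow> 'v dimvec set \<Rightarrow> nat \<Rightarrow> complex \<Rightarrow>
   (complex, ('v, 'h, 'k::field) hall) module" where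
  "hall_algebra \<Gamma> J D q s =
     \<lparr>partial_object.carrier =
        {f. (\<forall>\<nu>\<in>D. f \<nu> \<in> Hsp \<Gamma> J q s \<nu>) \<and> (\<forall>\<nu>. \<nu> \<notin> D \<longrightarrow> f \<nu> = (\<lambda>_. 0)) \<and>
          finite {\<nu>. f \<nu> \<noteq> (\<lambda>_. 0)}},
      monoid.mult = (\<lambda>f g \<nu> x. \<Sum>(\<tau>, \<omega>)\<in>{(\<tau>, \<omega>). \<tau> \<in> D \<and> \<omega> \<in> D \<and> dplus \<tau> \<omega> = \<nu>}.
                Ind \<Gamma> J q s \<tau> \<omega> (tens (f \<tau>) (g \<omega>)) x),
      monoid.one = (\<lambda>\<nu> x. if \<nu> = (\<lambda>_. 0) \<and> x \<in> EF \<Gamma> J q \<nu> then 1 else 0),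
      ring.zero = (\<lambda>\<nu> x. 0),
      ring.add = (\<lambda>f g \<nu> x. f \<nu> x + g \<nu> x),
      module.smult = (\<lambda>c f \<nu> x. c * f \<nu> x)\<rparr>"

definition alg_hom ::
  "complex set \<Rightarrow> (complex, 'a) module \<Rightarrow> (complex, 'b) module \<Rightarrow> ('a \<Rightarrow> 'b) set" where
  "alg_hom K A B =
     {\<phi> \<in> Ring.ring_hom A B. \<forall>c\<in>K. \<forall>a\<in>carrier A. \<phi> (c \<odot>\<^bsub>A\<^esub> a) = c \<odot>\<^bsub>B\<^esub> \<phi> a}"

definition H_full ::
  "('v, 'h) agraph \<Rightarrow> nat \<Rightarrow> complex \<Rightarrow> (complex, ('v, 'h, 'k::field) hall) module" where
  "H_full \<Gamma> q s = hall_algebra \<Gamma> {} (dimvecs \<Gamma>) q s"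

definition H_heart ::
  "('v, 'h) agraph \<Rightarrow> 'v set \<Rightarrow> 'v set \<Rightarrow> nat \<Rightarrow> complex \<Rightarrow>
   (complex, ('v, 'h, 'k::field) hall) module" where
  "H_heart \<Gamma> ip im q s = hall_algebra \<Gamma> (arrs_pm \<Gamma> ip im) (cdimvecs \<Gamma> ip im) q s"

definition H_contr ::
  "('v, 'h) agraph \<Rightarrow> 'v set \<Rightarrow> 'v set \<Rightarrow> nat \<Rightarrow> complex \<Rightarrow>
   (complex, ('v, 'h carrow, 'k::field) hall) module" where
  "H_contr \<Gamma> ip im q s = hall_algebra (contract \<Gamma> ip im) {} (cdimvecs \<Gamma> ip im) q s"


section \<open>The maps between the Hall algebras\<close>

definition mu ::
  "('v, 'h) agraph \<Rightarrow> 'v set \<Rightarrow> 'v set \<Rightarrow> ('h, 'k::field) rep \<Rightarrow> ('h carrow, 'k) rep" where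
  "mu \<Gamma> ip im x = (\<lambda>k\<in>arrs (contract \<Gamma> ip im).
     case k of Keep h \<Rightarrow> x h | Comp h2 h1 \<Rightarrow> x h2 * x h1 | BarComp h1 h2 \<Rightarrow> minv (x h1) * x h2)"

definition mu_star_nu ::
  "('v, 'h) agraph \<Rightarrow> 'v set \<Rightarrow> 'v set \<Rightarrow> nat \<Rightarrow> complex \<Rightarrow> 'v dimvec \<Rightarrow>
   (('h carrow, 'k::field) rep \<Rightarrow> complex) \<Rightarrow> (('h, 'k) rep \<Rightarrow> complex)" where
  "mu_star_nu \<Gamma> ip im q s \<nu> f = (\<lambda>x.
     if x \<in> EF \<Gamma> (arrs_pm \<Gamma> ip im) q \<nu>
     then s powi (- (((int (\<nu> im))\<^sup>2 * cartan \<Gamma> im im) div 2)) * pull (mu \<Gamma> ip im) f x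
     else 0)"

definition mu_star ::
  "('v, 'h) agraph \<Rightarrow> 'v set \<Rightarrow> 'v set \<Rightarrow> nat \<Rightarrow> complex \<Rightarrow>
   ('v, 'h carrow, 'k::field) hall \<Rightarrow> ('v, 'h, 'k) hall" where
  "mu_star \<Gamma> ip im q s f = (\<lambda>\<nu>. mu_star_nu \<Gamma> ip im q s \<nu> (f \<nu>))"

definition j_shriek_nu ::
  "('v, 'h) agraph \<Rightarrow> 'v set \<Rightarrow> 'v set \<Rightarrow> nat \<Rightarrow> 'v dimvec \<Rightarrow>
   (('h, 'k::field) rep \<Rightarrow> complex) \<Rightarrow> (('h, 'k) rep \<Rightarrow> complex)" where
  "j_shriek_nu \<Gamma> ip im q \<nu> f = (\<lambda>x. if x \<in> EF \<Gamma> (arrs_pm \<Gamma> ip im) q \<nu> then f x else 0)"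

definition j_shriek ::
  "('v, 'h) agraph \<Rightarrow> 'v set \<Rightarrow> 'v set \<Rightarrow> nat \<Rightarrow>
   ('v, 'h, 'k::field) hall \<Rightarrow> ('v, 'h, 'k) hall" where
  "j_shriek \<Gamma> ip im q f = (\<lambda>\<nu>. j_shriek_nu \<Gamma> ip im q \<nu> (f \<nu>))"

definition psi ::
  "('v, 'h) agraph \<Rightarrow> 'v set \<Rightarrow> 'v set \<Rightarrow> nat \<Rightarrow> complex \<Rightarrow>
   ('v, 'h carrow, 'k::field) hall \<Rightarrow> ('v, 'h, 'k) hall" where
  "psi \<Gamma> ip im q s = j_shriek \<Gamma> ip im q \<circ> mu_star \<Gamma> ip im q s"

text \<open>An algebraic closure of the prime field with \<open>CARD('p)\<close> elements.\<close>

type_synonym 'p Fbar = "'p mod_ring alg_closure"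

end

theory Submission
  imports Defs "Jordan_Normal_Form.Determinant"
begin

text \<open>
  The idea is that the open part $\mathbf E^\heartsuit_{\nu,\Omega}$ is a product: a representation
  \<open>x\<close> in it is the same thing as its contraction \<open>\<mu> x\<close> together with the invertible matrices
  \<open>x h\<close> on the arrows \<open>h\<close> from $i_+$ to $i_-$. Every other arrow of the graph survives in the
  contracted graph as exactly one arrow, whose matrix is \<open>x h\<close> composed with such an \<open>x h1\<close> or its
  inverse wherever \<open>h\<close> touches $i_-$, and from these products \<open>x h\<close> can be recovered (\<open>mu_inj\<close>,
  \<open>lift\<close>). The arrows from $i_+$ to $i_-$ match the two orbits bijectively and compatibly with the
  automorphism (\<open>pm_bij\<close>), so the correspondence respects Frobenius, the group actions, and the
  condition of leaving a coordinate subspace stable. What remains for each statement is to count how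
  many objects over the graph lie above one object over the contracted graph, and to see that the
  powers of $q^{1/2}$ absorb this number.

  Induction. The points of $\mathbf E'$ and $\mathbf E''$ over a point \<open>y\<close> are the cosets of $U$ and
  of $Q$ in the set of \<open>g\<close> with $g^{-1}y\in S_W$, and \<open>Ind\<close> is a double sum over those that are stable
  under Frobenius (\<open>Ind_eq\<close>). Forget the components of \<open>g\<close> at $i_-$. On cosets of $Q$ this is a
  bijection, because \<open>y\<close> is invertible on the arrows from $i_+$ to $i_-$, so that a subspace stable
  under \<open>y\<close> is determined at $i_-$ by what it is at $i_+$. On cosets of $U$ the fibres are the rational points of the Levi subgroup at $i_-$
  (\<open>coset_rel_proj\<close>, \<open>lift_over\<close>). By \<open>card_GF\<close> their number is exactly the factor by which the orders
  of the groups in the normalization of \<open>Ind\<close> differ, so \<open>mu_star_Ind\<close> becomes an identity between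
  exponents: $m_\Omega$ grows by $2\#i_-\tau_{i_-}\omega_{i_-}$, which is the difference between
  $\#i_-\nu_{i_-}^2$ and $\#i_-(\tau_{i_-}^2+\omega_{i_-}^2)$.

  Restriction. In the fibre of $\kappa$ over a pair, \<open>x\<close> corresponds to the point \<open>\<mu> x\<close> of the fibre
  of $\widehat\kappa$ together with the lower left blocks of \<open>x\<close> on the arrows from $i_+$ to $i_-$
  (\<open>restriction_fibre_bij\<close>). Since these arrows form one orbit of length $\#i_-$, there are
  $q^{\#i_-\tau_{i_-}\omega_{i_-}}$ rational choices of the blocks (\<open>card_corners\<close>), and this is again
  the cross term of $\nu_{i_-}^2$, while $m^*_\Omega$ does not change.

  Extension by zero. A block triangular matrix with square diagonal blocks is invertible if and only
  if its diagonal blocks are. Hence whether \<open>x\<close> in $S_W$ lies in the open part can be read off from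
  the pair $(x^T,x^W)$, and the sums that define induction and restriction for the open part and for
  the whole space agree term by term.

  The restriction formulas also involve tensor products of linear maps. Both \<open>mu_star_nu\<close> and
  \<open>j_shriek_nu\<close> multiply by a fixed function after composing with a fixed map, so their tensor
  product acts in the same way on functions on pairs (\<open>tens_map_eq\<close>), provided that \<open>Res f\<close> is a
  finite sum of products of invariant functions (\<open>Res_decomposition\<close>). Injectivity of \<open>psi\<close> is the
  surjectivity of \<open>\<mu>\<close> on rational points.
\<close>

section \<open>Invertible matrices\<close>

text \<open>
  In this form, with dimensions instead of carrier sets, the simplifier can discharge the premises of
  the matrix laws by itself.
\<close>

lemma mat_assoc:
  fixes A B C :: "'k::semiring_0 mat"
  shows "dim_col A = dim_row B \<Longrightarrow> dim_col B = dim_row C \<Longrightarrow> A * B * C = A * (B * C)"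
  by (rule assoc_mult_mat[where ?n\<^sub>1="dim_row A" and ?n\<^sub>2="dim_row B" and ?n\<^sub>3="dim_row C" and ?n\<^sub>4="dim_col C"]) auto

lemma mat_one_mult:
  fixes A :: "'k::semiring_1 mat"
  shows "dim_row A = n \<Longrightarrow> 1\<^sub>m n * A = A" and "dim_col A = n \<Longrightarrow> A * 1\<^sub>m n = A"
  by (auto intro: left_mult_one_mat right_mult_one_mat)

lemma invertible_square: "invertible_mat A \<Longrightarrow> dim_col A = dim_row A"
  by (simp add: invertible_mat_def)

lemma invertibleI:
  fixes A B :: "'k::field mat"
  assumes "A * B = 1\<^sub>m (dim_row A)" "B * A = 1\<^sub>m (dim_row A)" "dim_row B = dim_row A"
  shows "invertible_mat A"
proof -
  have "dim_col A = dim_row A" using arg_cong[OF assms(2), of dim_col] by simp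
  then show ?thesis using assms by (auto simp: invertible_mat_def inverts_mat_def)
qed

lemma unit_ring_mat_iff:
  "A \<in> Units (ring_mat TYPE('k::field) n b) \<longleftrightarrow>
     A \<in> carrier_mat n n \<and> (\<exists>B\<in>carrier_mat n n. A * B = 1\<^sub>m n \<and> B * A = 1\<^sub>m n)"
  unfolding Units_def ring_mat_def by auto

lemma minv_props:
  fixes A :: "'k::field mat"
  assumes "invertible_mat A"
  shows "A * minv A = 1\<^sub>m (dim_row A)" "minv A * A = 1\<^sub>m (dim_row A)"
    "dim_row (minv A) = dim_row A" "dim_col (minv A) = dim_row A" "invertible_mat (minv A)"
proof -
  let ?n = "dim_row A"
  have A: "A \<in> carrier_mat ?n ?n" using assms by (auto simp: invertible_mat_def)
  obtain B where B: "A * B = 1\<^sub>m ?n" "B * A = 1\<^sub>m (dim_row B)"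
    using assms by (auto simp: invertible_mat_def inverts_mat_def)
  have "dim_col B = ?n" "dim_col A = dim_row B"
    using arg_cong[OF B(1), of dim_col] arg_cong[OF B(2), of dim_col] by simp_all
  then have Bc: "B \<in> carrier_mat ?n ?n" using carrier_matD(2)[OF A] by (metis carrier_matI)
  have "B * A = 1\<^sub>m ?n" using B(2) Bc by (metis carrier_matD(1))
  then have "A \<in> Units (ring_mat TYPE('k) ?n ())"
    unfolding unit_ring_mat_iff using A B(1) Bc by blast
  then obtain C where C: "mat_inverse A = Some C"
    using mat_inverse(1)[OF A, of "()"] by (cases "mat_inverse A") auto
  then have *: "A * C = 1\<^sub>m ?n" "C * A = 1\<^sub>m ?n" "C \<in> carrier_mat ?n ?n"
    using mat_inverse(2)[OF A] by auto
  show m: "A * minv A = 1\<^sub>m ?n" "minv A * A = 1\<^sub>m ?n"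
    and d: "dim_row (minv A) = dim_row A" "dim_col (minv A) = dim_row A"
    using * C carrier_matD[of C] by (simp_all only: option.sel)
  show "invertible_mat (minv A)"
    by (rule invertibleI[of _ A]) (simp_all only: m d)
qed

lemma minv_cancel:
  fixes A B :: "'k::field mat"
  assumes "invertible_mat A" "dim_row B = dim_row A"
  shows "minv A * (A * B) = B" "A * (minv A * B) = B"
  using assms by (simp_all add: mat_assoc[symmetric] minv_props invertible_square mat_one_mult)

lemma minv_unique:
  fixes A B :: "'k::field mat"
  assumes "invertible_mat A" "A * B = 1\<^sub>m (dim_row A)" "dim_row B = dim_row A"
  shows "minv A = B"
proof -
  have "minv A = minv A * (A * B)" using assms by (simp add: mat_one_mult minv_props)
  also have "\<dots> = B" using assms(1,3) by (rule minv_cancel(1))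
  finally show ?thesis .
qed

lemma invertible_mult:
  fixes A B :: "'k::field mat"
  assumes "invertible_mat A" "invertible_mat B" "dim_row B = dim_row A"
  shows "invertible_mat (A * B)" "minv (A * B) = minv B * minv A"
proof -
  have *: "A * B * (minv B * minv A) = 1\<^sub>m (dim_row A)"  "minv B * minv A * (A * B) = 1\<^sub>m (dim_row A)"
    using assms by (simp_all add: mat_assoc minv_props minv_cancel invertible_square)
  then show "invertible_mat (A * B)"
    using assms by (intro invertibleI[where B="minv B * minv A"]) (auto simp: minv_props)
  then show "minv (A * B) = minv B * minv A"
    using * assms by (intro minv_unique) (auto simp: minv_props)
qed

lemma minv_minv: "invertible_mat A \<Longrightarrow> minv (minv A) = (A :: 'k::field mat)"
  by (rule minv_unique) (auto simp: minv_props)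

lemma invertible_one: "invertible_mat (1\<^sub>m n :: 'k::field mat)" "minv (1\<^sub>m n :: 'k mat) = 1\<^sub>m n"
proof -
  show "invertible_mat (1\<^sub>m n :: 'k mat)" by (rule invertibleI[where B="1\<^sub>m n"]) auto
  then show "minv (1\<^sub>m n :: 'k mat) = 1\<^sub>m n" by (rule minv_unique) auto
qed

lemma invertible_mult_iff:
  fixes A B :: "'k::field mat"
  assumes "dim_col A = dim_row B"
  shows "invertible_mat A \<Longrightarrow> invertible_mat (A * B) \<longleftrightarrow> invertible_mat B"
    and "invertible_mat B \<Longrightarrow> invertible_mat (A * B) \<longleftrightarrow> invertible_mat A"
proof -
  assume A: "invertible_mat A"
  have d: "dim_row B = dim_row A" using A assms by (simp add: invertible_square)
  have "invertible_mat (minv A * (A * B))" if "invertible_mat (A * B)"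
    by (rule invertible_mult(1)) (use that A in \<open>auto simp: minv_props\<close>)
  then show "invertible_mat (A * B) \<longleftrightarrow> invertible_mat B"
    using A d invertible_mult(1)[OF A _ d] by (auto simp: minv_cancel(1)[OF A d])
next
  assume B: "invertible_mat B"
  have "invertible_mat (A * B * minv B)" if "invertible_mat (A * B)"
    by (rule invertible_mult(1)) (use that B assms invertible_square[OF that] invertible_square[OF B]
        in \<open>auto simp: minv_props\<close>)
  moreover have "A * B * minv B = A"
    using B assms by (simp add: mat_assoc minv_props mat_one_mult invertible_square)
  moreover have "invertible_mat (A * B)" if "invertible_mat A"
    using that B assms by (intro invertible_mult) (auto simp: invertible_square)
  ultimately show "invertible_mat (A * B) \<longleftrightarrow> invertible_mat A" by auto
qed

lemma invertible_det:
  fixes A :: "'k::field mat"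
  assumes A: "A \<in> carrier_mat n n"
  shows "invertible_mat A \<longleftrightarrow> det A \<noteq> 0"
proof
  assume inv: "invertible_mat A"
  have n: "dim_row A = n" using A by simp
  have "det (A * minv A) = det A * det (minv A)"
    using A minv_props(3,4)[OF inv] by (intro det_mult[where n=n]) auto
  then show "det A \<noteq> 0" unfolding minv_props(1)[OF inv] by auto
next
  assume "det A \<noteq> 0"
  then obtain B where B: "B \<in> carrier_mat n n" "A * B = 1\<^sub>m n" "B * A = 1\<^sub>m n"
    using det_non_zero_imp_unit[OF A] unfolding unit_ring_mat_iff by blast
  then show "invertible_mat A" using A by (intro invertibleI[where B=B]) auto
qed

section \<open>Block-triangular matrices\<close>

text \<open>
  For \<open>r = t'\<close> and \<open>c = t\<close> these are the matrices $k^{t+w}\to k^{t'+w'}$ that carry the span of the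
  last \<open>w\<close> coordinates into the span of the last \<open>w'\<close> coordinates (\<open>stable_iff_low\<close>).
\<close>

definition low :: "nat \<Rightarrow> nat \<Rightarrow> 'k::zero mat \<Rightarrow> bool" where
  "low r c A \<longleftrightarrow> (\<forall>i<r. \<forall>j. c \<le> j \<longrightarrow> j < dim_col A \<longrightarrow> A $$ (i, j) = 0)"

definition lowerleft :: "nat \<Rightarrow> nat \<Rightarrow> nat \<Rightarrow> 'k mat \<Rightarrow> 'k mat" where
  "lowerleft t' w' t A = mat w' t (\<lambda>(i, j). A $$ (t' + i, j))"

abbreviation block_lower :: "'k::zero mat \<Rightarrow> 'k mat \<Rightarrow> 'k mat \<Rightarrow> 'k mat" where
  "block_lower a c d \<equiv> four_block_mat a (0\<^sub>m (dim_row a) (dim_col d)) c d"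

lemma diag_dims:
  "dim_row (diagT t' t A) = t'" "dim_col (diagT t' t A) = t"
  "dim_row (diagW t' w' t w A) = w'" "dim_col (diagW t' w' t w A) = w"
  "dim_row (lowerleft t' w' t A) = w'" "dim_col (lowerleft t' w' t A) = t"
  by (auto simp: diagT_def diagW_def lowerleft_def)

lemma low_one: "low r r (1\<^sub>m n)"
  by (auto simp: low_def)

lemma index_mult:
  fixes A B :: "'k::field mat"
  assumes "i < dim_row A" "j < dim_col B" "dim_col A = dim_row B"
  shows "(A * B) $$ (i, j) = (\<Sum>k<dim_row B. A $$ (i, k) * B $$ (k, j))"
  using assms by (auto simp: scalar_prod_def atLeast0LessThan intro!: sum.cong)

lemma low_mult:
  fixes A B :: "'k::field mat"
  assumes "low r m A" "low m c B" "dim_col A = dim_row B" "r \<le> dim_row A"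
  shows "low r c (A * B)"
proof -
  have "A $$ (i, k) * B $$ (k, j) = 0" if "i < r" "c \<le> j" "j < dim_col B" "k < dim_row B" for i j k
    using that assms by (cases "k < m") (auto simp: low_def)
  then show ?thesis
    using assms by (auto simp: low_def simp del: index_mult_mat(1) simp: index_mult intro!: sum.neutral)
qed

lemma diagT_mult:
  fixes A B :: "'k::field mat"
  assumes "low t'' t' A" "dim_row B = t' + w'" "dim_col A = t' + w'" "t'' \<le> dim_row A" "t \<le> dim_col B"
  shows "diagT t'' t (A * B) = diagT t'' t' A * diagT t' t B"
proof (rule eq_matI)
  fix i j assume "i < dim_row (diagT t'' t' A * diagT t' t B)" "j < dim_col (diagT t'' t' A * diagT t' t B)"
  then have ij: "i < t''" "j < t" by (auto simp: diag_dims)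
  have "(\<Sum>k<t'+w'. A $$ (i, k) * B $$ (k, j)) = (\<Sum>k<t'. A $$ (i, k) * B $$ (k, j))"
    using ij assms by (intro sum.mono_neutral_right) (auto simp: low_def)
  then show "diagT t'' t (A * B) $$ (i, j) = (diagT t'' t' A * diagT t' t B) $$ (i, j)"
    using ij assms by (simp add: index_mult diag_dims del: index_mult_mat(1)) (simp add: index_mult diagT_def del: index_mult_mat(1))
qed (auto simp: diag_dims)

lemma diagW_mult:
  fixes A B :: "'k::field mat"
  assumes "low t' t B" "dim_row B = t' + w'" "dim_col A = t' + w'" "dim_row A = t'' + w''" "dim_col B = t + w"
  shows "diagW t'' w'' t w (A * B) = diagW t'' w'' t' w' A * diagW t' w' t w B"
proof (rule eq_matI)
  fix i j assume "i < dim_row (diagW t'' w'' t' w' A * diagW t' w' t w B)" "j < dim_col (diagW t'' w'' t' w' A * diagW t' w' t w B)"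
  then have ij: "i < w''" "j < w" by (auto simp: diag_dims)
  have "(\<Sum>k<t'+w'. A $$ (t'' + i, k) * B $$ (k, t + j)) = (\<Sum>k\<in>{t'..<t'+w'}. A $$ (t'' + i, k) * B $$ (k, t + j))"
    using ij assms by (intro sum.mono_neutral_right) (auto simp: low_def)
  also have "\<dots> = (\<Sum>k<w'. A $$ (t'' + i, t' + k) * B $$ (t' + k, t + j))"
    by (rule sum.reindex_bij_witness[of _ "\<lambda>k. t' + k" "\<lambda>k. k - t'"]) auto
  finally show "diagW t'' w'' t w (A * B) $$ (i, j) = (diagW t'' w'' t' w' A * diagW t' w' t w B) $$ (i, j)"
    using ij assms by (simp add: index_mult diag_dims del: index_mult_mat(1)) (simp add: index_mult diagW_def del: index_mult_mat(1))
qed (auto simp: diag_dims)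

lemma diag_one: "diagT t t (1\<^sub>m (t + w)) = 1\<^sub>m t" "diagW t w t w (1\<^sub>m (t + w)) = 1\<^sub>m w"
  by (auto simp: diagT_def diagW_def)

text \<open>
  Let \<open>a\<close> be the upper left block of \<open>A\<close>, and let \<open>b\<close> and \<open>r\<close> be the upper blocks of the inverse.
  The product of \<open>A\<close> with its inverse gives $ab=1$ and $ar=0$; as \<open>a\<close> is square, also $ba=1$, and so
  $r=bar=0$.
\<close>

lemma low_minv:
  fixes A :: "'k::field mat"
  assumes inv: "invertible_mat A" and A: "low t t A" "dim_row A = t + w"
  shows "low t t (minv A)"
proof -
  let ?B = "minv A" let ?a = "diagT t t A" let ?b = "diagT t t ?B"
  have dims: "dim_col A = t + w" "dim_row ?B = t + w" "dim_col ?B = t + w"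
    using inv A by (auto simp: invertible_square minv_props)
  have "?a * ?b = 1\<^sub>m t"
    using diagT_mult[of t t A ?B w t] A inv dims by (simp add: minv_props diag_one)
  then have ba: "?b * ?a = 1\<^sub>m t"
    by (intro mat_mult_left_right_inverse[of ?a t ?b]) (auto simp: diag_dims)
  define r where "r = mat t w (\<lambda>(i, j). ?B $$ (i, t + j))"
  have "?a * r = 0\<^sub>m t w"
  proof (rule eq_matI)
    fix i j assume "i < dim_row (0\<^sub>m t w)" "j < dim_col (0\<^sub>m t w)"
    then have ij: "i < t" "j < w" by auto
    have "(\<Sum>k<t+w. A $$ (i, k) * ?B $$ (k, t + j)) = (A * ?B) $$ (i, t + j)"
      using ij A dims by (subst index_mult) auto
    also have "\<dots> = 0" using ij A inv by (simp add: minv_props)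
    finally have "(\<Sum>k<t+w. A $$ (i, k) * ?B $$ (k, t + j)) = 0" .
    moreover have "(\<Sum>k<t+w. A $$ (i, k) * ?B $$ (k, t + j)) = (\<Sum>k<t. A $$ (i, k) * ?B $$ (k, t + j))"
      using ij A dims by (intro sum.mono_neutral_right) (auto simp: low_def)
    ultimately show "(?a * r) $$ (i, j) = 0\<^sub>m t w $$ (i, j)"
      using ij by (simp add: index_mult diag_dims r_def del: index_mult_mat(1)) (simp add: diagT_def)
  qed (auto simp: diag_dims r_def)
  then have "?b * (?a * r) = 0\<^sub>m t w" by (auto simp: diag_dims)
  moreover have "?b * (?a * r) = r"
    using ba by (simp add: mat_assoc[symmetric] diag_dims r_def mat_one_mult)
  ultimately have r0: "r = 0\<^sub>m t w" by simp
  have "?B $$ (i, j) = 0" if "i < t" "t \<le> j" "j < t + w" for i j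
  proof -
    have "r $$ (i, j - t) = 0" using r0 that by simp
    then show ?thesis using that by (simp add: r_def)
  qed
  then show ?thesis using dims by (auto simp: low_def)
qed

lemma low_block_lower:
  assumes "dim_row a = t'" "dim_col a = t" "dim_row d = w'" "dim_col d = w" "dim_row c = w'" "dim_col c = t"
  shows "low t' t (block_lower a c d)" "diagT t' t (block_lower a c d) = a"
    "diagW t' w' t w (block_lower a c d) = d" "lowerleft t' w' t (block_lower a c d) = c"
  using assms by (auto simp: low_def diagT_def diagW_def lowerleft_def)

lemma low_eq_block_lower:
  assumes "low t' t A" "dim_row A = t' + w'" "dim_col A = t + w"
  shows "A = block_lower (diagT t' t A) (lowerleft t' w' t A) (diagW t' w' t w A)"
  by (rule eq_matI) (use assms in \<open>auto simp: low_def diagT_def diagW_def lowerleft_def\<close>)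

lemma low_invertible_iff:
  fixes A :: "'k::field mat"
  assumes "low t t A" "dim_row A = t + w" "dim_col A = t + w"
  shows "invertible_mat A \<longleftrightarrow> invertible_mat (diagT t t A) \<and> invertible_mat (diagW t w t w A)"
proof -
  have "det A = det (diagT t t A) * det (diagW t w t w A)"
    by (subst low_eq_block_lower[OF assms], rule det_four_block_mat_upper_right_zero)
      (auto simp: diag_dims)
  moreover have "A \<in> carrier_mat (t + w) (t + w)" "diagT t t A \<in> carrier_mat t t"
    "diagW t w t w A \<in> carrier_mat w w"
    using assms by (auto simp: diag_dims)
  ultimately show ?thesis by (simp add: invertible_det)
qed

lemma diag_minv:
  fixes A :: "'k::field mat"
  assumes inv: "invertible_mat A" and A: "low t t A" "dim_row A = t + w"
  shows "diagT t t (minv A) = minv (diagT t t A)" "diagW t w t w (minv A) = minv (diagW t w t w A)"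
proof -
  have dims: "dim_col A = t + w" "dim_row (minv A) = t + w" "dim_col (minv A) = t + w"
    using inv A by (auto simp: invertible_square minv_props)
  have i: "invertible_mat (diagT t t A)" "invertible_mat (diagW t w t w A)"
    using low_invertible_iff[OF A dims(1)] inv by auto
  have "diagT t t A * diagT t t (minv A) = 1\<^sub>m t"
    using diagT_mult[of t t A "minv A" w t] A inv dims by (simp add: minv_props diag_one)
  then show "diagT t t (minv A) = minv (diagT t t A)"
    by (intro minv_unique[symmetric] i) (auto simp: diag_dims)
  have "diagW t w t w A * diagW t w t w (minv A) = 1\<^sub>m w"
    using diagW_mult[OF low_minv[OF inv A], of w A t w w] A inv dims by (simp add: minv_props diag_one)
  then show "diagW t w t w (minv A) = minv (diagW t w t w A)"
    by (intro minv_unique[symmetric] i) (auto simp: diag_dims)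
qed

lemma stable_iff_low:
  fixes A :: "'k::field mat"
  assumes "dim_row A = t' + w'" "dim_col A = t + w"
  shows "(\<forall>x\<in>Wsub t w. A *\<^sub>v x \<in> Wsub t' w') \<longleftrightarrow> low t' t A"
proof
  assume L: "\<forall>x\<in>Wsub t w. A *\<^sub>v x \<in> Wsub t' w'"
  have "A $$ (i, j) = 0" if "i < t'" "t \<le> j" "j < t + w" for i j
  proof -
    have "unit_vec (t + w) j \<in> Wsub t w" using that by (auto simp: Wsub_def)
    then have "(A *\<^sub>v unit_vec (t + w) j) $ i = 0" using L that by (auto simp: Wsub_def)
    then show ?thesis using that assms by simp
  qed
  then show "low t' t A" using assms by (auto simp: low_def)
next
  assume L: "low t' t A"
  have "(A *\<^sub>v x) $ i = 0" if "x \<in> Wsub t w" "i < t'" for x i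
  proof -
    have "row A i $ k * x $ k = 0" if k: "k < t + w" for k
      using that \<open>x \<in> Wsub t w\<close> \<open>i < t'\<close> L assms by (cases "k < t") (auto simp: Wsub_def low_def)
    then show ?thesis using that assms by (auto simp: scalar_prod_def Wsub_def intro!: sum.neutral)
  qed
  then show "\<forall>x\<in>Wsub t w. A *\<^sub>v x \<in> Wsub t' w'"
    using assms by (auto simp: Wsub_def intro: carrier_vecI)
qed

text \<open>
  A matrix that maps the subspace into itself maps it onto itself because its inverse is of the same
  shape.
\<close>

lemma stabilizer_iff_low:
  fixes g :: "'k::field mat"
  assumes g: "invertible_mat g" "dim_row g = t + w"
  shows "(\<lambda>x. g *\<^sub>v x) ` Wsub t w = Wsub t w \<longleftrightarrow> low t t g"
proof
  assume "(\<lambda>x. g *\<^sub>v x) ` Wsub t w = Wsub t w"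
  then show "low t t g" using stable_iff_low[of g t w t w] g by (auto simp: invertible_square)
next
  assume L: "low t t g"
  have 1: "\<forall>x\<in>Wsub t w. g *\<^sub>v x \<in> Wsub t w"
    using L stable_iff_low[of g t w t w] g by (auto simp: invertible_square)
  have 2: "\<forall>x\<in>Wsub t w. minv g *\<^sub>v x \<in> Wsub t w"
    using low_minv[OF g(1) L g(2)] stable_iff_low[of "minv g" t w t w] g by (auto simp: minv_props)
  have "x \<in> (\<lambda>x. g *\<^sub>v x) ` Wsub t w" if "x \<in> Wsub t w" for x
  proof
    have "g \<in> carrier_mat (t + w) (t + w)" "minv g \<in> carrier_mat (t + w) (t + w)" "x \<in> carrier_vec (t + w)"
      using g that by (auto simp: minv_props invertible_square Wsub_def)
    then show "x = g *\<^sub>v (minv g *\<^sub>v x)"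
      using g by (simp add: assoc_mult_mat_vec[symmetric] minv_props)
  qed (use 2 that in auto)
  then show "(\<lambda>x. g *\<^sub>v x) ` Wsub t w = Wsub t w" using 1 by auto
qed

section \<open>Permutations of finite sets and fixed points of Frobenius\<close>

lemma finite_bij_period:
  assumes "finite A" "bij_betw a A A" "h \<in> A"
  shows "\<exists>n>0. (a ^^ n) h = h"
proof -
  have A: "(a ^^ n) h \<in> A" for n
    using assms(2,3) by (induction n) (auto simp: bij_betw_def)
  have "\<not> inj (\<lambda>n. (a ^^ n) h)"
  proof
    assume "inj (\<lambda>n. (a ^^ n) h)"
    moreover have "finite (range (\<lambda>n. (a ^^ n) h))"
      by (rule finite_subset[OF _ assms(1)]) (use A in auto)
    ultimately show False using finite_imageD by fastforce
  qed
  then obtain i j where "(a ^^ i) h = (a ^^ j) h" "i \<noteq> j" by (auto simp: inj_def)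
  then obtain i j where ij: "(a ^^ i) h = (a ^^ j) h" "i < j" by (metis nat_neq_iff)
  have "(a ^^ i) ((a ^^ (j - i)) h) = (a ^^ i) h"
    using ij by (metis add_diff_inverse_nat comp_apply funpow_add less_imp_not_less)
  then have "(a ^^ (j - i)) h = h"
    using inj_onD[OF bij_betw_imp_inj_on[OF bij_betw_funpow[OF assms(2)]]] A assms(3) by metis
  then show ?thesis using ij by (intro exI[of _ "j - i"]) auto
qed

lemma orbit_bij:
  assumes "finite A" "bij_betw a A A" "h \<in> A"
  shows "h \<in> orbit a h" "orbit a h \<subseteq> A" "orbit a (a h) = orbit a h"
proof -
  obtain n where n: "n > 0" "(a ^^ n) h = h" using finite_bij_period[OF assms] by auto
  then show h: "h \<in> orbit a h" unfolding orbit_altdef mem_Collect_eq by (intro exI[of _ n]) simp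
  then show "orbit a (a h) = orbit a h" by (rule self_in_orbit_step)
  have "(a ^^ k) h \<in> A" for k
    using assms(2,3) by (induction k) (auto simp: bij_betw_def)
  then show "orbit a h \<subseteq> A" by (auto simp: orbit_altdef)
qed

text \<open>
  With \<open>S\<close> a finite field, this counts the rational points of a space of matrices.
\<close>

lemma card_matrices_with_entries:
  "card {M \<in> carrier_mat r c. \<forall>i<r. \<forall>j<c. M $$ (i, j) \<in> S} = card S ^ (r * c)"
  "finite S \<Longrightarrow> finite {M \<in> carrier_mat r c. \<forall>i<r. \<forall>j<c. M $$ (i, j) \<in> S}"
proof -
  let ?M = "{M \<in> carrier_mat r c. \<forall>i<r. \<forall>j<c. M $$ (i, j) \<in> S}"
  let ?P = "({..<r} \<times> {..<c}) \<rightarrow>\<^sub>E S"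
  have b: "bij_betw (\<lambda>M. \<lambda>ij\<in>{..<r} \<times> {..<c}. M $$ ij) ?M ?P"
  proof (rule bij_betwI[where g="\<lambda>f. mat r c f"])
    show "(\<lambda>M. \<lambda>ij\<in>{..<r} \<times> {..<c}. M $$ ij) \<in> ?M \<rightarrow> ?P"
      by (auto simp: PiE_iff)
    show "(\<lambda>f. mat r c f) \<in> ?P \<rightarrow> ?M" by (auto simp: PiE_iff)
    show "mat r c (\<lambda>ij\<in>{..<r} \<times> {..<c}. M $$ ij) = M" if "M \<in> ?M" for M using that by auto
    show "(\<lambda>ij\<in>{..<r} \<times> {..<c}. mat r c f $$ ij) = f" if "f \<in> ?P" for f
      using that by (auto simp: fun_eq_iff PiE_iff extensional_def)
  qed
  have "card ?P = card S ^ (r * c)" by (simp add: card_PiE)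
  then show "card ?M = card S ^ (r * c)" using bij_betw_same_card[OF b] by simp
  show "finite ?M" if "finite S" using bij_betw_finite[OF b] that by (simp add: finite_PiE)
qed

text \<open>
  The power map \<open>z \<mapsto> z ^ q\<close> enters the argument only through these properties. Surjectivity is used
  to see that a class containing the Frobenius image of one of its points is stable as a set, and the
  number of fixed points of the powers of Frobenius is what the restriction maps require.
\<close>

locale frobenius =
  fixes q :: nat and K :: "'k::field itself"
  assumes q_pos: "0 < q"
    and frob_add: "(a + b :: 'k) ^ q = a ^ q + b ^ q"
    and frob_surj: "\<exists>w. w ^ q = (z :: 'k)"
    and card_fixed: "0 < n \<Longrightarrow> card {z :: 'k. z ^ (q ^ n) = z} = q ^ n"
begin

abbreviation fr :: "'k mat \<Rightarrow> 'k mat" where "fr \<equiv> map_mat (\<lambda>z. z ^ q)"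

lemma frob_inj: "(a :: 'k) ^ q = b ^ q \<Longrightarrow> a = b"
proof -
  assume "a ^ q = b ^ q"
  then have "b ^ q + (a - b) ^ q = b ^ q" using frob_add[of b "a - b"] by simp
  then show "a = b" by simp
qed

lemma frob_sum: "(\<Sum>i\<in>A. f i :: 'k) ^ q = (\<Sum>i\<in>A. f i ^ q)"
  by (induction A rule: infinite_finite_induct) (auto simp: frob_add q_pos)

lemma fr_mult: "dim_col A = dim_row B \<Longrightarrow> fr (A * B) = fr A * fr B"
  by (rule eq_matI) (auto simp: index_mult frob_sum power_mult_distrib simp del: index_mult_mat(1))

lemma fr_one: "fr (1\<^sub>m n) = 1\<^sub>m n"
  by (rule eq_matI) (auto simp: q_pos)

lemma fr_inj: "fr A = fr B \<Longrightarrow> A = B"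
proof (rule eq_matI)
  assume e: "fr A = fr B"
  show "dim_row A = dim_row B" "dim_col A = dim_col B"
    using arg_cong[OF e, of dim_row] arg_cong[OF e, of dim_col] by auto
  fix i j assume "i < dim_row B" "j < dim_col B"
  then show "A $$ (i, j) = B $$ (i, j)"
    using arg_cong[OF e, of "\<lambda>M. M $$ (i, j)"] \<open>dim_row A = _\<close> \<open>dim_col A = _\<close> by (auto intro: frob_inj)
qed

lemma fr_surj: "\<exists>A. fr A = B"
proof -
  obtain r where r: "r z ^ q = z" for z :: 'k using frob_surj by metis
  have "fr (map_mat r B) = B" by (rule eq_matI) (auto simp: r)
  then show ?thesis by blast
qed

lemma fr_invertible: "invertible_mat (fr A) \<longleftrightarrow> invertible_mat A"
proof
  assume i: "invertible_mat (fr A)"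
  obtain B where B: "minv (fr A) = fr B" using fr_surj by metis
  have d: "dim_row B = dim_row A" "dim_col B = dim_row A" "dim_col A = dim_row A"
    using minv_props(3,4)[OF i] invertible_square[OF i] unfolding B by auto
  have "fr (A * B) = fr (1\<^sub>m (dim_row A))" "fr (B * A) = fr (1\<^sub>m (dim_row A))"
    using minv_props(1,2)[OF i] d unfolding B by (simp_all add: fr_mult fr_one)
  then show "invertible_mat A" using d by (intro invertibleI[of A B]) (auto dest!: fr_inj)
next
  assume i: "invertible_mat A"
  then have "fr A * fr (minv A) = 1\<^sub>m (dim_row A)" "fr (minv A) * fr A = 1\<^sub>m (dim_row A)"
    by (simp_all add: fr_mult[symmetric] minv_props fr_one invertible_square)
  then show "invertible_mat (fr A)" using i by (intro invertibleI[where B="fr (minv A)"]) (auto simp: minv_props)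
qed

lemma fr_minv: "invertible_mat A \<Longrightarrow> fr (minv A) = minv (fr A)"
  by (rule minv_unique[symmetric])
    (simp_all add: fr_invertible minv_props fr_mult[symmetric] fr_one invertible_square)

lemma low_fr: "r \<le> dim_row A \<Longrightarrow> low r c (fr A) \<longleftrightarrow> low r c A"
  using frob_inj[of _ 0] q_pos by (auto simp: low_def)

lemma diag_fr:
  "t' \<le> dim_row A \<Longrightarrow> t \<le> dim_col A \<Longrightarrow> diagT t' t (fr A) = fr (diagT t' t A)"
  "t' + w' \<le> dim_row A \<Longrightarrow> t + w \<le> dim_col A \<Longrightarrow> diagW t' w' t w (fr A) = fr (diagW t' w' t w A)"
  "t' + w' \<le> dim_row A \<Longrightarrow> t \<le> dim_col A \<Longrightarrow> lowerleft t' w' t (fr A) = fr (lowerleft t' w' t A)"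
  by (auto simp: diagT_def diagW_def lowerleft_def)

lemma finite_fixed: "0 < n \<Longrightarrow> finite {z :: 'k. z ^ (q ^ n) = z}"
  using card_fixed[of n] q_pos by (metis card.infinite power_eq_0_iff less_not_refl)

lemma fr_funpow: "(fr ^^ n) A = map_mat (\<lambda>z. z ^ (q ^ n)) A"
  by (induction n) (auto simp: power_mult[symmetric] mult.commute)

text \<open>
  The fixed points of a twisted Frobenius map on families of matrices: going from \<open>h\<close> to \<open>a h\<close> raises
  the entries to the power \<open>q\<close>. Rational representations, rational group elements and the data on the
  contracted arrows are all of this form.
\<close>

definition fixed_families ::
  "'i set \<Rightarrow> ('i \<Rightarrow> 'i) \<Rightarrow> ('i \<Rightarrow> nat) \<Rightarrow> ('i \<Rightarrow> nat) \<Rightarrow> ('i \<Rightarrow> 'k mat) set" where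
  "fixed_families A a r c =
     {x \<in> (\<Pi>\<^sub>E h\<in>A. carrier_mat (r h) (c h)). \<forall>h\<in>A. x (a h) = fr (x h)}"

lemma fixed_families_funpow:
  assumes "x \<in> fixed_families A a r c" "h \<in> A" "bij_betw a A A"
  shows "x ((a ^^ n) h) = (fr ^^ n) (x h)" "(a ^^ n) h \<in> A"
proof -
  show A: "(a ^^ n) h \<in> A" for n using assms by (induction n) (auto simp: bij_betw_def)
  show "x ((a ^^ n) h) = (fr ^^ n) (x h)"
    using assms A by (induction n) (auto simp: fixed_families_def)
qed

lemma fixed_entries:
  assumes "(fr ^^ n) M = M" "M \<in> carrier_mat r c"
  shows "M \<in> {M \<in> carrier_mat r c. \<forall>i<r. \<forall>j<c. M $$ (i, j) \<in> {z. z ^ (q ^ n) = z}}"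
proof -
  have "M $$ (i, j) ^ (q ^ n) = M $$ (i, j)" if "i < r" "j < c" for i j
    using that assms(2) arg_cong[OF assms(1)[unfolded fr_funpow], of "\<lambda>M. M $$ (i, j)"] by simp
  then show ?thesis using assms(2) by simp
qed

lemma finite_fixed_families:
  assumes "finite A" "bij_betw a A A"
  shows "finite (fixed_families A a r c)"
proof -
  obtain n where n: "n h > 0 \<and> (a ^^ n h) h = h" if "h \<in> A" for h
    using finite_bij_period[OF assms] by metis
  let ?M = "\<lambda>h. {M \<in> (carrier_mat (r h) (c h) :: 'k mat set). \<forall>i<r h. \<forall>j<c h. M $$ (i, j) \<in> {z. z ^ (q ^ n h) = z}}"
  have "x h \<in> ?M h" if "x \<in> fixed_families A a r c" "h \<in> A" for x h
    using fixed_families_funpow(1)[OF that assms(2), of "n h"] n[OF that(2)] that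
    by (intro fixed_entries) (auto simp: fixed_families_def)
  then have "fixed_families A a r c \<subseteq> (\<Pi>\<^sub>E h\<in>A. ?M h)"
    by (force simp: fixed_families_def PiE_iff)
  moreover have "finite {z :: 'k. z ^ (q ^ n h) = z}" if "h \<in> A" for h
    using finite_fixed n that by blast
  then have "finite (\<Pi>\<^sub>E h\<in>A. ?M h)"
    using assms(1) by (intro finite_PiE card_matrices_with_entries(2))
  ultimately show ?thesis by (rule finite_subset)
qed

text \<open>
  A fixed family on a single orbit is determined by its value at \<open>h0\<close>. Going once around the orbit,
  of length \<open>p\<close>, shows that this value may be any matrix whose entries satisfy $z^{q^p}=z$.
\<close>

lemma card_fixed_families:
  assumes fin: "finite A" and bij: "bij_betw a A A" and h0: "h0 \<in> A"
    and trans: "\<And>h. h \<in> A \<Longrightarrow> \<exists>k. (a ^^ k) h0 = h"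
  shows "card (fixed_families A a (\<lambda>_. r) (\<lambda>_. c)) = q ^ (card A * (r * c))"
proof -
  define p where "p = (LEAST n. n > 0 \<and> (a ^^ n) h0 = h0)"
  have p: "p > 0" "(a ^^ p) h0 = h0"
    using LeastI_ex[OF finite_bij_period[OF fin bij h0]] by (auto simp: p_def)
  have p_least: "p \<le> n" if "n > 0" "(a ^^ n) h0 = h0" for n
    unfolding p_def using that by (intro Least_le) auto
  have inA: "(a ^^ n) h0 \<in> A" for n
    using h0 bij by (induction n) (auto simp: bij_betw_def)
  have inj: "inj_on (\<lambda>k. (a ^^ k) h0) {..<p}"
  proof (rule linorder_inj_onI)
    fix i j assume ij: "i < j" "i \<in> {..<p}" "j \<in> {..<p}"
    show "(a ^^ i) h0 \<noteq> (a ^^ j) h0"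
    proof
      assume "(a ^^ i) h0 = (a ^^ j) h0"
      also have "\<dots> = (a ^^ i) ((a ^^ (j - i)) h0)"
        using ij(1) by (metis add_diff_inverse_nat comp_apply funpow_add less_imp_not_less)
      finally have "(a ^^ (j - i)) h0 = h0"
        using inj_onD[OF bij_betw_imp_inj_on[OF bij_betw_funpow[OF bij], of i]] inA h0 by metis
      then show False using p_least[of "j - i"] ij by auto
    qed
  qed auto
  have "(a ^^ k) h0 = (a ^^ (k mod p)) h0" for k
  proof -
    have "(a ^^ (p * m)) h0 = h0" for m
      by (induction m) (auto simp: funpow_add p(2))
    then show ?thesis by (metis (no_types) add.commute comp_apply funpow_add mult_div_mod_eq)
  qed
  then have img: "(\<lambda>k. (a ^^ k) h0) ` {..<p} = A"
    using trans inA p(1) by (fastforce simp: image_iff intro: mod_less_divisor)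
  then have cardA: "card A = p" using card_image[OF inj] by simp
  define k where "k = the_inv_into {..<p} (\<lambda>k. (a ^^ k) h0)"
  have k: "k h < p" "(a ^^ k h) h0 = h" if "h \<in> A" for h
    using the_inv_into_into[OF inj, of h "{..<p}"] f_the_inv_into_f[OF inj, of h] that img by (auto simp: k_def)
  have k_eq: "k ((a ^^ i) h0) = i" if "i < p" for i
    using the_inv_into_f_f[OF inj, of i] that by (simp add: k_def)
  let ?M = "{M \<in> carrier_mat r c. \<forall>i<r. \<forall>j<c. M $$ (i, j) \<in> {z. z ^ (q ^ p) = z}}"
  have M: "(fr ^^ p) M = M" if "M \<in> ?M" for M :: "'k mat"
    using that by (auto simp: fr_funpow intro!: eq_matI)
  have "bij_betw (\<lambda>x. x h0) (fixed_families A a (\<lambda>_. r) (\<lambda>_. c)) ?M"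
  proof (rule bij_betwI[where g="\<lambda>M. \<lambda>h\<in>A. (fr ^^ k h) M"])
    show "(\<lambda>x. x h0) \<in> fixed_families A a (\<lambda>_. r) (\<lambda>_. c) \<rightarrow> ?M"
    proof (rule Pi_I)
      fix x assume "x \<in> fixed_families A a (\<lambda>_. r) (\<lambda>_. c)"
      then show "x h0 \<in> ?M"
        using fixed_families_funpow(1)[OF _ h0 bij, of x _ _ p] h0 p(2)
        by (intro fixed_entries) (auto simp: fixed_families_def)
    qed
    show "(\<lambda>M. \<lambda>h\<in>A. (fr ^^ k h) M) \<in> ?M \<rightarrow> fixed_families A a (\<lambda>_. r) (\<lambda>_. c)"
    proof (rule Pi_I)
      fix M :: "'k mat" assume MM: "M \<in> ?M"
      have "(fr ^^ k (a h)) M = fr ((fr ^^ k h) M)" if h: "h \<in> A" for h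
      proof (cases "Suc (k h) < p")
        case True
        have "a h = (a ^^ Suc (k h)) h0" using k[OF h] by simp
        then have "k (a h) = Suc (k h)" using k_eq[OF True] by simp
        then show ?thesis by simp
      next
        case False
        then have "Suc (k h) = p" using k[OF h] by simp
        moreover have "a h = (a ^^ Suc (k h)) h0" using k[OF h] by simp
        ultimately have "a h = h0" "fr ((fr ^^ k h) M) = (fr ^^ p) M" using p by auto
        then show ?thesis using M[OF MM] k_eq[of 0] p by simp
      qed
      moreover have "a h \<in> A" if "h \<in> A" for h using that bij by (auto simp: bij_betw_def)
      moreover have "(fr ^^ n) M \<in> carrier_mat r c" for n using MM by (auto simp: fr_funpow)
      ultimately show "(\<lambda>h\<in>A. (fr ^^ k h) M) \<in> fixed_families A a (\<lambda>_. r) (\<lambda>_. c)"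
        by (auto simp: fixed_families_def)
    qed
    show "(\<lambda>h\<in>A. (fr ^^ k h) (x h0)) = x" if x: "x \<in> fixed_families A a (\<lambda>_. r) (\<lambda>_. c)" for x
    proof (rule extensionalityI[where A=A])
      show "(\<lambda>h\<in>A. (fr ^^ k h) (x h0)) h = x h" if "h \<in> A" for h
        using that fixed_families_funpow(1)[OF x h0 bij, of "k h"] k[OF that] by simp
    qed (use x in \<open>auto simp: fixed_families_def PiE_iff\<close>)
    show "(\<lambda>h\<in>A. (fr ^^ k h) M) h0 = M" if "M \<in> ?M" for M
      using k_eq[of 0] p h0 by simp
  qed
  then have "card (fixed_families A a (\<lambda>_. r) (\<lambda>_. c)) = card {z::'k. z ^ (q ^ p) = z} ^ (r * c)"
    by (simp only: bij_betw_same_card card_matrices_with_entries(1)[symmetric])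
  then show ?thesis using card_fixed[OF p(1)] by (simp add: cardA power_mult)
qed

end

section \<open>Parabolic subgroups\<close>

text \<open>
  The local condition for the parabolic subgroup $Q$ (\<open>b = False\<close>) and for its unipotent radical $U$
  (\<open>b = True\<close>). The flag allows one proof for both.
\<close>

definition parab :: "bool \<Rightarrow> nat \<Rightarrow> nat \<Rightarrow> 'k::field mat \<Rightarrow> bool" where
  "parab b t w A \<longleftrightarrow> low t t A \<and> (b \<longrightarrow> diagT t t A = 1\<^sub>m t \<and> diagW t w t w A = 1\<^sub>m w)"

lemma parab_one: "parab b t w (1\<^sub>m (t + w))"
  by (simp add: parab_def low_one diag_one)

lemma parab_mult:
  assumes "parab b t w A" "parab b t w B" "dim_row A = t + w" "dim_col A = t + w" "dim_row B = t + w" "dim_col B = t + w"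
  shows "parab b t w (A * B)"
proof -
  have "low t t (A * B)" using assms by (intro low_mult[where m=t]) (auto simp: parab_def)
  moreover have "diagT t t (A * B) = diagT t t A * diagT t t B"
    using assms by (intro diagT_mult[where w'=w]) (auto simp: parab_def)
  moreover have "diagW t w t w (A * B) = diagW t w t w A * diagW t w t w B"
    using assms by (intro diagW_mult) (auto simp: parab_def)
  ultimately show ?thesis using assms by (auto simp: parab_def)
qed

lemma parab_minv:
  assumes "invertible_mat A" "parab b t w A" "dim_row A = t + w"
  shows "parab b t w (minv A)"
  using assms low_minv[OF assms(1) _ assms(3)] diag_minv[OF assms(1) _ assms(3)]
  by (auto simp: parab_def invertible_one)

lemma (in frobenius) parab_fr:
  "dim_row A = t + w \<Longrightarrow> dim_col A = t + w \<Longrightarrow> parab b t w (fr A) \<longleftrightarrow> parab b t w A"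
proof -
  assume d: "dim_row A = t + w" "dim_col A = t + w"
  have "fr M = 1\<^sub>m m \<longleftrightarrow> M = 1\<^sub>m m" for M m using fr_inj[of M "1\<^sub>m m"] by (auto simp: fr_one)
  then show ?thesis using d by (simp add: parab_def low_fr diag_fr)
qed

definition Pgrp :: "('v, 'h) agraph \<Rightarrow> 'v dimvec \<Rightarrow> 'v dimvec \<Rightarrow> bool \<Rightarrow> ('v \<Rightarrow> 'k::field mat) set" where
  "Pgrp \<Gamma> \<tau> \<omega> b =
     {g \<in> Grp \<Gamma> (dplus \<tau> \<omega>). \<forall>v\<in>verts \<Gamma>. parab b (vdim \<Gamma> \<tau> v) (vdim \<Gamma> \<omega> v) (g v)}"

lemma vdim_dplus: "vdim \<Gamma> (dplus \<tau> \<omega>) v = vdim \<Gamma> \<tau> v + vdim \<Gamma> \<omega> v"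
  by (simp add: vdim_def dplus_def)

lemma GrpD:
  assumes "g \<in> Grp \<Gamma> \<nu>" "v \<in> verts \<Gamma>"
  shows "dim_row (g v) = vdim \<Gamma> \<nu> v" "dim_col (g v) = vdim \<Gamma> \<nu> v" "invertible_mat (g v)"
  using assms by (auto simp: Grp_def)

lemma Grp_ext: "g \<in> Grp \<Gamma> \<nu> \<Longrightarrow> g \<in> extensional (verts \<Gamma>)"
  by (auto simp: Grp_def PiE_iff)

lemma GrpI:
  assumes "g \<in> extensional (verts \<Gamma>)"
    "\<And>v. v \<in> verts \<Gamma> \<Longrightarrow> dim_row (g v) = vdim \<Gamma> \<nu> v \<and> invertible_mat (g v)"
  shows "g \<in> Grp \<Gamma> \<nu>"
  unfolding Grp_def PiE_iff
  by (intro conjI ballI CollectI carrier_matI) (simp_all add: assms invertible_square)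

text \<open>
  This and the next lemma replace stability of subspaces by the shape of matrices.
\<close>

lemma Qgrp_eq: "(Qgrp \<Gamma> \<tau> \<omega> :: ('v \<Rightarrow> 'k::field mat) set) = Pgrp \<Gamma> \<tau> \<omega> False"
proof -
  have "((*\<^sub>v) (g v) ` Wsub (vdim \<Gamma> \<tau> v) (vdim \<Gamma> \<omega> v) = Wsub (vdim \<Gamma> \<tau> v) (vdim \<Gamma> \<omega> v)) \<longleftrightarrow>
      parab False (vdim \<Gamma> \<tau> v) (vdim \<Gamma> \<omega> v) (g v)"
    if "g \<in> Grp \<Gamma> (dplus \<tau> \<omega>)" "v \<in> verts \<Gamma>" for g :: "'v \<Rightarrow> 'k mat" and v
    using stabilizer_iff_low[of "g v" "vdim \<Gamma> \<tau> v" "vdim \<Gamma> \<omega> v"] GrpD[OF that]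
    by (simp add: parab_def vdim_dplus)
  then show ?thesis unfolding Qgrp_def Pgrp_def by (intro Collect_cong conj_cong refl ball_cong) blast+
qed

lemma Ugrp_eq: "Ugrp \<Gamma> \<tau> \<omega> = Pgrp \<Gamma> \<tau> \<omega> True"
  by (auto simp: Ugrp_def Qgrp_eq Pgrp_def parab_def)

lemma EspD:
  assumes "x \<in> Esp \<Gamma> J \<nu>" "h \<in> arrs \<Gamma>"
  shows "dim_row (x h) = vdim \<Gamma> \<nu> (tgt \<Gamma> h)" "dim_col (x h) = vdim \<Gamma> \<nu> (src \<Gamma> h)"
  using assms by (auto simp: Esp_def)

lemma Esp_invertible: "x \<in> Esp \<Gamma> J \<nu> \<Longrightarrow> h \<in> J \<Longrightarrow> invertible_mat (x h)"
  by (simp add: Esp_def)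

lemma Esp_ext: "x \<in> Esp \<Gamma> J \<nu> \<Longrightarrow> x \<in> extensional (arrs \<Gamma>)"
  by (auto simp: Esp_def PiE_iff)

lemma EspI:
  assumes "x \<in> extensional (arrs \<Gamma>)"
    "\<And>h. h \<in> arrs \<Gamma> \<Longrightarrow> dim_row (x h) = vdim \<Gamma> \<nu> (tgt \<Gamma> h) \<and> dim_col (x h) = vdim \<Gamma> \<nu> (src \<Gamma> h)"
    "\<And>h. h \<in> J \<Longrightarrow> invertible_mat (x h)"
  shows "x \<in> Esp \<Gamma> J \<nu>"
  unfolding Esp_def PiE_iff
  by (intro conjI ballI CollectI carrier_matI) (simp_all add: assms)

lemma Esp_open_subset: "x \<in> Esp \<Gamma> J \<nu> \<longleftrightarrow> x \<in> Esp \<Gamma> {} \<nu> \<and> (\<forall>h\<in>J. invertible_mat (x h))"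
  by (auto simp: Esp_def)

lemma SW_iff:
  "x \<in> SW \<Gamma> J \<tau> \<omega> \<longleftrightarrow> x \<in> Esp \<Gamma> J (dplus \<tau> \<omega>) \<and>
     (\<forall>h\<in>arrs \<Gamma>. low (vdim \<Gamma> \<tau> (tgt \<Gamma> h)) (vdim \<Gamma> \<tau> (src \<Gamma> h)) (x h))"
proof -
  have "(\<forall>u\<in>Wsub (vdim \<Gamma> \<tau> (src \<Gamma> h)) (vdim \<Gamma> \<omega> (src \<Gamma> h)).
          x h *\<^sub>v u \<in> Wsub (vdim \<Gamma> \<tau> (tgt \<Gamma> h)) (vdim \<Gamma> \<omega> (tgt \<Gamma> h))) \<longleftrightarrow>
        low (vdim \<Gamma> \<tau> (tgt \<Gamma> h)) (vdim \<Gamma> \<tau> (src \<Gamma> h)) (x h)"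
    if "x \<in> Esp \<Gamma> J (dplus \<tau> \<omega>)" "h \<in> arrs \<Gamma>" for h
    by (rule stable_iff_low) (use EspD[OF that] in \<open>simp_all add: vdim_dplus\<close>)
  then show ?thesis by (auto simp: SW_def)
qed

definition ginv :: "('v, 'h) agraph \<Rightarrow> ('v \<Rightarrow> 'k::field mat) \<Rightarrow> ('v \<Rightarrow> 'k mat)" where
  "ginv \<Gamma> g = (\<lambda>v\<in>verts \<Gamma>. minv (g v))"

lemma ginv_Grp: "g \<in> Grp \<Gamma> \<nu> \<Longrightarrow> ginv \<Gamma> g \<in> Grp \<Gamma> \<nu>"
  by (rule GrpI) (auto simp: ginv_def minv_props GrpD)

lemma gmul_Grp: "g \<in> Grp \<Gamma> \<nu> \<Longrightarrow> g' \<in> Grp \<Gamma> \<nu> \<Longrightarrow> gmul \<Gamma> g g' \<in> Grp \<Gamma> \<nu>"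
  by (rule GrpI) (auto simp: gmul_def GrpD intro!: invertible_mult(1))

lemma gmul_ginv_cancel:
  assumes "g \<in> Grp \<Gamma> \<nu>" "g' \<in> Grp \<Gamma> \<nu>"
  shows "gmul \<Gamma> g (gmul \<Gamma> (ginv \<Gamma> g) g') = g'"
  by (rule extensionalityI[where A="verts \<Gamma>"])
    (use assms in \<open>auto simp: gmul_def ginv_def minv_cancel GrpD Grp_ext\<close>)

section \<open>Representations, group action and Frobenius\<close>

locale admissible_graph =
  fixes \<Gamma> :: "('v, 'h) agraph"
  assumes adm: "admissible \<Gamma>"
begin

abbreviation "vd \<equiv> vdim \<Gamma>"

lemma finite_verts: "finite (verts \<Gamma>)" and finite_arrs: "finite (arrs \<Gamma>)"
  and vaut_bij: "bij_betw (vaut \<Gamma>) (verts \<Gamma>) (verts \<Gamma>)"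
  and haut_bij: "bij_betw (haut \<Gamma>) (arrs \<Gamma>) (arrs \<Gamma>)"
  using adm by (auto simp: admissible_def)

lemma arrD:
  assumes "h \<in> arrs \<Gamma>"
  shows "src \<Gamma> h \<in> verts \<Gamma>" "tgt \<Gamma> h \<in> verts \<Gamma>" "haut \<Gamma> h \<in> arrs \<Gamma>"
    "src \<Gamma> (haut \<Gamma> h) = vaut \<Gamma> (src \<Gamma> h)" "tgt \<Gamma> (haut \<Gamma> h) = vaut \<Gamma> (tgt \<Gamma> h)"
    "vorbit \<Gamma> (src \<Gamma> h) \<noteq> vorbit \<Gamma> (tgt \<Gamma> h)"
  using adm assms by (auto simp: admissible_def bij_betw_def)

lemma vaut_in: "v \<in> verts \<Gamma> \<Longrightarrow> vaut \<Gamma> v \<in> verts \<Gamma>"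
  using vaut_bij by (auto simp: bij_betw_def)

lemma vorbitD:
  assumes "v \<in> verts \<Gamma>"
  shows "v \<in> vorbit \<Gamma> v" "vorbit \<Gamma> v \<subseteq> verts \<Gamma>" "vorbit \<Gamma> (vaut \<Gamma> v) = vorbit \<Gamma> v"
  using orbit_bij[OF finite_verts vaut_bij assms] by (auto simp: vorbit_def)

lemma vdim_vaut: "v \<in> verts \<Gamma> \<Longrightarrow> vd \<nu> (vaut \<Gamma> v) = vd \<nu> v"
  by (simp add: vdim_def vorbitD)

text \<open>
  Frobenius is defined with the inverse of \<open>haut\<close>, which disappears when equalities are tested at
  the arrows \<open>haut \<Gamma> h\<close>.
\<close>

lemma rep_eqI_haut:
  assumes "x \<in> extensional (arrs \<Gamma>)" "x' \<in> extensional (arrs \<Gamma>)"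
    "\<And>h. h \<in> arrs \<Gamma> \<Longrightarrow> x (haut \<Gamma> h) = x' (haut \<Gamma> h)"
  shows "x = x'"
proof (rule extensionalityI[OF assms(1,2)])
  fix h assume "h \<in> arrs \<Gamma>"
  then obtain h' where "h' \<in> arrs \<Gamma>" "h = haut \<Gamma> h'" using haut_bij by (auto simp: bij_betw_def)
  then show "x h = x' h" using assms(3) by simp
qed

lemma grp_eqI_vaut:
  assumes "x \<in> extensional (verts \<Gamma>)" "x' \<in> extensional (verts \<Gamma>)"
    "\<And>h. h \<in> verts \<Gamma> \<Longrightarrow> x (vaut \<Gamma> h) = x' (vaut \<Gamma> h)"
  shows "x = x'"
proof (rule extensionalityI[OF assms(1,2)])
  fix h assume "h \<in> verts \<Gamma>"
  then obtain h' where "h' \<in> verts \<Gamma>" "h = vaut \<Gamma> h'" using vaut_bij by (auto simp: bij_betw_def)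
  then show "x h = x' h" using assms(3) by simp
qed

lemma act_app: "h \<in> arrs \<Gamma> \<Longrightarrow> act \<Gamma> g x h = g (tgt \<Gamma> h) * x h * minv (g (src \<Gamma> h))"
  by (simp add: act_def)

lemma act_ext: "act \<Gamma> g x \<in> extensional (arrs \<Gamma>)"
  by (simp add: act_def)

lemma act_Esp:
  assumes g: "g \<in> Grp \<Gamma> \<nu>" and x: "x \<in> Esp \<Gamma> {} \<nu>" and J: "J \<subseteq> arrs \<Gamma>"
  shows "act \<Gamma> g x \<in> Esp \<Gamma> J \<nu> \<longleftrightarrow> x \<in> Esp \<Gamma> J \<nu>"
proof -
  have "invertible_mat (act \<Gamma> g x h) \<longleftrightarrow> invertible_mat (x h)" if h: "h \<in> arrs \<Gamma>" for h
  proof -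
    note gd = GrpD[OF g arrD(1)[OF h]] GrpD[OF g arrD(2)[OF h]] EspD[OF x h]
    show ?thesis
      using gd by (simp add: act_app h invertible_mult_iff minv_props)
  qed
  moreover have "act \<Gamma> g x \<in> Esp \<Gamma> {} \<nu>"
    by (rule EspI[OF act_ext]) (auto simp: act_app arrD GrpD[OF g] minv_props)
  ultimately show ?thesis using x J by (auto simp: Esp_open_subset[of _ _ J])
qed

lemma act_gmul:
  assumes "g \<in> Grp \<Gamma> \<nu>" "g' \<in> Grp \<Gamma> \<nu>" "x \<in> Esp \<Gamma> {} \<nu>"
  shows "act \<Gamma> (gmul \<Gamma> g g') x = act \<Gamma> g (act \<Gamma> g' x)"
proof (rule extensionalityI[OF act_ext act_ext])
  fix h assume h: "h \<in> arrs \<Gamma>"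
  have "minv (g (src \<Gamma> h) * g' (src \<Gamma> h)) = minv (g' (src \<Gamma> h)) * minv (g (src \<Gamma> h))"
    using GrpD[OF assms(1) arrD(1)[OF h]] GrpD[OF assms(2) arrD(1)[OF h]]
    by (intro invertible_mult(2)) auto
  then show "act \<Gamma> (gmul \<Gamma> g g') x h = act \<Gamma> g (act \<Gamma> g' x) h"
    using GrpD[OF assms(1) arrD(1)[OF h]] GrpD[OF assms(2) arrD(1)[OF h]]
      GrpD[OF assms(1) arrD(2)[OF h]] GrpD[OF assms(2) arrD(2)[OF h]] EspD[OF assms(3) h]
    by (simp add: act_app h gmul_def arrD mat_assoc minv_props)
qed

text \<open>
  Clearing the inverse turns the action into an intertwining relation. The condition on the columns
  excludes that \<open>y h\<close> has a size for which the product on the right is meaningless.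
\<close>

lemma act_eq_iff:
  assumes g: "g \<in> Grp \<Gamma> \<nu>" and x: "x \<in> Esp \<Gamma> {} \<nu>" and y: "y \<in> extensional (arrs \<Gamma>)"
  shows "act \<Gamma> g x = y \<longleftrightarrow> (\<forall>h\<in>arrs \<Gamma>. g (tgt \<Gamma> h) * x h = y h * g (src \<Gamma> h) \<and> dim_col (y h) = vd \<nu> (src \<Gamma> h))"
proof -
  have "(g (tgt \<Gamma> h) * x h * minv (g (src \<Gamma> h)) = y h) \<longleftrightarrow>
      g (tgt \<Gamma> h) * x h = y h * g (src \<Gamma> h) \<and> dim_col (y h) = vd \<nu> (src \<Gamma> h)" if h: "h \<in> arrs \<Gamma>" for h
  proof
    note gd = GrpD[OF g arrD(1)[OF h]] GrpD[OF g arrD(2)[OF h]] EspD[OF x h]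
    assume e: "g (tgt \<Gamma> h) * x h * minv (g (src \<Gamma> h)) = y h"
    show "g (tgt \<Gamma> h) * x h = y h * g (src \<Gamma> h) \<and> dim_col (y h) = vd \<nu> (src \<Gamma> h)"
      unfolding e[symmetric] using gd by (simp add: mat_assoc minv_props mat_one_mult)
  next
    note gd = GrpD[OF g arrD(1)[OF h]] GrpD[OF g arrD(2)[OF h]] EspD[OF x h]
    assume e: "g (tgt \<Gamma> h) * x h = y h * g (src \<Gamma> h) \<and> dim_col (y h) = vd \<nu> (src \<Gamma> h)"
    show "g (tgt \<Gamma> h) * x h * minv (g (src \<Gamma> h)) = y h"
      unfolding e[THEN conjunct1] using gd e[THEN conjunct2] by (simp add: mat_assoc minv_props mat_one_mult)
  qed
  then show ?thesis
    using extensionalityI[OF act_ext y] by (metis act_app)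
qed

lemma act_ginv_cancel:
  assumes "g \<in> Grp \<Gamma> \<nu>" "x \<in> Esp \<Gamma> {} \<nu>"
  shows "act \<Gamma> (ginv \<Gamma> g) (act \<Gamma> g x) = x" "act \<Gamma> g (act \<Gamma> (ginv \<Gamma> g) x) = x"
proof -
  show "act \<Gamma> (ginv \<Gamma> g) (act \<Gamma> g x) = x"
  proof (rule extensionalityI[OF act_ext Esp_ext[OF assms(2)]])
    fix h assume h: "h \<in> arrs \<Gamma>"
    note gd = GrpD[OF assms(1) arrD(1)[OF h]] GrpD[OF assms(1) arrD(2)[OF h]] EspD[OF assms(2) h]
    show "act \<Gamma> (ginv \<Gamma> g) (act \<Gamma> g x) h = x h"
      using gd h by (simp add: act_app ginv_def arrD mat_assoc minv_props minv_minv minv_cancel mat_one_mult)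
  qed
  show "act \<Gamma> g (act \<Gamma> (ginv \<Gamma> g) x) = x"
  proof (rule extensionalityI[OF act_ext Esp_ext[OF assms(2)]])
    fix h assume h: "h \<in> arrs \<Gamma>"
    note gd = GrpD[OF assms(1) arrD(1)[OF h]] GrpD[OF assms(1) arrD(2)[OF h]] EspD[OF assms(2) h]
    show "act \<Gamma> g (act \<Gamma> (ginv \<Gamma> g) x) h = x h"
      using gd h by (simp add: act_app ginv_def arrD mat_assoc minv_props minv_minv minv_cancel mat_one_mult)
  qed
qed

end

locale rep_graph = admissible_graph \<Gamma> + frobenius q K
  for \<Gamma> :: "('v, 'h) agraph" and q :: nat and K :: "'k::field itself"
begin

lemma frobE_haut: "h \<in> arrs \<Gamma> \<Longrightarrow> frobE \<Gamma> q x (haut \<Gamma> h) = fr (x h)"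
  using haut_bij by (simp add: frobE_def arrD inv_into_f_f bij_betw_def)

lemma frobG_vaut: "v \<in> verts \<Gamma> \<Longrightarrow> frobG \<Gamma> q g (vaut \<Gamma> v) = fr (g v)"
  using vaut_bij by (simp add: frobG_def vaut_in inv_into_f_f bij_betw_def)

lemma frobE_ext: "frobE \<Gamma> q x \<in> extensional (arrs \<Gamma>)" and frobG_ext: "frobG \<Gamma> q g \<in> extensional (verts \<Gamma>)"
  by (simp_all add: frobE_def frobG_def)

lemma ball_haut: "(\<forall>h\<in>arrs \<Gamma>. P h) \<longleftrightarrow> (\<forall>h\<in>arrs \<Gamma>. P (haut \<Gamma> h))"
  using haut_bij unfolding bij_betw_def by (metis (no_types, lifting) imageE imageI)

lemma ball_vaut: "(\<forall>h\<in>verts \<Gamma>. P h) \<longleftrightarrow> (\<forall>h\<in>verts \<Gamma>. P (vaut \<Gamma> h))"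
  using vaut_bij unfolding bij_betw_def by (metis (no_types, lifting) imageE imageI)

lemma frobE_fixed_iff:
  "x \<in> extensional (arrs \<Gamma>) \<Longrightarrow> frobE \<Gamma> q x = x \<longleftrightarrow> (\<forall>h\<in>arrs \<Gamma>. x (haut \<Gamma> h) = fr (x h))"
  by (metis frobE_haut frobE_ext rep_eqI_haut)

lemma frobG_fixed_iff:
  "g \<in> extensional (verts \<Gamma>) \<Longrightarrow> frobG \<Gamma> q g = g \<longleftrightarrow> (\<forall>h\<in>verts \<Gamma>. g (vaut \<Gamma> h) = fr (g h))"
  by (metis frobG_vaut frobG_ext grp_eqI_vaut)

lemma frobE_Esp:
  fixes x :: "('h, 'k) rep"
  assumes x: "x \<in> extensional (arrs \<Gamma>)" and J: "haut \<Gamma> ` J = J" "J \<subseteq> arrs \<Gamma>"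
  shows "frobE \<Gamma> q x \<in> Esp \<Gamma> J \<nu> \<longleftrightarrow> x \<in> Esp \<Gamma> J \<nu>"
proof -
  have "(\<forall>h\<in>haut \<Gamma> ` J. invertible_mat (frobE \<Gamma> q x h)) \<longleftrightarrow> (\<forall>h\<in>J. invertible_mat (x h))"
    using J(2) by (auto simp: frobE_haut fr_invertible subset_eq)
  then have "(\<forall>h\<in>J. invertible_mat (frobE \<Gamma> q x h)) \<longleftrightarrow> (\<forall>h\<in>J. invertible_mat (x h))"
    unfolding J(1) .
  moreover have "(\<forall>h\<in>arrs \<Gamma>. frobE \<Gamma> q x h \<in> carrier_mat (vd \<nu> (tgt \<Gamma> h)) (vd \<nu> (src \<Gamma> h))) \<longleftrightarrow>
    (\<forall>h\<in>arrs \<Gamma>. x h \<in> carrier_mat (vd \<nu> (tgt \<Gamma> h)) (vd \<nu> (src \<Gamma> h)))"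
    by (subst ball_haut) (simp add: frobE_haut arrD vdim_vaut)
  ultimately show ?thesis using x frobE_ext by (auto simp: Esp_def PiE_iff)
qed

lemma frobG_Grp:
  fixes g :: "'v \<Rightarrow> 'k mat"
  assumes g: "g \<in> extensional (verts \<Gamma>)"
  shows "frobG \<Gamma> q g \<in> Grp \<Gamma> \<nu> \<longleftrightarrow> g \<in> Grp \<Gamma> \<nu>"
proof -
  have "(\<forall>v\<in>verts \<Gamma>. frobG \<Gamma> q g v \<in> {g \<in> carrier_mat (vd \<nu> v) (vd \<nu> v). invertible_mat g}) \<longleftrightarrow>
    (\<forall>v\<in>verts \<Gamma>. g v \<in> {g \<in> carrier_mat (vd \<nu> v) (vd \<nu> v). invertible_mat g})"
    by (subst ball_vaut) (simp add: frobG_vaut vdim_vaut fr_invertible)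
  then show ?thesis using g frobG_ext by (auto simp: Grp_def PiE_iff)
qed

lemma frobE_SW:
  fixes x :: "('h, 'k) rep"
  assumes x: "x \<in> extensional (arrs \<Gamma>)" and J: "haut \<Gamma> ` J = J" "J \<subseteq> arrs \<Gamma>"
  shows "frobE \<Gamma> q x \<in> SW \<Gamma> J \<tau> \<omega> \<longleftrightarrow> x \<in> SW \<Gamma> J \<tau> \<omega>"
proof -
  have "(\<forall>h\<in>arrs \<Gamma>. low (vd \<tau> (tgt \<Gamma> h)) (vd \<tau> (src \<Gamma> h)) (frobE \<Gamma> q x h)) \<longleftrightarrow>
    (\<forall>h\<in>arrs \<Gamma>. low (vd \<tau> (tgt \<Gamma> h)) (vd \<tau> (src \<Gamma> h)) (x h))"
    if "x \<in> Esp \<Gamma> J (dplus \<tau> \<omega>)"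
    by (subst ball_haut) (use EspD[OF that] in \<open>simp add: frobE_haut arrD vdim_vaut low_fr vdim_dplus\<close>)
  then show ?thesis unfolding SW_iff using frobE_Esp[OF x J] by blast
qed

lemma frobE_surj:
  assumes "y \<in> extensional (arrs \<Gamma>)"
  shows "\<exists>x :: ('h, 'k) rep. x \<in> extensional (arrs \<Gamma>) \<and> frobE \<Gamma> q x = y"
proof -
  obtain r where r: "fr (r B) = B" for B using fr_surj by metis
  have "frobE \<Gamma> q (\<lambda>h\<in>arrs \<Gamma>. r (y (haut \<Gamma> h))) = y"
    by (rule rep_eqI_haut[OF frobE_ext assms]) (simp add: frobE_haut r)
  then show ?thesis by (metis restrict_extensional)
qed

lemma frobG_surj:
  assumes "y \<in> extensional (verts \<Gamma>)"
  shows "\<exists>x :: 'v \<Rightarrow> 'k mat. x \<in> extensional (verts \<Gamma>) \<and> frobG \<Gamma> q x = y"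
proof -
  obtain r where r: "fr (r B) = B" for B using fr_surj by metis
  have "frobG \<Gamma> q (\<lambda>h\<in>verts \<Gamma>. r (y (vaut \<Gamma> h))) = y"
    by (rule grp_eqI_vaut[OF frobG_ext assms]) (simp add: frobG_vaut r)
  then show ?thesis by (metis restrict_extensional)
qed

lemma frobE_inj:
  fixes x x' :: "('h, 'k) rep"
  assumes "x \<in> extensional (arrs \<Gamma>)" "x' \<in> extensional (arrs \<Gamma>)" "frobE \<Gamma> q x = frobE \<Gamma> q x'"
  shows "x = x'"
  using assms by (intro extensionalityI[of x "arrs \<Gamma>"]) (metis frobE_haut fr_inj)+

lemma frobE_act:
  fixes x :: "('h, 'k) rep"
  assumes g: "g \<in> Grp \<Gamma> \<nu>" and x: "x \<in> Esp \<Gamma> {} \<nu>"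
  shows "frobE \<Gamma> q (act \<Gamma> g x) = act \<Gamma> (frobG \<Gamma> q g) (frobE \<Gamma> q x)"
proof (rule rep_eqI_haut[OF frobE_ext act_ext])
  fix h assume h: "h \<in> arrs \<Gamma>"
  note gd = GrpD[OF g arrD(1)[OF h]] GrpD[OF g arrD(2)[OF h]] EspD[OF x h]
  show "frobE \<Gamma> q (act \<Gamma> g x) (haut \<Gamma> h) = act \<Gamma> (frobG \<Gamma> q g) (frobE \<Gamma> q x) (haut \<Gamma> h)"
    using gd h by (simp add: frobE_haut act_app arrD frobG_vaut fr_mult minv_props fr_minv)
qed

lemma frobE_xT:
  fixes x :: "('h, 'k) rep"
  assumes "x \<in> Esp \<Gamma> J (dplus \<tau> \<omega>)"
  shows "xT \<Gamma> \<tau> (frobE \<Gamma> q x) = frobE \<Gamma> q (xT \<Gamma> \<tau> x)"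
    "xW \<Gamma> \<tau> \<omega> (frobE \<Gamma> q x) = frobE \<Gamma> q (xW \<Gamma> \<tau> \<omega> x)"
proof -
  show "xT \<Gamma> \<tau> (frobE \<Gamma> q x) = frobE \<Gamma> q (xT \<Gamma> \<tau> x)"
    by (rule rep_eqI_haut) (use EspD[OF assms] in
      \<open>auto simp: xT_def frobE_ext frobE_haut arrD vdim_vaut vdim_dplus diag_fr\<close>)
  show "xW \<Gamma> \<tau> \<omega> (frobE \<Gamma> q x) = frobE \<Gamma> q (xW \<Gamma> \<tau> \<omega> x)"
    by (rule rep_eqI_haut) (use EspD[OF assms] in
      \<open>auto simp: xW_def frobE_ext frobE_haut arrD vdim_vaut vdim_dplus diag_fr\<close>)
qed

lemma EF_fixed_families:
  "(EF \<Gamma> J q \<nu> :: ('h, 'k) rep set) = {x \<in> fixed_families (arrs \<Gamma>) (haut \<Gamma>)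
     (\<lambda>h. vd \<nu> (tgt \<Gamma> h)) (\<lambda>h. vd \<nu> (src \<Gamma> h)). \<forall>h\<in>J. invertible_mat (x h)}"
  unfolding EF_def Esp_def fixed_families_def by (auto simp: frobE_fixed_iff PiE_iff)

lemma GF_fixed_families:
  "(GF \<Gamma> q \<nu> :: ('v \<Rightarrow> 'k mat) set) = {x \<in> fixed_families (verts \<Gamma>) (vaut \<Gamma>)
     (\<lambda>v. vd \<nu> v) (\<lambda>v. vd \<nu> v). \<forall>v\<in>verts \<Gamma>. invertible_mat (x v)}"
  unfolding GF_def Grp_def fixed_families_def by (auto simp: frobG_fixed_iff PiE_iff)

lemma finite_EF: "finite (EF \<Gamma> J q \<nu> :: ('h, 'k) rep set)"
  unfolding EF_fixed_families by (simp add: finite_fixed_families[OF finite_arrs haut_bij])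

end

section \<open>Classes over a point\<close>

text \<open>
  Representatives \<open>(g, x)\<close> of the points of $\mathbf G_\nu\times_K S_W$ over \<open>y\<close>. Such a pair is
  determined by \<open>g\<close>.
\<close>

definition reps_over ::
  "('v, 'h) agraph \<Rightarrow> 'h set \<Rightarrow> 'v dimvec \<Rightarrow> 'v dimvec \<Rightarrow> ('h, 'k::field) rep \<Rightarrow>
   (('v \<Rightarrow> 'k mat) \<times> ('h, 'k) rep) set" where
  "reps_over \<Gamma> J \<tau> \<omega> y = {(g, x). g \<in> Grp \<Gamma> (dplus \<tau> \<omega>) \<and> x \<in> SW \<Gamma> J \<tau> \<omega> \<and> act \<Gamma> g x = y}"

text \<open>
  Over \<open>y\<close>, two pairs represent the same point if and only if their group elements lie in the same
  coset of $Q$ or of $U$ (\<open>twrel_iff\<close>).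
\<close>

definition coset_rel ::
  "('v, 'h) agraph \<Rightarrow> 'h set \<Rightarrow> 'v dimvec \<Rightarrow> 'v dimvec \<Rightarrow> bool \<Rightarrow> ('h, 'k::field) rep \<Rightarrow>
   (('v \<Rightarrow> 'k mat) \<times> ('h, 'k) rep) rel" where
  "coset_rel \<Gamma> J \<tau> \<omega> b y = {(z, z'). z \<in> reps_over \<Gamma> J \<tau> \<omega> y \<and> z' \<in> reps_over \<Gamma> J \<tau> \<omega> y \<and>
     (\<forall>v\<in>verts \<Gamma>. parab b (vdim \<Gamma> \<tau> v) (vdim \<Gamma> \<omega> v) (minv (fst z' v) * fst z v))}"

text \<open>
  Representatives of the classes that are stable under Frobenius (\<open>stable_class_iff\<close>). The
  representative itself need not be fixed.
\<close>

definition rational ::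
  "('v, 'h) agraph \<Rightarrow> 'h set \<Rightarrow> nat \<Rightarrow> 'v dimvec \<Rightarrow> 'v dimvec \<Rightarrow> bool \<Rightarrow> ('h, 'k::field) rep \<Rightarrow>
   (('v \<Rightarrow> 'k mat) \<times> ('h, 'k) rep) set" where
  "rational \<Gamma> J q \<tau> \<omega> b y =
     {z \<in> reps_over \<Gamma> J \<tau> \<omega> y. (map_prod (frobG \<Gamma> q) (frobE \<Gamma> q) z, z) \<in> coset_rel \<Gamma> J \<tau> \<omega> b y}"

lemma reps_overD:
  assumes "(g, x) \<in> reps_over \<Gamma> J \<tau> \<omega> y"
  shows "g \<in> Grp \<Gamma> (dplus \<tau> \<omega>)" "x \<in> SW \<Gamma> J \<tau> \<omega>" "act \<Gamma> g x = y"
    "x \<in> Esp \<Gamma> {} (dplus \<tau> \<omega>)" "x \<in> Esp \<Gamma> J (dplus \<tau> \<omega>)"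
  using assms by (auto simp: reps_over_def SW_iff Esp_open_subset[of _ _ J])

lemma SW_Esp: "x \<in> SW \<Gamma> J \<tau> \<omega> \<Longrightarrow> x \<in> Esp \<Gamma> {} (dplus \<tau> \<omega>)"
  by (auto simp: SW_iff Esp_open_subset[of _ _ J])

lemma SW_low: "x \<in> SW \<Gamma> J \<tau> \<omega> \<Longrightarrow> h \<in> arrs \<Gamma> \<Longrightarrow> low (vdim \<Gamma> \<tau> (tgt \<Gamma> h)) (vdim \<Gamma> \<tau> (src \<Gamma> h)) (x h)"
  by (auto simp: SW_iff)

context admissible_graph
begin

text \<open>
  Both sides compare $x=g^{-1}y$ with $x'=g'^{-1}y$: the element $g'^{-1}g$ carries \<open>x\<close> to \<open>x'\<close>.
\<close>

lemma over_intertwine: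
  assumes z: "(g, x) \<in> reps_over \<Gamma> J \<tau> \<omega> y" and z': "(g', x') \<in> reps_over \<Gamma> J \<tau> \<omega> y" and h: "h \<in> arrs \<Gamma>"
  shows "minv (g' (tgt \<Gamma> h)) * g (tgt \<Gamma> h) * x h = x' h * (minv (g' (src \<Gamma> h)) * g (src \<Gamma> h))"
proof -
  let ?s = "src \<Gamma> h" and ?t = "tgt \<Gamma> h"
  have y: "y \<in> extensional (arrs \<Gamma>)" using reps_overD(3)[OF z] act_ext by metis
  note gd = GrpD[OF reps_overD(1)[OF z] arrD(1)[OF h]] GrpD[OF reps_overD(1)[OF z] arrD(2)[OF h]]
    GrpD[OF reps_overD(1)[OF z'] arrD(1)[OF h]] GrpD[OF reps_overD(1)[OF z'] arrD(2)[OF h]]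
    EspD[OF reps_overD(4)[OF z] h] EspD[OF reps_overD(4)[OF z'] h]
  have e: "g ?t * x h = y h * g ?s" "g' ?t * x' h = y h * g' ?s" "dim_col (y h) = vd (dplus \<tau> \<omega>) ?s"
    using act_eq_iff[OF reps_overD(1,4)[OF z] y] act_eq_iff[OF reps_overD(1,4)[OF z'] y] reps_overD(3)[OF z] reps_overD(3)[OF z'] h
    by auto
  have "minv (g' ?t) * g ?t * x h = minv (g' ?t) * (y h * g ?s)"
    using gd e by (simp add: mat_assoc minv_props)
  also have "y h * g ?s = y h * g' ?s * (minv (g' ?s) * g ?s)"
    using gd e(3) by (simp add: mat_assoc minv_cancel minv_props)
  also have "minv (g' ?t) * (y h * g' ?s * (minv (g' ?s) * g ?s)) = x' h * (minv (g' ?s) * g ?s)"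
    unfolding e(2)[symmetric] using gd by (simp add: mat_assoc minv_cancel minv_props)
  finally show ?thesis .
qed

lemma twrel_iff:
  "((g, x), (g', x')) \<in> twrel \<Gamma> J \<tau> \<omega> (Pgrp \<Gamma> \<tau> \<omega> b) \<longleftrightarrow>
     ((g, x), (g', x')) \<in> coset_rel \<Gamma> J \<tau> \<omega> b (act \<Gamma> g x)"
proof
  assume "((g, x), (g', x')) \<in> twrel \<Gamma> J \<tau> \<omega> (Pgrp \<Gamma> \<tau> \<omega> b)"
  then obtain u where u: "u \<in> Pgrp \<Gamma> \<tau> \<omega> b" "g = gmul \<Gamma> g' u" "x' = act \<Gamma> u x"
    and *: "g \<in> Grp \<Gamma> (dplus \<tau> \<omega>)" "g' \<in> Grp \<Gamma> (dplus \<tau> \<omega>)" "x \<in> SW \<Gamma> J \<tau> \<omega>" "x' \<in> SW \<Gamma> J \<tau> \<omega>"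
    by (auto simp: twrel_def)
  have uG: "u \<in> Grp \<Gamma> (dplus \<tau> \<omega>)" using u by (auto simp: Pgrp_def)
  have "act \<Gamma> g x = act \<Gamma> g' x'"
    using act_gmul[OF *(2) uG SW_Esp[OF *(3)]] u by simp
  moreover have "minv (g' v) * g v = u v" if v: "v \<in> verts \<Gamma>" for v
    using GrpD[OF uG v] GrpD[OF *(2) v] v by (simp add: u(2) gmul_def minv_cancel)
  ultimately show "((g, x), (g', x')) \<in> coset_rel \<Gamma> J \<tau> \<omega> b (act \<Gamma> g x)"
    using * u(1) by (auto simp: coset_rel_def reps_over_def Pgrp_def)
next
  assume r: "((g, x), (g', x')) \<in> coset_rel \<Gamma> J \<tau> \<omega> b (act \<Gamma> g x)"
  then have *: "g \<in> Grp \<Gamma> (dplus \<tau> \<omega>)" "g' \<in> Grp \<Gamma> (dplus \<tau> \<omega>)" "x \<in> SW \<Gamma> J \<tau> \<omega>" "x' \<in> SW \<Gamma> J \<tau> \<omega>"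
    "act \<Gamma> g x = act \<Gamma> g' x'"
    by (auto simp: coset_rel_def reps_over_def)
  let ?u = "gmul \<Gamma> (ginv \<Gamma> g') g"
  have uG: "?u \<in> Grp \<Gamma> (dplus \<tau> \<omega>)" using * by (intro gmul_Grp ginv_Grp)
  have "?u v = minv (g' v) * g v" if "v \<in> verts \<Gamma>" for v using that by (simp add: gmul_def ginv_def)
  then have "?u \<in> Pgrp \<Gamma> \<tau> \<omega> b" using r uG by (auto simp: Pgrp_def coset_rel_def)
  moreover have "g = gmul \<Gamma> g' ?u" using gmul_ginv_cancel[OF *(2,1)] by simp
  moreover have "x' = act \<Gamma> ?u x"
    using act_gmul[OF ginv_Grp[OF *(2)] *(1) SW_Esp[OF *(3)]] *(5) act_ginv_cancel(1)[OF *(2) SW_Esp[OF *(4)]] by simp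
  ultimately show "((g, x), (g', x')) \<in> twrel \<Gamma> J \<tau> \<omega> (Pgrp \<Gamma> \<tau> \<omega> b)"
    using * unfolding twrel_def by blast
qed

lemma coset_relD:
  assumes "((g, x), (g', x')) \<in> coset_rel \<Gamma> J \<tau> \<omega> b y"
  shows "(g, x) \<in> reps_over \<Gamma> J \<tau> \<omega> y" "(g', x') \<in> reps_over \<Gamma> J \<tau> \<omega> y"
    "\<And>v. v \<in> verts \<Gamma> \<Longrightarrow> parab b (vd \<tau> v) (vd \<omega> v) (minv (g' v) * g v)"
  using assms by (auto simp: coset_rel_def)

lemma coset_relI:
  assumes "(g, x) \<in> reps_over \<Gamma> J \<tau> \<omega> y" "(g', x') \<in> reps_over \<Gamma> J \<tau> \<omega> y"
    "\<And>v. v \<in> verts \<Gamma> \<Longrightarrow> parab b (vd \<tau> v) (vd \<omega> v) (minv (g' v) * g v)"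
  shows "((g, x), (g', x')) \<in> coset_rel \<Gamma> J \<tau> \<omega> b y"
  using assms by (auto simp: coset_rel_def)

lemma equiv_coset_rel: "equiv (reps_over \<Gamma> J \<tau> \<omega> y) (coset_rel \<Gamma> J \<tau> \<omega> b y)"
proof (rule equivI)
  show "coset_rel \<Gamma> J \<tau> \<omega> b y \<subseteq> reps_over \<Gamma> J \<tau> \<omega> y \<times> reps_over \<Gamma> J \<tau> \<omega> y"
    by (auto simp: coset_rel_def)
  show "refl_on (reps_over \<Gamma> J \<tau> \<omega> y) (coset_rel \<Gamma> J \<tau> \<omega> b y)"
  proof (rule refl_onI)
    fix z assume z: "z \<in> reps_over \<Gamma> J \<tau> \<omega> y"
    obtain g x where [simp]: "z = (g, x)" by (cases z)
    have "(g, x) \<in> reps_over \<Gamma> J \<tau> \<omega> y" using z by simp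
    then show "(z, z) \<in> coset_rel \<Gamma> J \<tau> \<omega> b y" unfolding \<open>z = (g, x)\<close>
      by (intro coset_relI) (auto simp: minv_props GrpD[OF reps_overD(1)] vdim_dplus parab_one)
  qed
  show "sym (coset_rel \<Gamma> J \<tau> \<omega> b y)"
  proof (rule symI)
    fix z z' assume zz: "(z, z') \<in> coset_rel \<Gamma> J \<tau> \<omega> b y"
    obtain g x g' x' where [simp]: "z = (g, x)" "z' = (g', x')" by (cases z; cases z')
    note r = coset_relD[OF zz[simplified]]
    have "parab b (vd \<tau> v) (vd \<omega> v) (minv (g v) * g' v)" if v: "v \<in> verts \<Gamma>" for v
    proof -
      note gd = GrpD[OF reps_overD(1)[OF r(1)] v] GrpD[OF reps_overD(1)[OF r(2)] v]
      have "minv (minv (g' v) * g v) = minv (g v) * minv (minv (g' v))"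
        by (rule invertible_mult(2)) (use gd in \<open>simp_all add: minv_props\<close>)
      moreover have "parab b (vd \<tau> v) (vd \<omega> v) (minv (minv (g' v) * g v))"
        by (rule parab_minv[OF _ r(3)[OF v]], rule invertible_mult(1))
          (use gd in \<open>simp_all add: minv_props vdim_dplus\<close>)
      ultimately show ?thesis using gd by (simp add: minv_minv)
    qed
    then show "(z', z) \<in> coset_rel \<Gamma> J \<tau> \<omega> b y" using r(1,2) by (simp add: coset_relI)
  qed
  show "trans (coset_rel \<Gamma> J \<tau> \<omega> b y)"
  proof (rule transI)
    fix z z' z'' assume zz: "(z, z') \<in> coset_rel \<Gamma> J \<tau> \<omega> b y" "(z', z'') \<in> coset_rel \<Gamma> J \<tau> \<omega> b y"
    obtain g x g' x' g'' x'' where [simp]: "z = (g, x)" "z' = (g', x')" "z'' = (g'', x'')"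
      by (cases z; cases z'; cases z'')
    note r = coset_relD[OF zz(1)[simplified]] and r' = coset_relD[OF zz(2)[simplified]]
    have "parab b (vd \<tau> v) (vd \<omega> v) (minv (g'' v) * g v)" if v: "v \<in> verts \<Gamma>" for v
    proof -
      note gd = GrpD[OF reps_overD(1)[OF r(1)] v] GrpD[OF reps_overD(1)[OF r(2)] v] GrpD[OF reps_overD(1)[OF r'(2)] v]
      have "parab b (vd \<tau> v) (vd \<omega> v) ((minv (g'' v) * g' v) * (minv (g' v) * g v))"
        by (rule parab_mult[OF r'(3)[OF v] r(3)[OF v]]) (use gd in \<open>simp_all add: minv_props vdim_dplus\<close>)
      then show ?thesis using gd by (simp add: mat_assoc minv_props minv_cancel)
    qed
    then show "(z, z'') \<in> coset_rel \<Gamma> J \<tau> \<omega> b y" using r(1) r'(2) by (simp add: coset_relI)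
  qed
qed

lemma twrel_class:
  assumes "z \<in> reps_over \<Gamma> J \<tau> \<omega> y"
  shows "twrel \<Gamma> J \<tau> \<omega> (Pgrp \<Gamma> \<tau> \<omega> b) `` {z} = coset_rel \<Gamma> J \<tau> \<omega> b y `` {z}"
proof -
  obtain g x where [simp]: "z = (g, x)" by (cases z)
  show ?thesis using twrel_iff[of g x _ _ J \<tau> \<omega> b] reps_overD(3)[OF assms[simplified]] by auto
qed

lemma coset_rel_True_False:
  "(z, z') \<in> coset_rel \<Gamma> J \<tau> \<omega> True y \<Longrightarrow> (z, z') \<in> coset_rel \<Gamma> J \<tau> \<omega> False y"
  by (auto simp: coset_rel_def parab_def)

text \<open>
  The matrices $g'^{-1}g$ have identity diagonal blocks, so they drop out of the diagonal blocks of
  the relation \<open>over_intertwine\<close>.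
\<close>

lemma coset_rel_xT_xW:
  assumes "((g, x), (g', x')) \<in> coset_rel \<Gamma> J \<tau> \<omega> True y"
  shows "xT \<Gamma> \<tau> x = xT \<Gamma> \<tau> x'" "xW \<Gamma> \<tau> \<omega> x = xW \<Gamma> \<tau> \<omega> x'"
proof -
  note r = coset_relD[OF assms]
  have "diagT (vd \<tau> (tgt \<Gamma> h)) (vd \<tau> (src \<Gamma> h)) (x h) = diagT (vd \<tau> (tgt \<Gamma> h)) (vd \<tau> (src \<Gamma> h)) (x' h) \<and>
      diagW (vd \<tau> (tgt \<Gamma> h)) (vd \<omega> (tgt \<Gamma> h)) (vd \<tau> (src \<Gamma> h)) (vd \<omega> (src \<Gamma> h)) (x h) =
      diagW (vd \<tau> (tgt \<Gamma> h)) (vd \<omega> (tgt \<Gamma> h)) (vd \<tau> (src \<Gamma> h)) (vd \<omega> (src \<Gamma> h)) (x' h)"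
    if h: "h \<in> arrs \<Gamma>" for h
  proof -
    let ?u = "minv (g' (tgt \<Gamma> h)) * g (tgt \<Gamma> h)" and ?v = "minv (g' (src \<Gamma> h)) * g (src \<Gamma> h)"
    let ?t' = "vd \<tau> (tgt \<Gamma> h)" and ?t = "vd \<tau> (src \<Gamma> h)"
    let ?w' = "vd \<omega> (tgt \<Gamma> h)" and ?w = "vd \<omega> (src \<Gamma> h)"
    have d: "dim_row ?u = ?t' + ?w'" "dim_col ?u = ?t' + ?w'" "dim_row ?v = ?t + ?w" "dim_col ?v = ?t + ?w"
      "dim_row (x h) = ?t' + ?w'" "dim_col (x h) = ?t + ?w" "dim_row (x' h) = ?t' + ?w'" "dim_col (x' h) = ?t + ?w"
      using GrpD[OF reps_overD(1)[OF r(1)] arrD(1)[OF h]] GrpD[OF reps_overD(1)[OF r(1)] arrD(2)[OF h]]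
        GrpD[OF reps_overD(1)[OF r(2)] arrD(1)[OF h]] GrpD[OF reps_overD(1)[OF r(2)] arrD(2)[OF h]]
        EspD[OF reps_overD(4)[OF r(1)] h] EspD[OF reps_overD(4)[OF r(2)] h]
      by (simp_all add: minv_props vdim_dplus)
    have p: "low ?t' ?t' ?u" "diagT ?t' ?t' ?u = 1\<^sub>m ?t'" "diagW ?t' ?w' ?t' ?w' ?u = 1\<^sub>m ?w'"
        "low ?t ?t ?v" "diagT ?t ?t ?v = 1\<^sub>m ?t" "diagW ?t ?w ?t ?w ?v = 1\<^sub>m ?w"
      using r(3)[OF arrD(1)[OF h]] r(3)[OF arrD(2)[OF h]] by (auto simp: parab_def)
    have l: "low ?t' ?t (x h)" "low ?t' ?t (x' h)"
      using SW_low[OF reps_overD(2)[OF r(1)] h] SW_low[OF reps_overD(2)[OF r(2)] h] .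
    have e: "?u * x h = x' h * ?v" by (rule over_intertwine[OF r(1,2) h])
    have "diagT ?t' ?t (?u * x h) = diagT ?t' ?t' ?u * diagT ?t' ?t (x h)"
      by (rule diagT_mult[OF p(1) d(5)]) (use d in auto)
    moreover have "diagT ?t' ?t (x' h * ?v) = diagT ?t' ?t (x' h) * diagT ?t ?t ?v"
      by (rule diagT_mult[OF l(2) d(3)]) (use d in auto)
    moreover have "diagW ?t' ?w' ?t ?w (?u * x h) = diagW ?t' ?w' ?t' ?w' ?u * diagW ?t' ?w' ?t ?w (x h)"
      by (rule diagW_mult[OF l(1) d(5)]) (use d in auto)
    moreover have "diagW ?t' ?w' ?t ?w (x' h * ?v) = diagW ?t' ?w' ?t ?w (x' h) * diagW ?t ?w ?t ?w ?v"
      by (rule diagW_mult[OF p(4) d(3)]) (use d in auto)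
    ultimately show ?thesis using e p by (simp add: mat_one_mult diag_dims)
  qed
  then show "xT \<Gamma> \<tau> x = xT \<Gamma> \<tau> x'" "xW \<Gamma> \<tau> \<omega> x = xW \<Gamma> \<tau> \<omega> x'"
    by (auto simp: xT_def xW_def)
qed

lemma the_elem_image_const:
  assumes "z \<in> C" "\<And>u. u \<in> C \<Longrightarrow> f u = a"
  shows "the_elem (f ` C) = a"
proof -
  have "f ` C = {a}" using assms by blast
  then show ?thesis by simp
qed

lemma p1_class:
  assumes "(g, x) \<in> reps_over \<Gamma> J \<tau> \<omega> y"
  shows "p1 \<Gamma> \<tau> \<omega> (coset_rel \<Gamma> J \<tau> \<omega> True y `` {(g, x)}) = (xT \<Gamma> \<tau> x, xW \<Gamma> \<tau> \<omega> x)"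
  unfolding p1_def
proof (rule the_elem_image_const)
  show "(g, x) \<in> coset_rel \<Gamma> J \<tau> \<omega> True y `` {(g, x)}"
    by (rule equiv_class_self[OF equiv_coset_rel assms])
  fix u assume "u \<in> coset_rel \<Gamma> J \<tau> \<omega> True y `` {(g, x)}"
  then obtain g' x' where "u = (g', x')" "((g, x), (g', x')) \<in> coset_rel \<Gamma> J \<tau> \<omega> True y" by (cases u) auto
  then show "(case u of (g, x) \<Rightarrow> (xT \<Gamma> \<tau> x, xW \<Gamma> \<tau> \<omega> x)) = (xT \<Gamma> \<tau> x, xW \<Gamma> \<tau> \<omega> x)"
    using coset_rel_xT_xW[of g x g' x'] by simp
qed

lemma p3_class:
  assumes "z \<in> reps_over \<Gamma> J \<tau> \<omega> y"
  shows "p3 \<Gamma> (coset_rel \<Gamma> J \<tau> \<omega> b y `` {z}) = y"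
  unfolding p3_def
proof (rule the_elem_image_const)
  show "z \<in> coset_rel \<Gamma> J \<tau> \<omega> b y `` {z}"
    by (rule equiv_class_self[OF equiv_coset_rel assms])
qed (auto simp: coset_rel_def reps_over_def)

lemma p2_class:
  assumes "z \<in> reps_over \<Gamma> J \<tau> \<omega> y"
  shows "p2 \<Gamma> J \<tau> \<omega> (coset_rel \<Gamma> J \<tau> \<omega> True y `` {z}) = coset_rel \<Gamma> J \<tau> \<omega> False y `` (coset_rel \<Gamma> J \<tau> \<omega> True y `` {z})"
    "coset_rel \<Gamma> J \<tau> \<omega> False y `` (coset_rel \<Gamma> J \<tau> \<omega> True y `` {z}) = coset_rel \<Gamma> J \<tau> \<omega> False y `` {z}"
proof -
  let ?C = "coset_rel \<Gamma> J \<tau> \<omega> True y `` {z}"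
  have C: "?C \<subseteq> reps_over \<Gamma> J \<tau> \<omega> y" by (auto simp: coset_rel_def)
  have "twrel \<Gamma> J \<tau> \<omega> (Qgrp \<Gamma> \<tau> \<omega>) `` ?C = (\<Union>z'\<in>?C. twrel \<Gamma> J \<tau> \<omega> (Pgrp \<Gamma> \<tau> \<omega> False) `` {z'})"
    by (auto simp: Qgrp_eq)
  also have "\<dots> = (\<Union>z'\<in>?C. coset_rel \<Gamma> J \<tau> \<omega> False y `` {z'})"
    using C twrel_class by (intro SUP_cong refl) blast
  also have "\<dots> = coset_rel \<Gamma> J \<tau> \<omega> False y `` ?C" by auto
  finally show "p2 \<Gamma> J \<tau> \<omega> ?C = coset_rel \<Gamma> J \<tau> \<omega> False y `` ?C" by (simp add: p2_def)
  have "(z, z) \<in> coset_rel \<Gamma> J \<tau> \<omega> True y" using equiv_class_self[OF equiv_coset_rel assms] by auto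
  moreover have "trans (coset_rel \<Gamma> J \<tau> \<omega> False y)" by (rule equivE[OF equiv_coset_rel])
  ultimately show "coset_rel \<Gamma> J \<tau> \<omega> False y `` ?C = coset_rel \<Gamma> J \<tau> \<omega> False y `` {z}"
    using coset_rel_True_False by (fast elim: transE)
qed

end

locale hall_space = rep_graph \<Gamma> q K
  for \<Gamma> :: "('v, 'h) agraph" and q :: nat and K :: "'k::field itself" +
  fixes J :: "'h set"
  assumes J: "haut \<Gamma> ` J = J" "J \<subseteq> arrs \<Gamma>"
begin

abbreviation frob :: "('v \<Rightarrow> 'k mat) \<times> ('h, 'k) rep \<Rightarrow> ('v \<Rightarrow> 'k mat) \<times> ('h, 'k) rep" where
  "frob \<equiv> map_prod (frobG \<Gamma> q) (frobE \<Gamma> q)"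

lemma frob_over:
  assumes y: "frobE \<Gamma> q y = y" and z: "z \<in> reps_over \<Gamma> J \<tau> \<omega> y"
  shows "frob z \<in> reps_over \<Gamma> J \<tau> \<omega> y"
proof -
  obtain g x where [simp]: "z = (g, x)" by (cases z)
  note o = reps_overD[OF z[simplified]]
  show ?thesis
    using o y frobE_act[OF o(1,4)] frobE_SW[OF Esp_ext[OF o(4)] J] frobG_Grp[OF Grp_ext[OF o(1)]]
    by (simp add: reps_over_def)
qed

lemma frob_coset_rel:
  assumes y: "frobE \<Gamma> q y = y" and z: "z \<in> reps_over \<Gamma> J \<tau> \<omega> y" "z' \<in> reps_over \<Gamma> J \<tau> \<omega> y"
  shows "(frob z, frob z') \<in> coset_rel \<Gamma> J \<tau> \<omega> b y \<longleftrightarrow> (z, z') \<in> coset_rel \<Gamma> J \<tau> \<omega> b y"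
proof -
  obtain g x g' x' where [simp]: "z = (g, x)" "z' = (g', x')" by (cases z; cases z')
  note o = reps_overD[OF z(1)[simplified]] reps_overD[OF z(2)[simplified]]
  have *: "parab b (vd \<tau> v) (vd \<omega> v) (minv (frobG \<Gamma> q g' (vaut \<Gamma> v)) * frobG \<Gamma> q g (vaut \<Gamma> v)) \<longleftrightarrow>
      parab b (vd \<tau> v) (vd \<omega> v) (minv (g' v) * g v)" if v: "v \<in> verts \<Gamma>" for v
  proof -
    note gd = GrpD[OF o(1) v] GrpD[OF o(6) v]
    have "minv (frobG \<Gamma> q g' (vaut \<Gamma> v)) * frobG \<Gamma> q g (vaut \<Gamma> v) = fr (minv (g' v) * g v)"
      using gd v by (simp add: frobG_vaut fr_minv fr_mult minv_props)
    then show ?thesis using gd by (simp add: parab_fr minv_props vdim_dplus)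
  qed
  have "(\<forall>v\<in>verts \<Gamma>. parab b (vd \<tau> v) (vd \<omega> v) (minv (frobG \<Gamma> q g' v) * frobG \<Gamma> q g v)) \<longleftrightarrow>
      (\<forall>v\<in>verts \<Gamma>. parab b (vd \<tau> v) (vd \<omega> v) (minv (g' v) * g v))"
    by (subst ball_vaut) (simp add: vdim_vaut *)
  then show ?thesis using z frob_over[OF y z(1)] frob_over[OF y z(2)] by (simp add: coset_rel_def)
qed

text \<open>
  If the image of \<open>z\<close> is equivalent to \<open>z\<close>, then Frobenius maps the class into itself; it maps the
  class onto itself because it is surjective and because the relation holds between two points
  whenever it holds between their images.
\<close>

lemma stable_class_iff:
  assumes y: "frobE \<Gamma> q y = y" and z: "z \<in> reps_over \<Gamma> J \<tau> \<omega> y"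
  shows "frob ` (coset_rel \<Gamma> J \<tau> \<omega> b y `` {z}) = coset_rel \<Gamma> J \<tau> \<omega> b y `` {z} \<longleftrightarrow>
    (frob z, z) \<in> coset_rel \<Gamma> J \<tau> \<omega> b y"
proof -
  let ?R = "coset_rel \<Gamma> J \<tau> \<omega> b y"
  note eq = equiv_coset_rel[of J \<tau> \<omega> y b]
  have "sym ?R" "trans ?R" using eq by (auto elim: equivE)
  have sym: "(v, u) \<in> ?R" if "(u, v) \<in> ?R" for u v
    using \<open>sym ?R\<close> that by (rule symD)
  have trans: "(u, w) \<in> ?R" if "(u, v) \<in> ?R" "(v, w) \<in> ?R" for u v w
    using \<open>trans ?R\<close> that by (rule transD)
  have refl: "(z, z) \<in> ?R" using equiv_class_self[OF eq z] by auto
  show ?thesis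
  proof
    assume "frob ` (?R `` {z}) = ?R `` {z}"
    then have "frob z \<in> ?R `` {z}" using refl by blast
    then show "(frob z, z) \<in> ?R" using sym by auto
  next
    assume fz: "(frob z, z) \<in> ?R"
    show "frob ` (?R `` {z}) = ?R `` {z}"
    proof (intro equalityI subsetI)
      fix u assume "u \<in> frob ` (?R `` {z})"
      then obtain w where w: "u = frob w" "(z, w) \<in> ?R" by auto
      then have "(frob z, u) \<in> ?R" using frob_coset_rel[OF y z, of w] by (auto simp: coset_rel_def)
      then show "u \<in> ?R `` {z}" using trans[OF sym[OF fz]] by auto
    next
      fix u assume u: "u \<in> ?R `` {z}"
      obtain g x where ux: "u = (g, x)" by (cases u)
      have uo: "(g, x) \<in> reps_over \<Gamma> J \<tau> \<omega> y" using u ux by (auto simp: coset_rel_def)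
      note o = reps_overD[OF uo]
      obtain g0 x0 where w: "g0 \<in> extensional (verts \<Gamma>)" "frobG \<Gamma> q g0 = g"
        "x0 \<in> extensional (arrs \<Gamma>)" "frobE \<Gamma> q x0 = x"
        using frobG_surj[OF Grp_ext[OF o(1)]] frobE_surj[OF Esp_ext[OF o(4)]] by metis
      have g0: "g0 \<in> Grp \<Gamma> (dplus \<tau> \<omega>)" using frobG_Grp[OF w(1)] o(1) w(2) by simp
      have x0: "x0 \<in> SW \<Gamma> J \<tau> \<omega>" using frobE_SW[OF w(3) J] o(2) w(4) by simp
      have "frobE \<Gamma> q (act \<Gamma> g0 x0) = frobE \<Gamma> q y"
        using frobE_act[OF g0 SW_Esp[OF x0]] w o(3) y by simp
      moreover have "y \<in> extensional (arrs \<Gamma>)" using o(3) act_ext by metis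
      ultimately have "act \<Gamma> g0 x0 = y" using frobE_inj[OF act_ext] by blast
      then have wo: "(g0, x0) \<in> reps_over \<Gamma> J \<tau> \<omega> y" using g0 x0 by (simp add: reps_over_def)
      have uf: "u = frob (g0, x0)" using ux w by simp
      have "(frob z, frob (g0, x0)) \<in> ?R"
        unfolding uf[symmetric] by (rule trans[OF fz]) (use u in simp)
      then have "(z, (g0, x0)) \<in> ?R" using frob_coset_rel[OF y z wo] by simp
      then show "u \<in> frob ` (?R `` {z})" using uf by blast
    qed
  qed
qed

lemma frob_fixed_of_stable:
  assumes z: "z \<in> reps_over \<Gamma> J \<tau> \<omega> y"
    and C: "frob ` (coset_rel \<Gamma> J \<tau> \<omega> b y `` {z}) = coset_rel \<Gamma> J \<tau> \<omega> b y `` {z}"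
  shows "frobE \<Gamma> q y = y"
proof -
  obtain g x where [simp]: "z = (g, x)" by (cases z)
  note o = reps_overD[OF z[simplified]]
  have "frob z \<in> coset_rel \<Gamma> J \<tau> \<omega> b y `` {z}"
    using C equiv_class_self[OF equiv_coset_rel z, of b] by blast
  then have "act \<Gamma> (frobG \<Gamma> q g) (frobE \<Gamma> q x) = y" by (auto simp: coset_rel_def reps_over_def)
  then show ?thesis using frobE_act[OF o(1,4)] o(3) by simp
qed

lemma twprodF_over:
  fixes y :: "('h, 'k) rep"
  assumes y: "frobE \<Gamma> q y = y"
  shows "{C \<in> twprodF \<Gamma> J q \<tau> \<omega> (Pgrp \<Gamma> \<tau> \<omega> b). p3 \<Gamma> C = y} =
    rational \<Gamma> J q \<tau> \<omega> b y // coset_rel \<Gamma> J \<tau> \<omega> b y"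
proof (intro equalityI subsetI)
  fix C assume "C \<in> {C \<in> twprodF \<Gamma> J q \<tau> \<omega> (Pgrp \<Gamma> \<tau> \<omega> b). p3 \<Gamma> C = y}"
  then obtain g x where C: "C = twrel \<Gamma> J \<tau> \<omega> (Pgrp \<Gamma> \<tau> \<omega> b) `` {(g, x)}"
    "g \<in> Grp \<Gamma> (dplus \<tau> \<omega>)" "x \<in> SW \<Gamma> J \<tau> \<omega>" "frob ` C = C" "p3 \<Gamma> C = y"
    unfolding twprodF_def twprod_def by (auto elim!: quotientE)
  have z: "(g, x) \<in> reps_over \<Gamma> J \<tau> \<omega> (act \<Gamma> g x)" using C by (auto simp: reps_over_def)
  then have "act \<Gamma> g x = y" using C twrel_class[OF z] p3_class[OF z] by simp
  then have z: "(g, x) \<in> reps_over \<Gamma> J \<tau> \<omega> y" using z by simp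
  have "C = coset_rel \<Gamma> J \<tau> \<omega> b y `` {(g, x)}" using C twrel_class[OF z] by simp
  moreover have "(g, x) \<in> rational \<Gamma> J q \<tau> \<omega> b y"
    using z stable_class_iff[OF y z, of b] C(4) calculation unfolding rational_def by auto
  ultimately show "C \<in> rational \<Gamma> J q \<tau> \<omega> b y // coset_rel \<Gamma> J \<tau> \<omega> b y"
    by (auto intro: quotientI)
next
  fix C assume "C \<in> rational \<Gamma> J q \<tau> \<omega> b y // coset_rel \<Gamma> J \<tau> \<omega> b y"
  then obtain z where C: "C = coset_rel \<Gamma> J \<tau> \<omega> b y `` {z}" "z \<in> rational \<Gamma> J q \<tau> \<omega> b y"
    by (auto elim!: quotientE)
  then have z: "z \<in> reps_over \<Gamma> J \<tau> \<omega> y" by (auto simp: rational_def)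
  have "frob ` C = C" unfolding C(1) stable_class_iff[OF y z] using C(2) by (simp add: rational_def)
  moreover have "C = twrel \<Gamma> J \<tau> \<omega> (Pgrp \<Gamma> \<tau> \<omega> b) `` {z}" using C twrel_class[OF z] by simp
  moreover have "z \<in> Grp \<Gamma> (dplus \<tau> \<omega>) \<times> SW \<Gamma> J \<tau> \<omega>" using z by (auto simp: reps_over_def)
  ultimately show "C \<in> {C \<in> twprodF \<Gamma> J q \<tau> \<omega> (Pgrp \<Gamma> \<tau> \<omega> b). p3 \<Gamma> C = y}"
    using p3_class[OF z, of b] C(1) by (auto simp: twprodF_def twprod_def intro: quotientI)
qed

lemma p3_twprodF:
  fixes C :: "(('v \<Rightarrow> 'k mat) \<times> ('h, 'k) rep) set"
  assumes "C \<in> twprodF \<Gamma> J q \<tau> \<omega> (Pgrp \<Gamma> \<tau> \<omega> b)"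
  shows "p3 \<Gamma> C \<in> EF \<Gamma> J q (dplus \<tau> \<omega>)"
proof -
  obtain g x where C: "C = twrel \<Gamma> J \<tau> \<omega> (Pgrp \<Gamma> \<tau> \<omega> b) `` {(g, x)}"
    "g \<in> Grp \<Gamma> (dplus \<tau> \<omega>)" "x \<in> SW \<Gamma> J \<tau> \<omega>" "frob ` C = C"
    using assms unfolding twprodF_def twprod_def by (auto elim!: quotientE)
  have z: "(g, x) \<in> reps_over \<Gamma> J \<tau> \<omega> (act \<Gamma> g x)" using C by (auto simp: reps_over_def)
  have C1: "C = coset_rel \<Gamma> J \<tau> \<omega> b (act \<Gamma> g x) `` {(g, x)}" using C twrel_class[OF z] by simp
  have "frobE \<Gamma> q (act \<Gamma> g x) = act \<Gamma> g x"
    by (rule frob_fixed_of_stable[OF z]) (use C(4) C1 in simp)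
  moreover have "act \<Gamma> g x \<in> Esp \<Gamma> J (dplus \<tau> \<omega>)"
    using act_Esp[OF reps_overD(1,4)[OF z] J(2)] reps_overD(5)[OF z] by simp
  ultimately show ?thesis using p3_class[OF z, of b] C1 by (simp add: EF_def)
qed

lemma Ind_eq_0:
  fixes y :: "('h, 'k) rep"
  shows "y \<notin> EF \<Gamma> J q (dplus \<tau> \<omega>) \<Longrightarrow> Ind \<Gamma> J q s \<tau> \<omega> \<Phi> y = 0"
proof -
  assume "y \<notin> EF \<Gamma> J q (dplus \<tau> \<omega>)"
  then have "{C \<in> twprodF \<Gamma> J q \<tau> \<omega> (Qgrp \<Gamma> \<tau> \<omega>). p3 \<Gamma> C = y} = {}"
    unfolding Qgrp_eq using p3_twprodF by blast
  then show ?thesis unfolding Ind_def push_def by (simp only:) simp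
qed

text \<open>
  The classes in the definition of \<open>Ind\<close> that lie over \<open>y\<close> are the classes of rational
  representatives over \<open>y\<close>.
\<close>

lemma Ind_eq:
  fixes y :: "('h, 'k) rep"
  assumes "y \<in> EF \<Gamma> J q (dplus \<tau> \<omega>)"
  shows "Ind \<Gamma> J q s \<tau> \<omega> \<Phi> y = s powi (- mOm \<Gamma> \<tau> \<omega>) *
     (1 / of_nat (card ((GF \<Gamma> q \<tau> :: ('v \<Rightarrow> 'k mat) set) \<times> (GF \<Gamma> q \<omega> :: ('v \<Rightarrow> 'k mat) set)))) *
     (\<Sum>D\<in>rational \<Gamma> J q \<tau> \<omega> False y // coset_rel \<Gamma> J \<tau> \<omega> False y.
      \<Sum>C\<in>{C \<in> rational \<Gamma> J q \<tau> \<omega> True y // coset_rel \<Gamma> J \<tau> \<omega> True y. coset_rel \<Gamma> J \<tau> \<omega> False y `` C = D}.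
        \<Phi> (p1 \<Gamma> \<tau> \<omega> C))"
proof -
  have y: "frobE \<Gamma> q y = y" using assms by (simp add: EF_def)
  have "{C \<in> twprodF \<Gamma> J q \<tau> \<omega> (Ugrp \<Gamma> \<tau> \<omega>). p2 \<Gamma> J \<tau> \<omega> C = D} =
      {C \<in> rational \<Gamma> J q \<tau> \<omega> True y // coset_rel \<Gamma> J \<tau> \<omega> True y. coset_rel \<Gamma> J \<tau> \<omega> False y `` C = D}"
    if D: "D \<in> rational \<Gamma> J q \<tau> \<omega> False y // coset_rel \<Gamma> J \<tau> \<omega> False y" for D
  proof -
    have "p3 \<Gamma> C = y" if C: "C \<in> twprodF \<Gamma> J q \<tau> \<omega> (Pgrp \<Gamma> \<tau> \<omega> True)" "p2 \<Gamma> J \<tau> \<omega> C = D" for C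
    proof -
      obtain g x where gx: "C = twrel \<Gamma> J \<tau> \<omega> (Pgrp \<Gamma> \<tau> \<omega> True) `` {(g, x)}"
        "g \<in> Grp \<Gamma> (dplus \<tau> \<omega>)" "x \<in> SW \<Gamma> J \<tau> \<omega>"
        using C unfolding twprodF_def twprod_def by (auto elim!: quotientE)
      have z: "(g, x) \<in> reps_over \<Gamma> J \<tau> \<omega> (act \<Gamma> g x)" using gx by (auto simp: reps_over_def)
      have "(g, x) \<in> D"
        using C(2) gx(1) twrel_class[OF z] p2_class[OF z] equiv_class_self[OF equiv_coset_rel z, of False] by simp
      then have "(g, x) \<in> reps_over \<Gamma> J \<tau> \<omega> y" using D by (auto elim!: quotientE simp: coset_rel_def)
      then show ?thesis using p3_class twrel_class gx(1) by metis
    qed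
    moreover have "p2 \<Gamma> J \<tau> \<omega> C = coset_rel \<Gamma> J \<tau> \<omega> False y `` C"
      if "C \<in> rational \<Gamma> J q \<tau> \<omega> True y // coset_rel \<Gamma> J \<tau> \<omega> True y" for C
      using that by (auto elim!: quotientE simp only: rational_def mem_Collect_eq p2_class(1))
    ultimately show ?thesis using twprodF_over[OF y, of \<tau> \<omega> True] unfolding Ugrp_eq by blast
  qed
  then show ?thesis
    using twprodF_over[OF y, of \<tau> \<omega> False]
    unfolding Ind_def push_def pull_def Qgrp_eq by simp
qed

end

section \<open>Edge contraction\<close>

lemma (in admissible_graph) vorbit_eq:
  assumes "v \<in> verts \<Gamma>" "u \<in> vorbit \<Gamma> v"
  shows "vorbit \<Gamma> u = vorbit \<Gamma> v"
proof -
  have "u \<in> verts \<Gamma> \<and> vorbit \<Gamma> u = vorbit \<Gamma> v"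
    using assms(2) unfolding vorbit_def
  proof (induction rule: orbit.induct)
    case base
    then show ?case using vorbitD[OF assms(1)] vaut_in[OF assms(1)] by (simp add: vorbit_def)
  next
    case (step u)
    then show ?case using vorbitD(3)[of u] vaut_in[of u] by (simp add: vorbit_def)
  qed
  then show ?thesis by simp
qed

locale contraction = rep_graph \<Gamma> q K
  for \<Gamma> :: "('v, 'h) agraph" and q :: nat and K :: "'k::field itself" +
  fixes ip im :: "'v set"
  assumes pair: "contractible_pair \<Gamma> ip im"
begin

abbreviation pm :: "'h set" where "pm \<equiv> arrs_pm \<Gamma> ip im"
abbreviation \<Delta> :: "('v, 'h carrow) agraph" where "\<Delta> \<equiv> contract \<Gamma> ip im"
abbreviation \<mu> :: "('h, 'k) rep \<Rightarrow> ('h carrow, 'k) rep" where "\<mu> \<equiv> mu \<Gamma> ip im"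

lemma orbits: "ip \<in> vorbits \<Gamma>" "im \<in> vorbits \<Gamma>"
  using pair by (auto simp: contractible_pair_def)

lemma orbit_of: "i \<in> vorbits \<Gamma> \<Longrightarrow> v \<in> i \<Longrightarrow> vorbit \<Gamma> v = i \<and> v \<in> verts \<Gamma>"
  unfolding vorbits_def using vorbit_eq vorbitD(2) by blast

lemma pm_within: "arrs_within \<Gamma> (ip \<union> im) = pm"
  using pair by (auto simp: contractible_pair_def arrs_within_def arrs_pm_def)

lemma card_pm: "card pm = card im" "card ip = card im" "0 < card im"
proof -
  show "card pm = card im" "card ip = card im"
    using pair by (auto simp: contractible_pair_def pm_within)
  have "im \<noteq> {}" using orbits(2) vorbitD(1) by (auto simp: vorbits_def)
  moreover have "finite im" using orbits(2) orbit_of finite_verts by (metis finite_subset subsetI)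
  ultimately show "0 < card im" by (simp add: card_gt_0_iff)
qed

lemma ip_im: "ip \<inter> im = {}"
proof (rule ccontr)
  assume "ip \<inter> im \<noteq> {}"
  then have "ip = im" using orbit_of orbits by blast
  then have "pm = {}" using arrD(6) orbit_of[OF orbits(2)] by (auto simp: arrs_pm_def)
  then show False using card_pm by simp
qed

lemma pm_arrs: "pm \<subseteq> arrs \<Gamma>" and finite_pm: "finite pm"
  using finite_arrs by (auto simp: arrs_pm_def)

lemma pmD: "h \<in> pm \<Longrightarrow> h \<in> arrs \<Gamma> \<and> src \<Gamma> h \<in> ip \<and> tgt \<Gamma> h \<in> im"
  by (auto simp: arrs_pm_def)

lemma vaut_orbit: "i \<in> vorbits \<Gamma> \<Longrightarrow> v \<in> verts \<Gamma> \<Longrightarrow> vaut \<Gamma> v \<in> i \<longleftrightarrow> v \<in> i"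
  using orbit_of[of i v] orbit_of[of i "vaut \<Gamma> v"] vorbitD(1,3) vaut_in by metis

lemma haut_in_pm: "h \<in> arrs \<Gamma> \<Longrightarrow> haut \<Gamma> h \<in> pm \<longleftrightarrow> h \<in> pm"
  using vaut_orbit orbits arrD by (auto simp: arrs_pm_def)

lemma haut_pm: "haut \<Gamma> ` pm = pm"
  by (rule endo_inj_surj[OF finite_pm])
    (use haut_in_pm pm_arrs haut_bij in \<open>auto simp: bij_betw_def intro: inj_on_subset\<close>)

text \<open>
  Applied to the sources and to the targets of the contracted arrows.
\<close>

lemma stable_subset_orbit:
  assumes "i \<in> vorbits \<Gamma>" "S \<subseteq> i" "S \<noteq> {}" "\<And>v. v \<in> S \<Longrightarrow> vaut \<Gamma> v \<in> S"
  shows "S = i"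
proof -
  obtain v where v: "v \<in> S" using assms(3) by auto
  then have "i = orbit (vaut \<Gamma>) v" using orbit_of[OF assms(1)] assms(2) by (auto simp: vorbit_def)
  moreover have "u \<in> S" if "u \<in> orbit (vaut \<Gamma>) v" for u
    using that by induction (use v assms(4) in auto)
  ultimately show ?thesis using assms(2) by auto
qed

text \<open>
  The sources fill the orbit $i_+$, and the targets $i_-$, by transitivity; both maps are bijective
  because there are as many arrows as vertices.
\<close>

lemma pm_bij: "bij_betw (src \<Gamma>) pm ip" "bij_betw (tgt \<Gamma>) pm im"
proof -
  have ne: "pm \<noteq> {}" using card_pm by auto
  have st: "haut \<Gamma> h \<in> pm" if "h \<in> pm" for h using that haut_pm by blast
  have "src \<Gamma> ` pm = ip"
  proof (rule stable_subset_orbit[OF orbits(1)])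
    fix v assume "v \<in> src \<Gamma> ` pm"
    then obtain h where h: "h \<in> pm" "v = src \<Gamma> h" by auto
    then show "vaut \<Gamma> v \<in> src \<Gamma> ` pm"
      using arrD(4)[of h] st[OF h(1)] pmD by (metis image_eqI)
  qed (use ne pmD in auto)
  then show "bij_betw (src \<Gamma>) pm ip"
    using card_pm finite_pm by (auto simp: bij_betw_def intro: eq_card_imp_inj_on)
  have "tgt \<Gamma> ` pm = im"
  proof (rule stable_subset_orbit[OF orbits(2)])
    fix v assume "v \<in> tgt \<Gamma> ` pm"
    then obtain h where h: "h \<in> pm" "v = tgt \<Gamma> h" by auto
    then show "vaut \<Gamma> v \<in> tgt \<Gamma> ` pm"
      using arrD(5)[of h] st[OF h(1)] pmD by (metis image_eqI)
  qed (use ne pmD in auto)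
  then show "bij_betw (tgt \<Gamma>) pm im"
    using card_pm finite_pm by (auto simp: bij_betw_def intro: eq_card_imp_inj_on)
qed

text \<open>
  The only arrow from $i_+$ that ends in the vertex \<open>v\<close> of $i_-$.
\<close>

definition arrow_into :: "'v \<Rightarrow> 'h" where "arrow_into v = the_inv_into pm (tgt \<Gamma>) v"

lemma arrow_into: "v \<in> im \<Longrightarrow> arrow_into v \<in> pm" "v \<in> im \<Longrightarrow> tgt \<Gamma> (arrow_into v) = v" "h \<in> pm \<Longrightarrow> arrow_into (tgt \<Gamma> h) = h"
proof -
  have inj: "inj_on (tgt \<Gamma>) pm" and img: "tgt \<Gamma> ` pm = im" using pm_bij(2) by (auto simp: bij_betw_def)
  show "arrow_into v \<in> pm" if "v \<in> im" using the_inv_into_into[OF inj] that img by (auto simp: arrow_into_def)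
  show "tgt \<Gamma> (arrow_into v) = v" if "v \<in> im" using f_the_inv_into_f[OF inj] that img by (auto simp: arrow_into_def)
  show "arrow_into (tgt \<Gamma> h) = h" if "h \<in> pm" using the_inv_into_f_f[OF inj that] by (simp add: arrow_into_def)
qed

lemma arrow_into_vaut: "v \<in> im \<Longrightarrow> arrow_into (vaut \<Gamma> v) = haut \<Gamma> (arrow_into v)"
  using arrow_into(3)[of "haut \<Gamma> (arrow_into v)"] arrow_into(1,2)[of v] haut_pm arrD(5) pmD by auto

text \<open>
  The vertex of the contracted graph into which \<open>v\<close> is merged.
\<close>

definition root :: "'v \<Rightarrow> 'v" where "root v = (if v \<in> im then src \<Gamma> (arrow_into v) else v)"

text \<open>
  The arrow of the contracted graph that comes from an arrow \<open>h\<close> outside the contracted ones. It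
  joins the vertices into which the ends of \<open>h\<close> are merged (\<open>kept_ends\<close>), and every arrow of the
  contracted graph arises once in this way (\<open>arrs_contract\<close>, \<open>inj_kept\<close>).
\<close>

definition kept :: "'h \<Rightarrow> 'h carrow" where
  "kept h = (if src \<Gamma> h \<in> im then Comp h (arrow_into (src \<Gamma> h))
     else if tgt \<Gamma> h \<in> im then BarComp (arrow_into (tgt \<Gamma> h)) h else Keep h)"

lemma arr_cases:
  assumes "h \<in> arrs \<Gamma>" "h \<notin> pm"
  shows "src \<Gamma> h \<in> im \<Longrightarrow> tgt \<Gamma> h \<notin> im \<and> tgt \<Gamma> h \<notin> ip"
    "tgt \<Gamma> h \<in> im \<Longrightarrow> src \<Gamma> h \<notin> im \<and> src \<Gamma> h \<notin> ip"
proof -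
  have "\<not> (src \<Gamma> h \<in> ip \<union> im \<and> tgt \<Gamma> h \<in> ip \<union> im)"
    using assms pm_within by (auto simp: arrs_within_def)
  then show "src \<Gamma> h \<in> im \<Longrightarrow> tgt \<Gamma> h \<notin> im \<and> tgt \<Gamma> h \<notin> ip"
    "tgt \<Gamma> h \<in> im \<Longrightarrow> src \<Gamma> h \<notin> im \<and> src \<Gamma> h \<notin> ip" by auto
qed

lemma arrs_contract: "arrs \<Delta> = kept ` (arrs \<Gamma> - pm)"
proof (intro equalityI subsetI)
  fix k assume "k \<in> arrs \<Delta>"
  then consider (a) h where "k = Keep h" "h \<in> arrs \<Gamma>" "src \<Gamma> h \<notin> im" "tgt \<Gamma> h \<notin> im"
    | (b) h h1 where "k = Comp h h1" "h1 \<in> pm" "h \<in> arrs \<Gamma>" "src \<Gamma> h = tgt \<Gamma> h1"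
    | (c) h h1 where "k = BarComp h1 h" "h1 \<in> pm" "h \<in> arrs \<Gamma>" "tgt \<Gamma> h = tgt \<Gamma> h1" "src \<Gamma> h \<notin> ip"
    by (auto simp: contract_def)
  then show "k \<in> kept ` (arrs \<Gamma> - pm)"
  proof cases
    case a
    then show ?thesis using pmD by (intro image_eqI[of _ _ h]) (auto simp: kept_def)
  next
    case b
    then have "src \<Gamma> h \<in> im" using pmD by auto
    then show ?thesis using b pmD[of h] ip_im arrow_into(3) by (intro image_eqI[of _ _ h]) (auto simp: kept_def)
  next
    case c
    then have "tgt \<Gamma> h \<in> im" "h \<notin> pm" using pmD by auto
    then show ?thesis using c arr_cases[of h] arrow_into(3) by (intro image_eqI[of _ _ h]) (auto simp: kept_def)
  qed
next
  fix k assume "k \<in> kept ` (arrs \<Gamma> - pm)"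
  then obtain h where h: "k = kept h" "h \<in> arrs \<Gamma>" "h \<notin> pm" by auto
  then show "k \<in> arrs \<Delta>"
    using arr_cases[OF h(2,3)] arrow_into by (auto simp: kept_def contract_def)
qed

lemma inj_kept: "inj_on kept (arrs \<Gamma> - pm)"
  by (rule inj_onI) (auto simp: kept_def split: if_splits)

lemma verts_contract [simp]: "verts \<Delta> = verts \<Gamma> - im"
  and vaut_contract [simp]: "vaut \<Delta> = vaut \<Gamma>"
  and haut_contract [simp]: "haut \<Delta> = map_carrow (haut \<Gamma>)"
  and vorbit_contract [simp]: "vorbit \<Delta> = vorbit \<Gamma>"
  and vdim_contract [simp]: "vdim \<Delta> = vdim \<Gamma>"
  by (auto simp: contract_def vorbit_def vdim_def fun_eq_iff)

lemma kept_ends: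
  assumes "h \<in> arrs \<Gamma>" "h \<notin> pm"
  shows "src \<Delta> (kept h) = root (src \<Gamma> h)" "tgt \<Delta> (kept h) = root (tgt \<Gamma> h)"
  using arr_cases[OF assms] by (auto simp: kept_def root_def contract_def)

lemma root_vaut: "v \<in> verts \<Gamma> \<Longrightarrow> root (vaut \<Gamma> v) = vaut \<Gamma> (root v)"
  using vaut_orbit[OF orbits(2)] arrow_into_vaut[of v] arrD(4)[of "arrow_into v"] arrow_into(1)[of v] pmD[of "arrow_into v"] by (auto simp: root_def)

lemma root_in: "v \<in> verts \<Gamma> \<Longrightarrow> root v \<in> verts \<Gamma> - im"
  using arrow_into(1)[of v] pmD[of "arrow_into v"] arrD(1) ip_im by (auto simp: root_def)

lemma kept_haut: "h \<in> arrs \<Gamma> \<Longrightarrow> kept (haut \<Gamma> h) = map_carrow (haut \<Gamma>) (kept h)"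
  using vaut_orbit[OF orbits(2)] arrow_into_vaut arrD[of h] by (auto simp: kept_def)

text \<open>
  Two ends of a surviving arrow cannot be merged into one orbit: this could only be that of $i_+$,
  but an arrow with one end in $i_-$ and the other in $i_+\cup i_-$ is one of the contracted ones.
\<close>

lemma admissible_contract: "admissible_graph \<Delta>"
proof
  have 1: "root (src \<Gamma> h) \<in> verts \<Gamma> - im \<and> root (tgt \<Gamma> h) \<in> verts \<Gamma> - im \<and>
     vorbit \<Gamma> (root (src \<Gamma> h)) \<noteq> vorbit \<Gamma> (root (tgt \<Gamma> h))" if h: "h \<in> arrs \<Gamma>" "h \<notin> pm" for h
  proof -
    have "vorbit \<Gamma> (root (src \<Gamma> h)) \<noteq> vorbit \<Gamma> (root (tgt \<Gamma> h))"
    proof (cases "src \<Gamma> h \<in> im \<or> tgt \<Gamma> h \<in> im")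
      case True
      have *: "root v \<in> ip" if "v \<in> im" for v using that arrow_into(1) pmD by (auto simp: root_def)
      have **: "vorbit \<Gamma> u \<noteq> vorbit \<Gamma> v" if "u \<in> ip" "v \<notin> ip" "v \<in> verts \<Gamma>" for u v
        using orbit_of[OF orbits(1) that(1)] vorbitD(1)[OF that(3)] that(2) by auto
      show ?thesis
        using True
      proof
        assume s: "src \<Gamma> h \<in> im"
        then have "root (tgt \<Gamma> h) = tgt \<Gamma> h" "tgt \<Gamma> h \<notin> ip" using arr_cases(1)[OF h] by (auto simp: root_def)
        then show ?thesis using **[OF *[OF s], of "tgt \<Gamma> h"] arrD(2)[OF h(1)] by simp
      next
        assume s: "tgt \<Gamma> h \<in> im"
        then have "root (src \<Gamma> h) = src \<Gamma> h" "src \<Gamma> h \<notin> ip" using arr_cases(2)[OF h] by (auto simp: root_def)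
        then show ?thesis using **[OF *[OF s], of "src \<Gamma> h"] arrD(1)[OF h(1)] by simp
      qed
    qed (use arrD(6)[OF h(1)] in \<open>simp add: root_def\<close>)
    then show ?thesis using root_in arrD h by blast
  qed
  have 2: "bij_betw (vaut \<Gamma>) (verts \<Gamma> - im) (verts \<Gamma> - im)"
  proof -
    have "vaut \<Gamma> ` (verts \<Gamma> - im) = verts \<Gamma> - im"
      by (rule endo_inj_surj) (use finite_verts vaut_bij vaut_orbit[OF orbits(2)] vaut_in in
        \<open>auto simp: bij_betw_def intro: inj_on_subset\<close>)
    then show ?thesis using vaut_bij by (auto simp: bij_betw_def intro: inj_on_subset)
  qed
  have 3: "haut \<Gamma> ` (arrs \<Gamma> - pm) = arrs \<Gamma> - pm"
    by (rule endo_inj_surj) (use finite_arrs haut_bij haut_in_pm arrD(3) in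
        \<open>auto simp: bij_betw_def intro: inj_on_subset\<close>)
  have 4: "map_carrow (haut \<Gamma>) ` arrs \<Delta> = arrs \<Delta>"
  proof -
    have "map_carrow (haut \<Gamma>) ` kept ` (arrs \<Gamma> - pm) = kept ` haut \<Gamma> ` (arrs \<Gamma> - pm)"
      by (auto simp: image_image kept_haut intro!: image_cong)
    then show ?thesis unfolding arrs_contract by (simp only: 3)
  qed
  have 5: "finite (arrs \<Delta>)" using finite_arrs by (simp add: arrs_contract)
  have 6: "bij_betw (map_carrow (haut \<Gamma>)) (arrs \<Delta>) (arrs \<Delta>)"
    using 4 5 by (simp add: bij_betw_def finite_surj_inj eq_card_imp_inj_on)
  have "src \<Delta> k \<in> verts \<Gamma> - im \<and> tgt \<Delta> k \<in> verts \<Gamma> - im \<and> vorbit \<Gamma> (src \<Delta> k) \<noteq> vorbit \<Gamma> (tgt \<Delta> k) \<and>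
      src \<Delta> (map_carrow (haut \<Gamma>) k) = vaut \<Gamma> (src \<Delta> k) \<and> tgt \<Delta> (map_carrow (haut \<Gamma>) k) = vaut \<Gamma> (tgt \<Delta> k)"
    if k: "k \<in> arrs \<Delta>" for k
  proof -
    obtain h where h: "k = kept h" "h \<in> arrs \<Gamma>" "h \<notin> pm" using k by (auto simp: arrs_contract)
    then have "haut \<Gamma> h \<notin> pm" using haut_in_pm by simp
    then show ?thesis using 1[OF h(2,3)] h arrD[OF h(2)]
      by (simp add: kept_ends kept_haut[symmetric] root_vaut)
  qed
  then show "admissible \<Delta>"
    unfolding admissible_def using finite_verts 2 5 6 by (simp, metis)
qed

sublocale con: rep_graph \<Delta> q K
  using admissible_contract by (simp add: rep_graph_def frobenius_axioms)

text \<open>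
  The identification of the space at \<open>root v\<close> with the space at \<open>v\<close> that \<open>x\<close> provides. It makes the
  three cases in the definition of the contraction into one formula (\<open>mu_kept\<close>).
\<close>

definition bridge :: "'v dimvec \<Rightarrow> ('h, 'k) rep \<Rightarrow> 'v \<Rightarrow> 'k mat" where
  "bridge \<nu> x v = (if v \<in> im then x (arrow_into v) else 1\<^sub>m (vd \<nu> v))"

lemma vdim_root: "\<nu> ip = \<nu> im \<Longrightarrow> v \<in> verts \<Gamma> \<Longrightarrow> vd \<nu> (root v) = vd \<nu> v"
  using arrow_into(1)[of v] pmD[of "arrow_into v"] orbit_of[OF orbits(1), of "src \<Gamma> (arrow_into v)"] orbit_of[OF orbits(2), of v]
  by (auto simp: root_def vdim_def)

lemma vdim_pm:
  assumes "\<nu> ip = \<nu> im" "h \<in> pm"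
  shows "vd \<nu> (src \<Gamma> h) = \<nu> im" "vd \<nu> (tgt \<Gamma> h) = \<nu> im"
  using assms pmD[OF assms(2)] orbit_of[OF orbits(1), of "src \<Gamma> h"] orbit_of[OF orbits(2), of "tgt \<Gamma> h"]
  by (auto simp: vdim_def)

lemma vdim_into:
  assumes "\<nu> ip = \<nu> im" "v \<in> im"
  shows "vd \<nu> (src \<Gamma> (arrow_into v)) = vd \<nu> v" "vd \<nu> v = \<nu> im"
  using vdim_pm[OF assms(1) arrow_into(1)[OF assms(2)]] arrow_into(2)[OF assms(2)] by auto

lemma bridge_props:
  assumes "\<nu> ip = \<nu> im" "\<And>h. h \<in> pm \<Longrightarrow> dim_row (x h) = \<nu> im \<and> invertible_mat (x h)" "v \<in> verts \<Gamma>"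
  shows "dim_row (bridge \<nu> x v) = vd \<nu> v" "dim_col (bridge \<nu> x v) = vd \<nu> v" "invertible_mat (bridge \<nu> x v)"
  using assms(2)[OF arrow_into(1), of v] vdim_into(2)[OF assms(1), of v]
  by (auto simp: bridge_def invertible_one invertible_square)

lemma Esp_pmD:
  assumes "\<nu> ip = \<nu> im" "x \<in> Esp \<Gamma> pm \<nu>" "h \<in> pm"
  shows "dim_row (x h) = \<nu> im" "dim_col (x h) = \<nu> im" "invertible_mat (x h)"
  using assms vdim_pm[OF assms(1,3)] EspD[OF assms(2), of h] pmD[OF assms(3)] Esp_invertible[OF assms(2,3)] by auto

lemma bridge_Esp:
  assumes "\<nu> ip = \<nu> im" "x \<in> Esp \<Gamma> pm \<nu>" "v \<in> verts \<Gamma>"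
  shows "dim_row (bridge \<nu> x v) = vd \<nu> v" "dim_col (bridge \<nu> x v) = vd \<nu> v" "invertible_mat (bridge \<nu> x v)"
  using bridge_props[OF assms(1) _ assms(3)] Esp_pmD[OF assms(1,2)] by auto

lemma mu_kept:
  assumes "\<nu> ip = \<nu> im" "x \<in> Esp \<Gamma> pm \<nu>" "h \<in> arrs \<Gamma>" "h \<notin> pm"
  shows "\<mu> x (kept h) = minv (bridge \<nu> x (tgt \<Gamma> h)) * x h * bridge \<nu> x (src \<Gamma> h)"
proof -
  have in_arrs: "kept h \<in> arrs \<Delta>" using assms(3,4) by (auto simp: arrs_contract)
  note d = EspD[OF assms(2,3)]
  have i: "dim_row (minv (x (arrow_into (tgt \<Gamma> h)))) = vd \<nu> (tgt \<Gamma> h)" "dim_col (minv (x (arrow_into (tgt \<Gamma> h)))) = vd \<nu> (tgt \<Gamma> h)" if "tgt \<Gamma> h \<in> im"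
    using Esp_pmD[OF assms(1,2) arrow_into(1)[OF that]] vdim_into(2)[OF assms(1) that] by (simp_all add: minv_props)
  show ?thesis
    using arr_cases[OF assms(3,4)] d i in_arrs
    by (auto simp: mu_def kept_def bridge_def invertible_one mat_one_mult)
qed

lemma mu_ext: "\<mu> x \<in> extensional (arrs \<Delta>)"
  by (simp add: mu_def)

lemma mu_Esp:
  fixes x :: "('h, 'k) rep"
  assumes "\<nu> ip = \<nu> im" "x \<in> Esp \<Gamma> pm \<nu>"
  shows "\<mu> x \<in> Esp \<Delta> {} \<nu>"
proof (rule EspI[OF mu_ext])
  fix k assume "k \<in> arrs \<Delta>"
  then obtain h where h: "k = kept h" "h \<in> arrs \<Gamma>" "h \<notin> pm" by (auto simp: arrs_contract)
  show "dim_row (\<mu> x k) = vdim \<Delta> \<nu> (tgt \<Delta> k) \<and> dim_col (\<mu> x k) = vdim \<Delta> \<nu> (src \<Delta> k)"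
    using h assms arrD[OF h(2)] by (simp add: mu_kept kept_ends vdim_root bridge_Esp minv_props)
qed simp

lemma contract_rep_eqI:
  assumes "u \<in> extensional (arrs \<Delta>)" "u' \<in> extensional (arrs \<Delta>)"
    "\<And>h. h \<in> arrs \<Gamma> \<Longrightarrow> h \<notin> pm \<Longrightarrow> u (kept h) = u' (kept h)"
  shows "u = u'"
  by (rule extensionalityI[OF assms(1,2)]) (use assms(3) in \<open>auto simp: arrs_contract\<close>)

abbreviation forget :: "('v \<Rightarrow> 'k mat) \<Rightarrow> ('v \<Rightarrow> 'k mat)" where
  "forget g \<equiv> restrict g (verts \<Gamma> - im)"

lemma forget_Grp: "g \<in> Grp \<Gamma> \<nu> \<Longrightarrow> forget g \<in> Grp \<Delta> \<nu>"
  by (rule GrpI) (auto simp: GrpD)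

text \<open>
  The group acts on the identifications by change of basis at both ends. In \<open>mu_act\<close> the components
  at $i_-$ cancel for this reason.
\<close>

lemma bridge_act:
  assumes "\<nu> ip = \<nu> im" "x \<in> Esp \<Gamma> pm \<nu>" "g \<in> Grp \<Gamma> \<nu>" "v \<in> verts \<Gamma>"
  shows "bridge \<nu> (act \<Gamma> g x) v = g v * bridge \<nu> x v * minv (g (root v))"
proof (cases "v \<in> im")
  case True
  then show ?thesis
    using arrow_into(1,2)[of v] pmD[of "arrow_into v"] by (simp add: bridge_def root_def act_app)
next
  case False
  then show ?thesis
    using GrpD[OF assms(3,4)] by (simp add: bridge_def root_def mat_one_mult minv_props)
qed

lemma mu_act:
  fixes x :: "('h, 'k) rep"
  assumes \<nu>: "\<nu> ip = \<nu> im" and x: "x \<in> Esp \<Gamma> pm \<nu>" and g: "g \<in> Grp \<Gamma> \<nu>"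
  shows "\<mu> (act \<Gamma> g x) = act \<Delta> (forget g) (\<mu> x)"
proof (rule contract_rep_eqI[OF mu_ext con.act_ext])
  fix h assume h: "h \<in> arrs \<Gamma>" "h \<notin> pm"
  let ?s = "src \<Gamma> h" and ?t = "tgt \<Gamma> h" and ?b = "bridge \<nu> x"
  have in_arrs: "kept h \<in> arrs \<Delta>" using h by (auto simp: arrs_contract)
  have x0: "x \<in> Esp \<Gamma> {} \<nu>" using x by (auto simp: Esp_open_subset[of _ _ pm])
  have ax: "act \<Gamma> g x \<in> Esp \<Gamma> pm \<nu>" using act_Esp[OF g x0 pm_arrs] x by simp
  note st = arrD(1)[OF h(1)] arrD(2)[OF h(1)]
  have r: "root ?s \<in> verts \<Gamma>" "root ?t \<in> verts \<Gamma>" "root ?s \<notin> im" "root ?t \<notin> im" using root_in st by auto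
  note gd = GrpD[OF g st(1)] GrpD[OF g st(2)] GrpD[OF g r(1)] GrpD[OF g r(2)]
    bridge_Esp[OF \<nu> x st(1)] bridge_Esp[OF \<nu> x st(2)] EspD[OF x h(1)] vdim_root[OF \<nu> st(1)] vdim_root[OF \<nu> st(2)]
  have "minv (g ?t * (?b ?t * minv (g (root ?t)))) = minv (?b ?t * minv (g (root ?t))) * minv (g ?t)"
    by (rule invertible_mult(2)) (use gd in \<open>auto simp: minv_props intro!: invertible_mult(1)\<close>)
  also have "minv (?b ?t * minv (g (root ?t))) = minv (minv (g (root ?t))) * minv (?b ?t)"
    by (rule invertible_mult(2)) (use gd in \<open>auto simp: minv_props\<close>)
  finally have m: "minv (g ?t * (?b ?t * minv (g (root ?t)))) = g (root ?t) * (minv (?b ?t) * minv (g ?t))"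
    using gd by (simp add: minv_minv mat_assoc minv_props)
  show "\<mu> (act \<Gamma> g x) (kept h) = act \<Delta> (forget g) (\<mu> x) (kept h)"
    using gd r h st
    by (simp add: con.act_app[OF in_arrs] kept_ends mu_kept[OF \<nu> ax] mu_kept[OF \<nu> x]
        bridge_act[OF \<nu> x g] m act_app mat_assoc minv_props minv_cancel)
qed

lemma bridge_frob:
  assumes "v \<in> verts \<Gamma>"
  shows "bridge \<nu> (frobE \<Gamma> q x) (vaut \<Gamma> v) = fr (bridge \<nu> x v)"
  using assms arrow_into(1,2)[of v] pmD[of "arrow_into v"]
  by (auto simp: bridge_def vaut_orbit[OF orbits(2)] arrow_into_vaut frobE_haut vdim_vaut fr_one)

lemma mu_frob:
  fixes x :: "('h, 'k) rep"
  assumes \<nu>: "\<nu> ip = \<nu> im" and x: "x \<in> Esp \<Gamma> pm \<nu>"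
  shows "\<mu> (frobE \<Gamma> q x) = frobE \<Delta> q (\<mu> x)"
proof (rule con.rep_eqI_haut[OF mu_ext con.frobE_ext])
  fix k assume "k \<in> arrs \<Delta>"
  then obtain h where h: "k = kept h" "h \<in> arrs \<Gamma>" "h \<notin> pm" by (auto simp: arrs_contract)
  have k: "kept h \<in> arrs \<Delta>" using h by (auto simp: arrs_contract)
  have fx: "frobE \<Gamma> q x \<in> Esp \<Gamma> pm \<nu>" using frobE_Esp[OF Esp_ext[OF x] haut_pm pm_arrs] x by simp
  have hh: "haut \<Gamma> h \<in> arrs \<Gamma>" "haut \<Gamma> h \<notin> pm" using h haut_in_pm arrD by auto
  note st = arrD(1)[OF h(2)] arrD(2)[OF h(2)]
  have "\<mu> (frobE \<Gamma> q x) (kept (haut \<Gamma> h)) = fr (\<mu> x (kept h))"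
    using h st bridge_Esp[OF \<nu> x st(1)] bridge_Esp[OF \<nu> x st(2)] EspD[OF x h(2)]
    by (simp add: mu_kept[OF \<nu> fx hh] mu_kept[OF \<nu> x h(2,3)] arrD bridge_frob frobE_haut fr_mult fr_minv minv_props)
  then show "\<mu> (frobE \<Gamma> q x) (haut \<Delta> k) = frobE \<Delta> q (\<mu> x) (haut \<Delta> k)"
    using con.frobE_haut[OF k, of "\<mu> x"] h by (simp add: kept_haut)
qed

lemma bridge_cong: "(\<And>h. h \<in> pm \<Longrightarrow> x h = x' h) \<Longrightarrow> bridge \<nu> x v = bridge \<nu> x' v"
  using arrow_into(1)[of v] by (auto simp: bridge_def)

text \<open>
  The formula \<open>mu_kept\<close> can be solved for \<open>x h\<close>.
\<close>

lemma mu_inj: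
  fixes x x' :: "('h, 'k) rep"
  assumes \<nu>: "\<nu> ip = \<nu> im" and x: "x \<in> Esp \<Gamma> pm \<nu>" and x': "x' \<in> Esp \<Gamma> pm \<nu>"
    and mu: "\<mu> x = \<mu> x'" and pm: "\<And>h. h \<in> pm \<Longrightarrow> x h = x' h"
  shows "x = x'"
proof (rule extensionalityI[OF Esp_ext[OF x] Esp_ext[OF x']])
  fix h assume h: "h \<in> arrs \<Gamma>"
  show "x h = x' h"
  proof (cases "h \<in> pm")
    case False
    note st = arrD(1)[OF h] arrD(2)[OF h]
    note d = bridge_Esp[OF \<nu> x st(1)] bridge_Esp[OF \<nu> x st(2)] EspD[OF x h]
      bridge_Esp[OF \<nu> x' st(1)] bridge_Esp[OF \<nu> x' st(2)] EspD[OF x' h]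
    have *: "bridge \<nu> u (tgt \<Gamma> h) * (minv (bridge \<nu> u (tgt \<Gamma> h)) * u h * bridge \<nu> u (src \<Gamma> h)) * minv (bridge \<nu> u (src \<Gamma> h)) = u h"
      if "u \<in> Esp \<Gamma> pm \<nu>" for u
      using bridge_Esp[OF \<nu> that st(1)] bridge_Esp[OF \<nu> that st(2)] EspD[OF that h]
      by (simp add: mat_assoc minv_props minv_cancel mat_one_mult)
    have "bridge \<nu> x v = bridge \<nu> x' v" for v by (rule bridge_cong[OF pm])
    then show ?thesis
      using *[OF x] *[OF x'] mu_kept[OF \<nu> x h False] mu_kept[OF \<nu> x' h False] mu by simp
  qed (use pm in simp)
qed

text \<open>
  The representation with prescribed contraction \<open>u\<close> and prescribed matrices \<open>b\<close> on the contracted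
  arrows.
\<close>

definition lift :: "'v dimvec \<Rightarrow> ('h carrow, 'k) rep \<Rightarrow> ('h \<Rightarrow> 'k mat) \<Rightarrow> ('h, 'k) rep" where
  "lift \<nu> u b = (\<lambda>h\<in>arrs \<Gamma>. if h \<in> pm then b h
     else bridge \<nu> b (tgt \<Gamma> h) * u (kept h) * minv (bridge \<nu> b (src \<Gamma> h)))"

lemma lift_pm: "h \<in> pm \<Longrightarrow> lift \<nu> u b h = b h"
  using pm_arrs by (auto simp: lift_def)

lemma lift:
  assumes \<nu>: "\<nu> ip = \<nu> im" and u: "u \<in> Esp \<Delta> {} \<nu>"
    and b: "\<And>h. h \<in> pm \<Longrightarrow> dim_row (b h) = \<nu> im \<and> invertible_mat (b h)"
  shows "lift \<nu> u b \<in> Esp \<Gamma> pm \<nu>" "\<mu> (lift \<nu> u b) = u"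
proof -
  have d: "dim_row (u (kept h)) = vd \<nu> (tgt \<Gamma> h)" "dim_col (u (kept h)) = vd \<nu> (src \<Gamma> h)"
    if h: "h \<in> arrs \<Gamma>" "h \<notin> pm" for h
  proof -
    have "kept h \<in> arrs \<Delta>" using h by (auto simp: arrs_contract)
    then show "dim_row (u (kept h)) = vd \<nu> (tgt \<Gamma> h)" "dim_col (u (kept h)) = vd \<nu> (src \<Gamma> h)"
      using EspD[OF u, of "kept h"] h arrD[OF h(1)] by (simp_all add: kept_ends vdim_root[OF \<nu>])
  qed
  show 1: "lift \<nu> u b \<in> Esp \<Gamma> pm \<nu>"
  proof (rule EspI)
    show "lift \<nu> u b \<in> extensional (arrs \<Gamma>)" by (simp add: lift_def)
    show "invertible_mat (lift \<nu> u b h)" if "h \<in> pm" for h using lift_pm[OF that] b[OF that] by simp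
    show "dim_row (lift \<nu> u b h) = vd \<nu> (tgt \<Gamma> h) \<and> dim_col (lift \<nu> u b h) = vd \<nu> (src \<Gamma> h)"
      if h: "h \<in> arrs \<Gamma>" for h
    proof (cases "h \<in> pm")
      case True
      then show ?thesis using lift_pm b[OF True] vdim_pm[OF \<nu> True] by (simp add: invertible_square)
    next
      case False
      then show ?thesis using h bridge_props[OF \<nu> b] arrD[OF h] by (simp add: lift_def minv_props)
    qed
  qed
  show "\<mu> (lift \<nu> u b) = u"
  proof (rule contract_rep_eqI[OF mu_ext Esp_ext[OF u]])
    fix h assume h: "h \<in> arrs \<Gamma>" "h \<notin> pm"
    have br: "bridge \<nu> (lift \<nu> u b) v = bridge \<nu> b v" for v by (rule bridge_cong) (rule lift_pm)
    show "\<mu> (lift \<nu> u b) (kept h) = u (kept h)"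
      using h d[OF h] bridge_props[OF \<nu> b] arrD[OF h(1)]
      by (simp add: mu_kept[OF \<nu> 1] br) (simp add: lift_def mat_assoc minv_props minv_cancel mat_one_mult)
  qed
qed

end

section \<open>Sums over fibred quotients\<close>

text \<open>
  If the pair \<open>(f, l)\<close> is onto and separates exactly the classes, then the quotient is a product. The
  bijection sends the class of \<open>z\<close> to the class of \<open>f z\<close> and \<open>l z\<close>.
\<close>

lemma quotient_fibration:
  fixes f :: "'a \<Rightarrow> 'b" and l :: "'a \<Rightarrow> 'c"
  assumes R: "equiv A R" "Y \<subseteq> A" and R': "equiv A' R'" "Y' \<subseteq> A'"
    and maps: "\<And>z. z \<in> Y \<Longrightarrow> f z \<in> Y'" "\<And>z. z \<in> Y \<Longrightarrow> l z \<in> L"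
    and iff: "\<And>z z'. z \<in> Y \<Longrightarrow> z' \<in> Y \<Longrightarrow> (z, z') \<in> R \<longleftrightarrow> (f z, f z') \<in> R' \<and> l z = l z'"
    and surj: "\<And>y c. y \<in> Y' \<Longrightarrow> c \<in> L \<Longrightarrow> \<exists>z\<in>Y. f z = y \<and> l z = c"
  shows "\<exists>h. bij_betw h (Y // R) ((Y' // R') \<times> L) \<and> (\<forall>z\<in>Y. h (R `` {z}) = (R' `` {f z}, l z))"
proof -
  define r where "r C = (SOME z. z \<in> Y \<and> R `` {z} = C)" for C
  define h where "h C = (R' `` {f (r C)}, l (r C))" for C
  have R_eq: "R `` {z} = R `` {z'} \<longleftrightarrow> (z, z') \<in> R" if "z \<in> Y" "z' \<in> Y" for z z'
    using that R by (intro eq_equiv_class_iff[OF R(1)]) auto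
  have R'_eq: "R' `` {y} = R' `` {y'} \<longleftrightarrow> (y, y') \<in> R'" if "y \<in> Y'" "y' \<in> Y'" for y y'
    using that R' by (intro eq_equiv_class_iff[OF R'(1)]) auto
  have hz: "h (R `` {z}) = (R' `` {f z}, l z)" if z: "z \<in> Y" for z
  proof -
    have "r (R `` {z}) \<in> Y \<and> R `` {r (R `` {z})} = R `` {z}"
      unfolding r_def by (rule someI[of _ z]) (use z in simp)
    then have "r (R `` {z}) \<in> Y" "(r (R `` {z}), z) \<in> R" using R_eq z by auto
    then show ?thesis using iff[of "r (R `` {z})" z] z R'_eq maps(1) by (simp add: h_def)
  qed
  have "bij_betw h (Y // R) ((Y' // R') \<times> L)"
  proof (rule bij_betwI')
    fix C D assume "C \<in> Y // R" "D \<in> Y // R"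
    then obtain z w where "z \<in> Y" "C = R `` {z}" "w \<in> Y" "D = R `` {w}" by (auto elim!: quotientE)
    then show "(h C = h D) = (C = D)" using hz R_eq R'_eq iff maps(1) by auto
  next
    fix C assume "C \<in> Y // R"
    then obtain z where "z \<in> Y" "C = R `` {z}" by (auto elim!: quotientE)
    then show "h C \<in> (Y' // R') \<times> L" using hz maps by (auto intro: quotientI)
  next
    fix E assume "E \<in> (Y' // R') \<times> L"
    then obtain y c where y: "y \<in> Y'" "c \<in> L" "E = (R' `` {y}, c)" by (auto elim!: quotientE)
    then obtain z where "z \<in> Y" "f z = y" "l z = c" using surj by blast
    then show "\<exists>C\<in>Y // R. E = h C" using hz y by (intro bexI[of _ "R `` {z}"]) (auto intro: quotientI)
  qed
  then show ?thesis using hz by blast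
qed

text \<open>
  The sums have the shape of those in \<open>Ind_eq\<close>: the outer one over coarse classes (\<open>False\<close>), the
  inner one over the fine classes (\<open>True\<close>) inside. Coarse classes correspond one to one, and above
  each fine class on the right there are \<open>card L\<close> fine classes on the left.
\<close>

lemma fibred_quotient_sum:
  fixes \<Phi> :: "'a set \<Rightarrow> complex" and \<Phi>' :: "'b set \<Rightarrow> complex" and l :: "'a \<Rightarrow> 'c"
  assumes eq: "\<And>b. equiv A (R b)" "\<And>b. Y b \<subseteq> A" "Y True \<subseteq> Y False"
    and eq': "\<And>b. equiv A' (R' b)" "\<And>b. Y' b \<subseteq> A'" "Y' True \<subseteq> Y' False"
    and RR: "\<And>z. z \<in> Y True \<Longrightarrow> R False `` (R True `` {z}) = R False `` {z}"
    and RR': "\<And>z. z \<in> Y' True \<Longrightarrow> R' False `` (R' True `` {z}) = R' False `` {z}"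
    and maps: "\<And>b z. z \<in> Y b \<Longrightarrow> f z \<in> Y' b" "\<And>z. z \<in> Y True \<Longrightarrow> l z \<in> L"
    and iff: "\<And>z z'. z \<in> Y False \<Longrightarrow> z' \<in> Y False \<Longrightarrow> (z, z') \<in> R False \<longleftrightarrow> (f z, f z') \<in> R' False"
      "\<And>z z'. z \<in> Y True \<Longrightarrow> z' \<in> Y True \<Longrightarrow> (z, z') \<in> R True \<longleftrightarrow> (f z, f z') \<in> R' True \<and> l z = l z'"
    and surj: "\<And>y. y \<in> Y' False \<Longrightarrow> \<exists>z\<in>Y False. f z = y"
      "\<And>y c. y \<in> Y' True \<Longrightarrow> c \<in> L \<Longrightarrow> \<exists>z\<in>Y True. f z = y \<and> l z = c"
    and \<Phi>: "\<And>z. z \<in> Y True \<Longrightarrow> \<Phi> (R True `` {z}) = \<Phi>' (R' True `` {f z})"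
  shows "(\<Sum>D\<in>Y False // R False. \<Sum>C\<in>{C \<in> Y True // R True. R False `` C = D}. \<Phi> C) =
    of_nat (card L) * (\<Sum>D\<in>Y' False // R' False. \<Sum>C\<in>{C \<in> Y' True // R' True. R' False `` C = D}. \<Phi>' C)"
proof -
  obtain h where h: "bij_betw h (Y False // R False) ((Y' False // R' False) \<times> {()})"
    "\<And>z. z \<in> Y False \<Longrightarrow> h (R False `` {z}) = (R' False `` {f z}, ())"
    using quotient_fibration[OF eq(1)[of False] eq(2)[of False] eq'(1)[of False] eq'(2)[of False],
        where f=f and l="\<lambda>_. ()" and L="{()}"] maps(1) iff(1) surj(1) by auto
  have "bij_betw fst ((Y' False // R' False) \<times> {()}) (Y' False // R' False)"
    by (auto simp: bij_betw_def inj_on_def)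
  then have hQ: "bij_betw (fst \<circ> h) (Y False // R False) (Y' False // R' False)"
    using h(1) bij_betw_trans by blast
  obtain k where k: "bij_betw k (Y True // R True) ((Y' True // R' True) \<times> L)"
    "\<And>z. z \<in> Y True \<Longrightarrow> k (R True `` {z}) = (R' True `` {f z}, l z)"
    using quotient_fibration[OF eq(1)[of True] eq(2)[of True] eq'(1)[of True] eq'(2)[of True],
        where f=f and l=l and L=L] maps iff(2) surj(2) by auto
  have inner: "(\<Sum>C\<in>{C \<in> Y True // R True. R False `` C = D}. \<Phi> C) =
      of_nat (card L) * (\<Sum>C\<in>{C \<in> Y' True // R' True. R' False `` C = (fst \<circ> h) D}. \<Phi>' C)"
    if D: "D \<in> Y False // R False" for D
  proof -
    obtain z0 where z0: "z0 \<in> Y False" "D = R False `` {z0}" using D by (auto elim!: quotientE)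
    let ?S = "{C \<in> Y True // R True. R False `` C = D}"
    let ?S' = "{C \<in> Y' True // R' True. R' False `` C = (fst \<circ> h) D}"
    have fib: "R False `` C = D \<longleftrightarrow> R' False `` fst (k C) = (fst \<circ> h) D" if C: "C \<in> Y True // R True" for C
    proof -
      obtain z where z: "z \<in> Y True" "C = R True `` {z}" using C by (auto elim!: quotientE)
      have zF: "z \<in> Y False" using z eq(3) by auto
      have "R False `` C = D \<longleftrightarrow> (z, z0) \<in> R False"
        using RR[OF z(1)] z z0 eq_equiv_class_iff[OF eq(1), of z z0 False] zF eq(2)[of False] by auto
      also have "\<dots> \<longleftrightarrow> (f z, f z0) \<in> R' False" using iff(1) zF z0 by auto
      also have "\<dots> \<longleftrightarrow> R' False `` {f z} = R' False `` {f z0}"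
        using eq_equiv_class_iff[OF eq'(1), of "f z" "f z0" False] maps(1)[OF zF] maps(1)[OF z0(1)] eq'(2)[of False] by auto
      finally show ?thesis using z z0 h(2) k(2) RR'[OF maps(1)[OF z(1)]] by simp
    qed
    have "bij_betw k ?S (?S' \<times> L)"
      unfolding bij_betw_def
    proof
      show "inj_on k ?S" using k(1) by (auto simp: bij_betw_def intro: inj_on_subset)
      show "k ` ?S = ?S' \<times> L"
      proof (intro equalityI subsetI)
        fix u assume "u \<in> k ` ?S"
        then obtain C where C: "C \<in> Y True // R True" "R False `` C = D" "u = k C" by auto
        then have "k C \<in> (Y' True // R' True) \<times> L" using k(1) by (auto simp: bij_betw_def)
        then show "u \<in> ?S' \<times> L" using fib[OF C(1)] C(2,3) by (simp add: mem_Times_iff)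
      next
        fix u assume u: "u \<in> ?S' \<times> L"
        then have "u \<in> (Y' True // R' True) \<times> L" by auto
        then obtain C where C: "C \<in> Y True // R True" "u = k C" using k(1) by (auto simp: bij_betw_def)
        have "R' False `` fst u = (fst \<circ> h) D" using u by (auto simp: mem_Times_iff)
        then have "R False `` C = D" unfolding C(2) fib[OF C(1)] .
        then show "u \<in> k ` ?S" using C by (intro image_eqI[of _ _ C]) simp_all
      qed
    qed
    moreover have "\<Phi> C = (case k C of (C', c) \<Rightarrow> \<Phi>' C')" if "C \<in> ?S" for C
      using that \<Phi> k(2) by (auto elim!: quotientE)
    ultimately have "(\<Sum>C\<in>?S. \<Phi> C) = (\<Sum>(C', c)\<in>?S' \<times> L. \<Phi>' C')"
      by (subst sum.reindex_bij_betw[symmetric]) (auto intro!: sum.cong)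
    also have "\<dots> = of_nat (card L) * (\<Sum>C\<in>?S'. \<Phi>' C)"
      by (simp add: sum.cartesian_product[symmetric] sum_distrib_left)
    finally show ?thesis .
  qed
  have "(\<Sum>D\<in>Y False // R False. \<Sum>C\<in>{C \<in> Y True // R True. R False `` C = D}. \<Phi> C) =
     (\<Sum>D\<in>Y False // R False. of_nat (card L) * (\<Sum>C\<in>{C \<in> Y' True // R' True. R' False `` C = (fst \<circ> h) D}. \<Phi>' C))"
    using inner by (rule sum.cong[OF refl])
  also have "\<dots> = (\<Sum>D\<in>Y' False // R' False. of_nat (card L) * (\<Sum>C\<in>{C \<in> Y' True // R' True. R' False `` C = D}. \<Phi>' C))"
    by (rule sum.reindex_bij_betw[OF hQ])
  finally show ?thesis by (simp add: sum_distrib_left)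
qed

section \<open>Contraction and induction\<close>

text \<open>
  On the arrows in \<open>J\<close> the diagonal blocks are square by the assumptions on dimensions, so
  \<open>low_invertible_iff\<close> applies.
\<close>

lemma xT_xW_Esp:
  fixes x :: "('h, 'k::field) rep"
  assumes "admissible_graph \<Gamma>" "x \<in> SW \<Gamma> {} \<tau> \<omega>" "J \<subseteq> arrs \<Gamma>"
    "\<And>h. h \<in> J \<Longrightarrow> vdim \<Gamma> \<tau> (src \<Gamma> h) = vdim \<Gamma> \<tau> (tgt \<Gamma> h)"
    "\<And>h. h \<in> J \<Longrightarrow> vdim \<Gamma> \<omega> (src \<Gamma> h) = vdim \<Gamma> \<omega> (tgt \<Gamma> h)"
  shows "x \<in> SW \<Gamma> J \<tau> \<omega> \<longleftrightarrow> xT \<Gamma> \<tau> x \<in> Esp \<Gamma> J \<tau> \<and> xW \<Gamma> \<tau> \<omega> x \<in> Esp \<Gamma> J \<omega>"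
proof -
  have x: "x \<in> Esp \<Gamma> {} (dplus \<tau> \<omega>)" using assms(2) by (auto simp: SW_iff)
  have T: "xT \<Gamma> \<tau> x \<in> Esp \<Gamma> {} \<tau>" by (rule EspI) (auto simp: xT_def diag_dims)
  have W: "xW \<Gamma> \<tau> \<omega> x \<in> Esp \<Gamma> {} \<omega>" by (rule EspI) (auto simp: xW_def diag_dims)
  have "invertible_mat (x h) \<longleftrightarrow> invertible_mat (xT \<Gamma> \<tau> x h) \<and> invertible_mat (xW \<Gamma> \<tau> \<omega> x h)" if "h \<in> J" for h
  proof -
    have h: "h \<in> arrs \<Gamma>" using that assms(3) by auto
    have "low (vdim \<Gamma> \<tau> (tgt \<Gamma> h)) (vdim \<Gamma> \<tau> (tgt \<Gamma> h)) (x h)"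
      using SW_low[OF assms(2) h] assms(4)[OF that] by simp
    then show ?thesis
      using low_invertible_iff[of "vdim \<Gamma> \<tau> (tgt \<Gamma> h)" "x h" "vdim \<Gamma> \<omega> (tgt \<Gamma> h)"] EspD[OF x h] h assms(4,5)[OF that]
      by (simp add: xT_def xW_def vdim_dplus)
  qed
  then show ?thesis using T W assms(2) by (auto simp: SW_iff Esp_open_subset[of _ _ J])
qed

context contraction
begin

sublocale heart: hall_space \<Gamma> q K pm
  by unfold_locales (auto simp: haut_pm pm_arrs)

sublocale con: hall_space \<Delta> q K "{}"
  by unfold_locales auto

text \<open>
  The rational points of the general linear group at $i_-$, indexed by the contracted arrows instead
  of their ends.
\<close>

definition levi_points :: "'v dimvec \<Rightarrow> ('h \<Rightarrow> 'k mat) set" where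
  "levi_points \<nu> = {b \<in> fixed_families pm (haut \<Gamma>) (\<lambda>_. \<nu> im) (\<lambda>_. \<nu> im). \<forall>h\<in>pm. invertible_mat (b h)}"

lemma haut_bij_pm: "bij_betw (haut \<Gamma>) pm pm"
  using haut_bij haut_pm pm_arrs by (auto simp: bij_betw_def intro: inj_on_subset)

lemma card_levi_points: "finite (levi_points \<nu>)" "0 < card (levi_points \<nu>)"
proof -
  show "finite (levi_points \<nu>)"
    unfolding levi_points_def using finite_fixed_families[OF finite_pm haut_bij_pm] by auto
  moreover have "(\<lambda>h\<in>pm. 1\<^sub>m (\<nu> im)) \<in> levi_points \<nu>"
    using haut_in_pm pm_arrs by (auto simp: levi_points_def fixed_families_def invertible_one fr_one)
  ultimately show "0 < card (levi_points \<nu>)" by (auto simp: card_gt_0_iff)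
qed

text \<open>
  A rational group element is its restriction to the vertices outside $i_-$ together with its
  components at $i_-$.
\<close>

lemma card_GF:
  assumes \<nu>: "\<nu> ip = \<nu> im"
  shows "card (GF \<Gamma> q \<nu> :: ('v \<Rightarrow> 'k mat) set) = card (GF \<Delta> q \<nu> :: ('v \<Rightarrow> 'k mat) set) * card (levi_points \<nu>)"
proof -
  have "bij_betw (\<lambda>g. (forget g, \<lambda>h\<in>pm. g (tgt \<Gamma> h))) (GF \<Gamma> q \<nu> :: ('v \<Rightarrow> 'k mat) set) (GF \<Delta> q \<nu> \<times> levi_points \<nu>)"
  proof (rule bij_betwI[where g="\<lambda>(g, b). \<lambda>v\<in>verts \<Gamma>. if v \<in> im then b (arrow_into v) else g v"])
    have t: "tgt \<Gamma> h \<in> verts \<Gamma>" "vaut \<Gamma> (tgt \<Gamma> h) = tgt \<Gamma> (haut \<Gamma> h)" "haut \<Gamma> h \<in> pm" if "h \<in> pm" for h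
      using that pmD[OF that] arrD haut_in_pm by auto
    show "(\<lambda>g. (forget g, \<lambda>h\<in>pm. g (tgt \<Gamma> h))) \<in> GF \<Gamma> q \<nu> \<rightarrow> GF \<Delta> q \<nu> \<times> levi_points \<nu>"
    proof (rule Pi_I)
      fix g :: "'v \<Rightarrow> 'k mat" assume "g \<in> GF \<Gamma> q \<nu>"
      then have g: "g \<in> extensional (verts \<Gamma>)" "\<And>v. v \<in> verts \<Gamma> \<Longrightarrow> g v \<in> carrier_mat (vd \<nu> v) (vd \<nu> v)"
        "\<And>v. v \<in> verts \<Gamma> \<Longrightarrow> g (vaut \<Gamma> v) = fr (g v)" "\<And>v. v \<in> verts \<Gamma> \<Longrightarrow> invertible_mat (g v)"
        by (auto simp: GF_fixed_families fixed_families_def PiE_iff)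
      have "forget g \<in> GF \<Delta> q \<nu>"
        unfolding con.GF_fixed_families fixed_families_def using g con.vaut_in by auto
      moreover have "(\<lambda>h\<in>pm. g (tgt \<Gamma> h)) \<in> levi_points \<nu>"
        unfolding levi_points_def fixed_families_def using g t vdim_pm[OF \<nu>] by (auto simp: t(2)[symmetric]) (metis carrier_matD)+
      ultimately show "(forget g, \<lambda>h\<in>pm. g (tgt \<Gamma> h)) \<in> GF \<Delta> q \<nu> \<times> levi_points \<nu>" by simp
    qed
    show "(\<lambda>(g, b). \<lambda>v\<in>verts \<Gamma>. if v \<in> im then b (arrow_into v) else g v) \<in> GF \<Delta> q \<nu> \<times> levi_points \<nu> \<rightarrow> GF \<Gamma> q \<nu>"
    proof (rule Pi_I)
      fix gb :: "('v \<Rightarrow> 'k mat) \<times> ('h \<Rightarrow> 'k mat)" assume "gb \<in> GF \<Delta> q \<nu> \<times> levi_points \<nu>"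
      then obtain g b where gb: "gb = (g, b)" "g \<in> GF \<Delta> q \<nu>" "b \<in> levi_points \<nu>" by auto
      have g: "\<And>v. v \<in> verts \<Gamma> \<Longrightarrow> v \<notin> im \<Longrightarrow> g v \<in> carrier_mat (vd \<nu> v) (vd \<nu> v)"
        "\<And>v. v \<in> verts \<Gamma> \<Longrightarrow> v \<notin> im \<Longrightarrow> g (vaut \<Gamma> v) = fr (g v)" "\<And>v. v \<in> verts \<Gamma> \<Longrightarrow> v \<notin> im \<Longrightarrow> invertible_mat (g v)"
        using gb(2) by (auto simp: con.GF_fixed_families fixed_families_def PiE_iff)
      have b: "\<And>h. h \<in> pm \<Longrightarrow> b h \<in> carrier_mat (\<nu> im) (\<nu> im)" "\<And>h. h \<in> pm \<Longrightarrow> b (haut \<Gamma> h) = fr (b h)"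
        "\<And>h. h \<in> pm \<Longrightarrow> invertible_mat (b h)"
        using gb(3) by (auto simp: levi_points_def fixed_families_def PiE_iff)
      have "(\<lambda>v\<in>verts \<Gamma>. if v \<in> im then b (arrow_into v) else g v) \<in> GF \<Gamma> q \<nu>"
        unfolding GF_fixed_families fixed_families_def
        using g b arrow_into(1) vdim_into(2)[OF \<nu>] vaut_orbit[OF orbits(2)] vaut_in arrow_into_vaut by (auto simp: PiE_iff)
      then show "(case gb of (g, b) \<Rightarrow> \<lambda>v\<in>verts \<Gamma>. if v \<in> im then b (arrow_into v) else g v) \<in> GF \<Gamma> q \<nu>"
        using gb(1) by simp
    qed
    show "(case (forget g, \<lambda>h\<in>pm. g (tgt \<Gamma> h)) of (g, b) \<Rightarrow> \<lambda>v\<in>verts \<Gamma>. if v \<in> im then b (arrow_into v) else g v) = g"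
      if "g \<in> GF \<Gamma> q \<nu>" for g :: "'v \<Rightarrow> 'k mat"
    proof -
      have "g \<in> extensional (verts \<Gamma>)" using that by (auto simp: GF_def Grp_def PiE_iff)
      then show ?thesis using arrow_into by (auto intro!: extensionalityI[of _ "verts \<Gamma>"])
    qed
    show "(\<lambda>g. (forget g, \<lambda>h\<in>pm. g (tgt \<Gamma> h))) (case gb of (g, b) \<Rightarrow> \<lambda>v\<in>verts \<Gamma>. if v \<in> im then b (arrow_into v) else g v) = gb"
      if gb: "gb \<in> GF \<Delta> q \<nu> \<times> levi_points \<nu>" for gb :: "('v \<Rightarrow> 'k mat) \<times> ('h \<Rightarrow> 'k mat)"
    proof -
      obtain g b where gb': "gb = (g, b)" "g \<in> extensional (verts \<Gamma> - im)" "b \<in> extensional pm"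
        using gb by (auto simp: GF_def Grp_def PiE_iff levi_points_def fixed_families_def)
      have "forget (\<lambda>v\<in>verts \<Gamma>. if v \<in> im then b (arrow_into v) else g v) = g"
        by (rule extensionalityI[OF _ gb'(2)]) auto
      moreover have "(\<lambda>h\<in>pm. (\<lambda>v\<in>verts \<Gamma>. if v \<in> im then b (arrow_into v) else g v) (tgt \<Gamma> h)) = b"
        by (rule extensionalityI[OF _ gb'(3)]) (use t pmD arrow_into in auto)
      ultimately show ?thesis using gb'(1) by simp
    qed
  qed
  then show ?thesis using bij_betw_same_card by (fastforce simp: card_cartesian_product)
qed

lemma mu_EF:
  fixes x :: "('h, 'k) rep"
  assumes "\<nu> ip = \<nu> im" "x \<in> EF \<Gamma> pm q \<nu>"
  shows "\<mu> x \<in> EF \<Delta> {} q \<nu>"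
  using assms mu_Esp[OF assms(1)] by (auto simp: EF_def mu_frob[OF assms(1), symmetric])

end

locale contraction_pair = contraction \<Gamma> q K ip im
  for \<Gamma> :: "('v, 'h) agraph" and q :: nat and K :: "'k::field itself" and ip im +
  fixes \<tau> \<omega> :: "'v dimvec"
  assumes \<tau>: "\<tau> ip = \<tau> im" and \<omega>: "\<omega> ip = \<omega> im"
begin

lemma \<tau>\<omega>: "dplus \<tau> \<omega> ip = dplus \<tau> \<omega> im"
  by (simp add: dplus_def \<tau> \<omega>)

lemma xT_xW_heart:
  fixes x :: "('h, 'k) rep"
  assumes "x \<in> SW \<Gamma> {} \<tau> \<omega>"
  shows "x \<in> SW \<Gamma> pm \<tau> \<omega> \<longleftrightarrow> xT \<Gamma> \<tau> x \<in> Esp \<Gamma> pm \<tau> \<and> xW \<Gamma> \<tau> \<omega> x \<in> Esp \<Gamma> pm \<omega>"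
  by (rule xT_xW_Esp[OF admissible_graph_axioms assms pm_arrs]) (simp_all add: vdim_pm \<tau> \<omega>)

lemma SW_heart: "x \<in> SW \<Gamma> pm \<tau> \<omega> \<Longrightarrow> x \<in> SW \<Gamma> {} \<tau> \<omega> \<and> x \<in> Esp \<Gamma> pm (dplus \<tau> \<omega>)"
  by (auto simp: SW_iff Esp_open_subset[of _ _ pm])

text \<open>
  The identifications respect the decomposition of the spaces, since the dimensions of the summands
  at \<open>root v\<close> and \<open>v\<close> agree.
\<close>

lemma bridge_diag:
  fixes x :: "('h, 'k) rep"
  assumes low: "\<And>h. h \<in> pm \<Longrightarrow> low (vd \<tau> (tgt \<Gamma> h)) (vd \<tau> (src \<Gamma> h)) (x h)" and v: "v \<in> verts \<Gamma>"
  shows "low (vd \<tau> v) (vd \<tau> v) (bridge (dplus \<tau> \<omega>) x v)"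
    "diagT (vd \<tau> v) (vd \<tau> v) (bridge (dplus \<tau> \<omega>) x v) = bridge \<tau> (xT \<Gamma> \<tau> x) v"
    "diagW (vd \<tau> v) (vd \<omega> v) (vd \<tau> v) (vd \<omega> v) (bridge (dplus \<tau> \<omega>) x v) = bridge \<omega> (xW \<Gamma> \<tau> \<omega> x) v"
proof -
  have "low (vd \<tau> v) (vd \<tau> v) (x (arrow_into v))" if "v \<in> im"
    using low[OF arrow_into(1)[OF that]] arrow_into(2)[OF that] vdim_into(1)[where \<nu>=\<tau>, OF \<tau> that] by simp
  then show "low (vd \<tau> v) (vd \<tau> v) (bridge (dplus \<tau> \<omega>) x v)"
    by (auto simp: bridge_def low_one)
  show "diagT (vd \<tau> v) (vd \<tau> v) (bridge (dplus \<tau> \<omega>) x v) = bridge \<tau> (xT \<Gamma> \<tau> x) v"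
    using arrow_into(1,2)[of v] pmD[of "arrow_into v"] vdim_into(1)[where \<nu>=\<tau>, OF \<tau>, of v]
    by (auto simp: bridge_def xT_def diag_one vdim_dplus)
  show "diagW (vd \<tau> v) (vd \<omega> v) (vd \<tau> v) (vd \<omega> v) (bridge (dplus \<tau> \<omega>) x v) = bridge \<omega> (xW \<Gamma> \<tau> \<omega> x) v"
    using arrow_into(1,2)[of v] pmD[of "arrow_into v"] vdim_into(1)[where \<nu>=\<tau>, OF \<tau>, of v] vdim_into(1)[where \<nu>=\<omega>, OF \<omega>, of v]
    by (auto simp: bridge_def xW_def diag_one vdim_dplus)
qed

text \<open>
  Conjugation by block triangular identifications preserves block triangular shape.
\<close>

lemma mu_SW:
  fixes x :: "('h, 'k) rep"
  assumes x: "x \<in> Esp \<Gamma> pm (dplus \<tau> \<omega>)"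
    and low: "\<And>h. h \<in> pm \<Longrightarrow> low (vd \<tau> (tgt \<Gamma> h)) (vd \<tau> (src \<Gamma> h)) (x h)"
  shows "x \<in> SW \<Gamma> pm \<tau> \<omega> \<longleftrightarrow> \<mu> x \<in> SW \<Delta> {} \<tau> \<omega>"
proof -
  have "low (vd \<tau> (tgt \<Gamma> h)) (vd \<tau> (src \<Gamma> h)) (x h) \<longleftrightarrow>
      low (vd \<tau> (tgt \<Delta> (kept h))) (vd \<tau> (src \<Delta> (kept h))) (\<mu> x (kept h))"
    if h: "h \<in> arrs \<Gamma>" "h \<notin> pm" for h
  proof -
    let ?s = "src \<Gamma> h" and ?t = "tgt \<Gamma> h" and ?b = "bridge (dplus \<tau> \<omega>) x"
    note st = arrD(1)[OF h(1)] arrD(2)[OF h(1)]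
    note d = bridge_Esp[OF \<tau>\<omega> x st(1)] bridge_Esp[OF \<tau>\<omega> x st(2)] EspD[OF x h(1)]
    note l = bridge_diag(1)[OF low st(1)] bridge_diag(1)[OF low st(2)]
    have li: "low (vd \<tau> ?s) (vd \<tau> ?s) (minv (?b ?s))" "low (vd \<tau> ?t) (vd \<tau> ?t) (minv (?b ?t))"
      using low_minv[OF d(3) l(1)] low_minv[OF d(6) l(2)] d by (auto simp: vdim_dplus)
    have e: "\<mu> x (kept h) = minv (?b ?t) * x h * ?b ?s" by (rule mu_kept[OF \<tau>\<omega> x h])
    have "low (vd \<tau> ?t) (vd \<tau> ?s) (minv (?b ?t) * x h * ?b ?s)" if "low (vd \<tau> ?t) (vd \<tau> ?s) (x h)"
      by (rule low_mult[OF low_mult[OF li(2) that] l(1)]) (use d in \<open>simp_all add: minv_props vdim_dplus\<close>)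
    moreover have "low (vd \<tau> ?t) (vd \<tau> ?s) (?b ?t * (minv (?b ?t) * x h * ?b ?s) * minv (?b ?s))"
      if "low (vd \<tau> ?t) (vd \<tau> ?s) (minv (?b ?t) * x h * ?b ?s)"
      by (rule low_mult[OF low_mult[OF l(2) that] li(1)]) (use d in \<open>simp_all add: minv_props vdim_dplus\<close>)
    moreover have "?b ?t * (minv (?b ?t) * x h * ?b ?s) * minv (?b ?s) = x h"
      using d by (simp add: mat_assoc minv_props minv_cancel mat_one_mult)
    ultimately show ?thesis
      using e st by (auto simp: kept_ends[OF h] vdim_root[where \<nu>=\<tau>, OF \<tau>])
  qed
  then show ?thesis
    unfolding SW_iff using x mu_Esp[OF \<tau>\<omega> x] low by (auto simp: arrs_contract)
qed

lemma mu_SW_imp: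
  fixes x :: "('h, 'k) rep"
  assumes "x \<in> SW \<Gamma> pm \<tau> \<omega>"
  shows "\<mu> x \<in> SW \<Delta> {} \<tau> \<omega>"
  using mu_SW[of x] assms SW_low[OF assms] pm_arrs by (auto simp: SW_iff)

lemma mu_xT_xW:
  fixes x :: "('h, 'k) rep"
  assumes x: "x \<in> SW \<Gamma> pm \<tau> \<omega>"
  shows "\<mu> (xT \<Gamma> \<tau> x) = xT \<Delta> \<tau> (\<mu> x)"
    "\<mu> (xW \<Gamma> \<tau> \<omega> x) = xW \<Delta> \<tau> \<omega> (\<mu> x)"
proof -
  have TW: "xT \<Gamma> \<tau> x \<in> Esp \<Gamma> pm \<tau>" "xW \<Gamma> \<tau> \<omega> x \<in> Esp \<Gamma> pm \<omega>"
    using xT_xW_heart SW_heart[OF x] x by auto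
  have xE: "x \<in> Esp \<Gamma> pm (dplus \<tau> \<omega>)" using SW_heart[OF x] by simp
  have "\<mu> (xT \<Gamma> \<tau> x) (kept h) = xT \<Delta> \<tau> (\<mu> x) (kept h) \<and>
      \<mu> (xW \<Gamma> \<tau> \<omega> x) (kept h) = xW \<Delta> \<tau> \<omega> (\<mu> x) (kept h)"
    if h: "h \<in> arrs \<Gamma>" "h \<notin> pm" for h
  proof -
    let ?s = "src \<Gamma> h" and ?t = "tgt \<Gamma> h" and ?b = "bridge (dplus \<tau> \<omega>) x"
    let ?ts = "vd \<tau> ?s" and ?tt = "vd \<tau> ?t" and ?ws = "vd \<omega> ?s" and ?wt = "vd \<omega> ?t"
    have in_arrs: "kept h \<in> arrs \<Delta>" using h by (auto simp: arrs_contract)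
    note st = arrD(1)[OF h(1)] arrD(2)[OF h(1)]
    note d = bridge_Esp[OF \<tau>\<omega> xE st(1)] bridge_Esp[OF \<tau>\<omega> xE st(2)] EspD[OF xE h(1)]
    have low: "low (vd \<tau> (tgt \<Gamma> h)) (vd \<tau> (src \<Gamma> h)) (x h)" if "h \<in> pm" for h
      using SW_low[OF x] that pm_arrs by auto
    note s = bridge_diag[OF low st(1)] and t = bridge_diag[OF low st(2)]
    have tr: "dim_row (?b ?t) = ?tt + ?wt" using d by (simp add: vdim_dplus)
    note ti = low_minv[OF d(6) t(1) tr] diag_minv[OF d(6) t(1) tr]
    note l = SW_low[OF x h(1)]
    have l2: "low ?tt ?ts (x h * ?b ?s)"
      by (rule low_mult[OF l s(1)]) (use d in \<open>simp_all add: vdim_dplus\<close>)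
    have T: "diagT ?tt ?ts (minv (?b ?t) * (x h * ?b ?s)) = diagT ?tt ?tt (minv (?b ?t)) * (diagT ?tt ?ts (x h) * diagT ?ts ?ts (?b ?s))"
      using d by (simp add: diagT_mult[OF ti(1), where w'="?wt"] diagT_mult[OF l, where w'="?ws"] vdim_dplus minv_props)
    have W: "diagW ?tt ?wt ?ts ?ws (minv (?b ?t) * (x h * ?b ?s)) =
        diagW ?tt ?wt ?tt ?wt (minv (?b ?t)) * (diagW ?tt ?wt ?ts ?ws (x h) * diagW ?ts ?ws ?ts ?ws (?b ?s))"
      using d by (simp add: diagW_mult[OF l2, where w'="?wt"] diagW_mult[OF s(1), where w'="?ws"] vdim_dplus minv_props)
    have e: "\<mu> x (kept h) = minv (?b ?t) * (x h * ?b ?s)"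
      using mu_kept[OF \<tau>\<omega> xE h] d by (simp add: mat_assoc minv_props)
    have dT: "dim_row (bridge \<tau> (xT \<Gamma> \<tau> x) ?s) = ?ts" "dim_col (minv (bridge \<tau> (xT \<Gamma> \<tau> x) ?t)) = ?tt"
      "dim_row (bridge \<omega> (xW \<Gamma> \<tau> \<omega> x) ?s) = ?ws" "dim_col (minv (bridge \<omega> (xW \<Gamma> \<tau> \<omega> x) ?t)) = ?wt"
      using bridge_Esp[OF \<tau> TW(1) st(1)] bridge_Esp[OF \<tau> TW(1) st(2)] bridge_Esp[OF \<omega> TW(2) st(1)] bridge_Esp[OF \<omega> TW(2) st(2)]
      by (simp_all add: minv_props)
    have xTW: "xT \<Gamma> \<tau> x h = diagT ?tt ?ts (x h)" "xW \<Gamma> \<tau> \<omega> x h = diagW ?tt ?wt ?ts ?ws (x h)"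
      using h(1) by (simp_all add: xT_def xW_def)
    show ?thesis
      using in_arrs dT st
      by (simp add: mu_kept[OF \<tau> TW(1) h] mu_kept[OF \<omega> TW(2) h] xT_def[of \<Delta>] xW_def[of \<Delta>] kept_ends[OF h]
          vdim_root[where \<nu>=\<tau>, OF \<tau>] vdim_root[where \<nu>=\<omega>, OF \<omega>] e T W ti s t mat_assoc diag_dims xTW)
  qed
  then show "\<mu> (xT \<Gamma> \<tau> x) = xT \<Delta> \<tau> (\<mu> x)"
    "\<mu> (xW \<Gamma> \<tau> \<omega> x) = xW \<Delta> \<tau> \<omega> (\<mu> x)"
    by (auto intro!: contract_rep_eqI[OF mu_ext] simp: xT_def[of \<Delta>] xW_def[of \<Delta>])
qed

abbreviation "eqv \<equiv> coset_rel \<Gamma> pm \<tau> \<omega> :: bool \<Rightarrow> ('h, 'k) rep \<Rightarrow> _"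
abbreviation "eqv\<^sub>\<Delta> \<equiv> coset_rel \<Delta> {} \<tau> \<omega> :: bool \<Rightarrow> ('h carrow, 'k) rep \<Rightarrow> _"
abbreviation "rat \<equiv> rational \<Gamma> pm q \<tau> \<omega> :: bool \<Rightarrow> ('h, 'k) rep \<Rightarrow> _"
abbreviation "rat\<^sub>\<Delta> \<equiv> rational \<Delta> {} q \<tau> \<omega> :: bool \<Rightarrow> ('h carrow, 'k) rep \<Rightarrow> _"
abbreviation "reps \<equiv> reps_over \<Gamma> pm \<tau> \<omega> :: ('h, 'k) rep \<Rightarrow> _"
abbreviation "reps\<^sub>\<Delta> \<equiv> reps_over \<Delta> {} \<tau> \<omega> :: ('h carrow, 'k) rep \<Rightarrow> _"

text \<open>
  The components of \<open>g\<close> at $i_-$ are lost here; \<open>diag_pm\<close> records what is left of them modulo $U$.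
\<close>

definition proj :: "('v \<Rightarrow> 'k mat) \<times> ('h, 'k) rep \<Rightarrow> ('v \<Rightarrow> 'k mat) \<times> ('h carrow, 'k) rep" where
  "proj = (\<lambda>(g, x). (forget g, \<mu> x))"

definition diag_pm :: "('v \<Rightarrow> 'k mat) \<times> ('h, 'k) rep \<Rightarrow> ('h \<Rightarrow> 'k mat) \<times> ('h \<Rightarrow> 'k mat)" where
  "diag_pm = (\<lambda>(g, x). (restrict (xT \<Gamma> \<tau> x) pm, restrict (xW \<Gamma> \<tau> \<omega> x) pm))"

lemma proj_over:
  assumes z: "z \<in> reps y"
  shows "proj z \<in> reps\<^sub>\<Delta> (\<mu> y)"
proof -
  obtain g x where [simp]: "z = (g, x)" by (cases z)
  note o = reps_overD[OF z[simplified]]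
  show ?thesis
    using forget_Grp[OF o(1)] mu_SW_imp[OF o(2)] mu_act[OF \<tau>\<omega> o(5,1)] o(3)
    by (simp add: proj_def reps_over_def)
qed

text \<open>
  Let \<open>h\<close> be the contracted arrow from \<open>s\<close> to \<open>v\<close> in $i_-$. By \<open>over_intertwine\<close>,
  $g_v'^{-1}g_v=x_h'\,(g_s'^{-1}g_s)\,x_h^{-1}$. If $g_s'^{-1}g_s$ is block triangular, then so is the left
  side, and if its diagonal blocks are moreover identities, then those of the left side are identities
  exactly when $x_h$ and $x_h'$ have the same diagonal blocks.
\<close>

lemma coset_rel_proj:
  assumes z: "z \<in> reps y" and z': "z' \<in> reps y"
  shows "(z, z') \<in> eqv b y \<longleftrightarrow>
    (proj z, proj z') \<in> eqv\<^sub>\<Delta> b (\<mu> y) \<and> (b \<longrightarrow> diag_pm z = diag_pm z')"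
proof -
  obtain g x g' x' where [simp]: "z = (g, x)" "z' = (g', x')" by (cases z; cases z')
  note o = reps_overD[OF z[simplified]] and o' = reps_overD[OF z'[simplified]]
  let ?par = "\<lambda>v. parab b (vd \<tau> v) (vd \<omega> v) (minv (g' v) * g v)"
  have L: "(z, z') \<in> eqv b y \<longleftrightarrow> (\<forall>v\<in>verts \<Gamma>. ?par v)"
    using z z' by (simp add: coset_rel_def)
  have R: "(proj z, proj z') \<in> eqv\<^sub>\<Delta> b (\<mu> y) \<longleftrightarrow> (\<forall>v\<in>verts \<Gamma> - im. ?par v)"
    using proj_over[OF z] proj_over[OF z'] by (simp add: coset_rel_def proj_def)
  have im: "?par v" if v: "v \<in> im" and p: "\<forall>v\<in>verts \<Gamma> - im. ?par v" and d: "b \<longrightarrow> diag_pm z = diag_pm z'" for v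
  proof -
    define h where "h = arrow_into v"
    have h: "h \<in> pm" "tgt \<Gamma> h = v" using arrow_into(1,2)[OF v] by (simp_all add: h_def)
    have ha: "h \<in> arrs \<Gamma>" using h pm_arrs by auto
    have s: "src \<Gamma> h \<in> verts \<Gamma> - im" using arrD(1)[OF ha] pmD[OF h(1)] ip_im by auto
    let ?t = "vd \<tau> v" and ?w = "vd \<omega> v" and ?u = "minv (g' (src \<Gamma> h)) * g (src \<Gamma> h)"
    have st: "vd \<tau> (src \<Gamma> h) = ?t" "vd \<omega> (src \<Gamma> h) = ?w"
      using vdim_pm[where \<nu>=\<tau>, OF \<tau> h(1)] vdim_pm[where \<nu>=\<omega>, OF \<omega> h(1)] h(2) by auto
    note gd = GrpD[OF o(1) arrD(1)[OF ha]] GrpD[OF o(1) arrD(2)[OF ha]]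
      GrpD[OF o'(1) arrD(1)[OF ha]] GrpD[OF o'(1) arrD(2)[OF ha]]
      EspD[OF o(4) ha] EspD[OF o'(4) ha] Esp_invertible[OF o(5) h(1)] Esp_invertible[OF o'(5) h(1)]
    note gd' = gd[unfolded vdim_dplus st h(2)]
    have "minv (g' v) * g v * x h = x' h * ?u"
      using over_intertwine[OF z[simplified] z'[simplified] ha] h(2) by simp
    then have "minv (g' v) * g v * x h * minv (x h) = x' h * ?u * minv (x h)" by simp
    then have e: "minv (g' v) * g v = x' h * (?u * minv (x h))"
      using gd' by (simp add: mat_assoc minv_props mat_one_mult)
    have pu: "parab b ?t ?w ?u" using bspec[OF p s] unfolding st .
    have lx: "low ?t ?t (x h)" "low ?t ?t (x' h)" using SW_low[OF o(2) ha] SW_low[OF o'(2) ha] h(2) st by auto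
    have lu: "low ?t ?t ?u" using pu by (simp add: parab_def)
    have lm: "low ?t ?t (minv (x h))" using low_minv[OF _ lx(1)] gd' by auto
    note dm = diag_minv[OF gd'(17) lx(1) gd'(13)]
    have du: "dim_row ?u = ?t + ?w" "dim_col ?u = ?t + ?w" using gd' by (simp_all add: minv_props)
    have dx: "dim_row (minv (x h)) = ?t + ?w" "dim_col (minv (x h)) = ?t + ?w" using gd' by (simp_all add: minv_props)
    have lum: "low ?t ?t (?u * minv (x h))"
      by (rule low_mult[OF lu lm]) (use du dx in simp_all)
    have "low ?t ?t (x' h * (?u * minv (x h)))"
      by (rule low_mult[OF lx(2) lum]) (use du dx gd' in simp_all)
    moreover have "diagT ?t ?t (x' h * (?u * minv (x h))) = 1\<^sub>m ?t \<and> diagW ?t ?w ?t ?w (x' h * (?u * minv (x h))) = 1\<^sub>m ?w" if b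
    proof -
      have dd: "diagT ?t ?t (x h) = diagT ?t ?t (x' h)" "diagW ?t ?w ?t ?w (x h) = diagW ?t ?w ?t ?w (x' h)"
        using d that h ha st by (auto simp: diag_pm_def xT_def xW_def fun_eq_iff restrict_def) metis+
      have one: "diagT ?t ?t ?u = 1\<^sub>m ?t" "diagW ?t ?w ?t ?w ?u = 1\<^sub>m ?w" using pu that by (auto simp: parab_def)
      have i: "invertible_mat (diagT ?t ?t (x' h))" "invertible_mat (diagW ?t ?w ?t ?w (x' h))"
        using low_invertible_iff[OF lx(2) gd'(15,16)] gd'(18) by auto
      have T: "diagT ?t ?t (x' h * (?u * minv (x h))) = diagT ?t ?t (x' h) * (diagT ?t ?t ?u * diagT ?t ?t (minv (x h)))"
        using du dx gd' by (simp add: diagT_mult[OF lx(2), where w'="?w"] diagT_mult[OF lu, where w'="?w"])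
      have W: "diagW ?t ?w ?t ?w (x' h * (?u * minv (x h))) = diagW ?t ?w ?t ?w (x' h) * (diagW ?t ?w ?t ?w ?u * diagW ?t ?w ?t ?w (minv (x h)))"
        using du dx gd' by (simp add: diagW_mult[OF lum, where w'="?w"] diagW_mult[OF lm, where w'="?w"])
      show ?thesis unfolding T W one dm dd using i by (simp add: mat_one_mult minv_props diag_dims)
    qed
    ultimately show ?thesis using e by (simp add: parab_def)
  qed
  have "diag_pm z = diag_pm z'" if "(z, z') \<in> eqv b y" b
    using coset_rel_xT_xW[of g x g' x' pm \<tau> \<omega> y] that by (simp add: diag_pm_def)
  then show ?thesis using L R im by blast
qed

lemma forget_frob:
  fixes g :: "'v \<Rightarrow> 'k mat"
  shows "forget (frobG \<Gamma> q g) = frobG \<Delta> q (forget g)"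
proof (rule con.grp_eqI_vaut[OF _ con.frobG_ext])
  fix v assume v: "v \<in> verts \<Delta>"
  then show "forget (frobG \<Gamma> q g) (vaut \<Delta> v) = frobG \<Delta> q (forget g) (vaut \<Delta> v)"
    using con.frobG_vaut[OF v, of "forget g"] con.vaut_in[OF v] by (simp add: frobG_vaut)
qed simp

lemma proj_frob:
  assumes "z \<in> reps y"
  shows "proj (heart.frob z) = con.frob (proj z)"
proof -
  obtain g x where [simp]: "z = (g, x)" by (cases z)
  show ?thesis using mu_frob[OF \<tau>\<omega> reps_overD(5)[OF assms[simplified]]] by (simp add: proj_def forget_frob)
qed

lemma rational_proj:
  assumes y: "frobE \<Gamma> q y = y" and z: "z \<in> reps y"
  shows "z \<in> rat b y \<longleftrightarrow>
    proj z \<in> rat\<^sub>\<Delta> b (\<mu> y) \<and> (b \<longrightarrow> diag_pm (heart.frob z) = diag_pm z)"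
  using coset_rel_proj[OF heart.frob_over[OF y z] z] proj_over[OF z] z proj_frob[OF z]
  by (simp add: rational_def)

text \<open>
  The point and its Frobenius image are equivalent modulo $U$, so that they have the same diagonal
  blocks by \<open>coset_rel_xT_xW\<close>.
\<close>

lemma rational_diag:
  fixes x :: "('h, 'k) rep"
  assumes z: "(g, x) \<in> rat True y"
  shows "xT \<Gamma> \<tau> x \<in> EF \<Gamma> pm q \<tau>" "xW \<Gamma> \<tau> \<omega> x \<in> EF \<Gamma> pm q \<omega>"
proof -
  have zo: "(g, x) \<in> reps y" and r: "((frobG \<Gamma> q g, frobE \<Gamma> q x), (g, x)) \<in> eqv True y"
    using z by (auto simp: rational_def)
  note o = reps_overD[OF zo]
  have "xT \<Gamma> \<tau> x \<in> Esp \<Gamma> pm \<tau> \<and> xW \<Gamma> \<tau> \<omega> x \<in> Esp \<Gamma> pm \<omega>"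
    using xT_xW_heart SW_heart o(2) by blast
  then show "xT \<Gamma> \<tau> x \<in> EF \<Gamma> pm q \<tau>" "xW \<Gamma> \<tau> \<omega> x \<in> EF \<Gamma> pm q \<omega>"
    using coset_rel_xT_xW[OF r] frobE_xT[OF o(4)] by (auto simp: EF_def)
qed

lemma EF_levi_points:
  fixes u :: "('h, 'k) rep"
  assumes "\<nu> ip = \<nu> im" "u \<in> EF \<Gamma> pm q \<nu>"
  shows "restrict u pm \<in> levi_points \<nu>"
proof -
  have u: "u \<in> Esp \<Gamma> pm \<nu>" "frobE \<Gamma> q u = u" using assms(2) by (auto simp: EF_def)
  have "u (haut \<Gamma> h) = fr (u h)" if "h \<in> pm" for h
    using frobE_haut[of h u] u(2) that pm_arrs by auto
  then show ?thesis
    using Esp_pmD[OF assms(1) u(1)] haut_in_pm pm_arrs by (auto simp: levi_points_def fixed_families_def)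
qed

lemma rational_diag_pm:
  fixes y :: "('h, 'k) rep"
  shows "z \<in> rat True y \<Longrightarrow> diag_pm z \<in> levi_points \<tau> \<times> levi_points \<omega>"
  using rational_diag EF_levi_points[OF \<tau>] EF_levi_points[OF \<omega>] by (cases z) (auto simp: diag_pm_def)

text \<open>
  Given the group element \<open>g\<close> over the contracted graph and the matrices \<open>c h\<close> that \<open>x\<close> shall have on
  the contracted arrows, the equation $gx=y$ forces the component $y_h g_s c_h^{-1}$ at the end of the
  arrow \<open>h\<close> that starts in \<open>s\<close>.
\<close>

lemma lift_over:
  fixes c :: "'h \<Rightarrow> 'k mat"
  assumes y: "y \<in> Esp \<Gamma> pm (dplus \<tau> \<omega>)" and z: "(g, u) \<in> reps\<^sub>\<Delta> (\<mu> y)"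
    and c: "\<And>h. h \<in> pm \<Longrightarrow> dim_row (c h) = \<tau> im + \<omega> im \<and> invertible_mat (c h) \<and> low (\<tau> im) (\<tau> im) (c h)"
  shows "\<exists>z\<in>reps y. proj z = (g, u) \<and> (\<forall>h\<in>pm. snd z h = c h)"
proof -
  let ?\<nu> = "dplus \<tau> \<omega>"
  note o = reps_overD[OF z]
  define x where "x = lift ?\<nu> u c"
  have xpm: "x h = c h" if "h \<in> pm" for h using that lift_pm by (simp add: x_def)
  have c': "dim_row (c h) = ?\<nu> im \<and> invertible_mat (c h)" if "h \<in> pm" for h
    using c[OF that] by (simp add: dplus_def)
  have x: "x \<in> Esp \<Gamma> pm ?\<nu>" "\<mu> x = u"
    using lift[OF \<tau>\<omega> o(4) c'] by (auto simp: x_def)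
  have xSW: "x \<in> SW \<Gamma> pm \<tau> \<omega>"
    using mu_SW[OF x(1)] x(2) o(2) c vdim_pm[where \<nu>=\<tau>, OF \<tau>] by (simp add: xpm)
  define g' where "g' = (\<lambda>v\<in>verts \<Gamma>. if v \<in> im then y (arrow_into v) * (g (src \<Gamma> (arrow_into v)) * minv (c (arrow_into v))) else g v)"
  have src: "src \<Gamma> h \<in> verts \<Gamma> - im" if "h \<in> pm" for h
    using pmD[OF that] arrD(1)[of h] ip_im by auto
  have gd: "dim_row (g v) = vd ?\<nu> v" "dim_col (g v) = vd ?\<nu> v" "invertible_mat (g v)" if "v \<in> verts \<Gamma> - im" for v
    using GrpD[OF o(1), of v] that by auto
  have g'im: "g' (tgt \<Gamma> h) = y h * (g (src \<Gamma> h) * minv (c h))" if "h \<in> pm" for h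
    using that pmD[OF that] arrD(2)[of h] arrow_into(3)[OF that] by (simp add: g'_def)
  have gs: "dim_row (g (src \<Gamma> h)) = ?\<nu> im" "dim_col (g (src \<Gamma> h)) = ?\<nu> im" "invertible_mat (g (src \<Gamma> h))" if "h \<in> pm" for h
    using gd[OF src[OF that]] vdim_pm[OF \<tau>\<omega> that] by auto
  have g'G: "g' \<in> Grp \<Gamma> ?\<nu>"
  proof (rule GrpI)
    show "g' \<in> extensional (verts \<Gamma>)" by (simp add: g'_def)
    show "dim_row (g' v) = vd ?\<nu> v \<and> invertible_mat (g' v)" if v: "v \<in> verts \<Gamma>" for v
    proof (cases "v \<in> im")
      case True
      note h = arrow_into(1,2)[OF True]
      have "g' v = y (arrow_into v) * (g (src \<Gamma> (arrow_into v)) * minv (c (arrow_into v)))" using g'im[OF h(1)] h(2) by simp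
      moreover have "invertible_mat (y (arrow_into v) * (g (src \<Gamma> (arrow_into v)) * minv (c (arrow_into v))))"
        using Esp_pmD[OF \<tau>\<omega> y h(1)] gs[OF h(1)] c'[OF h(1)]
        by (intro invertible_mult(1)) (auto simp: minv_props)
      ultimately show ?thesis using Esp_pmD[OF \<tau>\<omega> y h(1)] vdim_into(2)[OF \<tau>\<omega> True] by simp
    next
      case False
      then show ?thesis using gd[of v] v by (simp add: g'_def)
    qed
  qed
  have fg: "forget g' = g"
  proof (rule extensionalityI)
    show "g \<in> extensional (verts \<Gamma> - im)" using Grp_ext[OF o(1)] by simp
  qed (auto simp: g'_def)
  have x0: "x \<in> Esp \<Gamma> {} ?\<nu>" using x(1) by (auto simp: Esp_open_subset[of _ _ pm])
  have "act \<Gamma> g' x = y"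
  proof (rule mu_inj[OF \<tau>\<omega> _ y])
    show "act \<Gamma> g' x \<in> Esp \<Gamma> pm ?\<nu>" using act_Esp[OF g'G x0 pm_arrs] x(1) by simp
    show "\<mu> (act \<Gamma> g' x) = \<mu> y" using mu_act[OF \<tau>\<omega> x(1) g'G] x(2) fg o(3) by simp
    show "act \<Gamma> g' x h = y h" if h: "h \<in> pm" for h
    proof -
      have "g' (src \<Gamma> h) = g (src \<Gamma> h)" using src[OF h] by (simp add: g'_def)
      then show ?thesis
        using h pm_arrs Esp_pmD[OF \<tau>\<omega> y h] gs[OF h] c'[OF h]
        by (simp add: act_app subset_eq xpm g'im mat_assoc minv_props minv_cancel invertible_square mat_one_mult)
    qed
  qed
  then have "(g', x) \<in> reps y" using g'G xSW by (simp add: reps_over_def)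
  moreover have "proj (g', x) = (g, u)" using fg x(2) by (simp add: proj_def)
  ultimately show ?thesis using xpm by fastforce
qed

text \<open>
  The vertices in $i_-$ and the contracted arrows each contribute $\#i_-\tau_{i_-}\omega_{i_-}$. The
  contributions are added in $m_\Omega$ and cancel in $m^*_\Omega$.
\<close>

lemma mOm_contract:
  "mOm \<Gamma> \<tau> \<omega> = mOm \<Delta> \<tau> \<omega> + 2 * (int (card im) * (int (\<tau> im) * int (\<omega> im)))"
  "mstarOm \<Gamma> \<tau> \<omega> = mstarOm \<Delta> \<tau> \<omega>"
proof -
  have im: "im \<subseteq> verts \<Gamma>" using orbit_of[OF orbits(2)] by auto
  have "vd \<nu> v = \<nu> im" if "v \<in> im" for \<nu> v using orbit_of[OF orbits(2) that] by (simp add: vdim_def)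
  then have "(\<Sum>v\<in>im. int (vd \<tau> v) * int (vd \<omega> v)) = int (card im) * (int (\<tau> im) * int (\<omega> im))"
    by simp
  then have V: "(\<Sum>v\<in>verts \<Gamma>. int (vd \<tau> v) * int (vd \<omega> v)) =
      (\<Sum>v\<in>verts \<Delta>. int (vdim \<Delta> \<tau> v) * int (vdim \<Delta> \<omega> v)) + int (card im) * (int (\<tau> im) * int (\<omega> im))"
    using sum.subset_diff[OF im finite_verts, of "\<lambda>v. int (vd \<tau> v) * int (vd \<omega> v)"] by simp
  have "(\<Sum>h\<in>pm. int (vd \<tau> (src \<Gamma> h)) * int (vd \<omega> (tgt \<Gamma> h))) = int (card im) * (int (\<tau> im) * int (\<omega> im))"
    using vdim_pm[where \<nu>=\<tau>, OF \<tau>] vdim_pm[where \<nu>=\<omega>, OF \<omega>] by (simp add: card_pm(1))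
  moreover have "(\<Sum>k\<in>arrs \<Delta>. int (vdim \<Delta> \<tau> (src \<Delta> k)) * int (vdim \<Delta> \<omega> (tgt \<Delta> k))) =
      (\<Sum>h\<in>arrs \<Gamma> - pm. int (vd \<tau> (src \<Gamma> h)) * int (vd \<omega> (tgt \<Gamma> h)))"
    unfolding arrs_contract
    by (subst sum.reindex[OF inj_kept])
      (auto simp: kept_ends arrD vdim_root[where \<nu>=\<tau>, OF \<tau>] vdim_root[where \<nu>=\<omega>, OF \<omega>] intro!: sum.cong)
  ultimately have A: "(\<Sum>h\<in>arrs \<Gamma>. int (vd \<tau> (src \<Gamma> h)) * int (vd \<omega> (tgt \<Gamma> h))) =
      (\<Sum>k\<in>arrs \<Delta>. int (vdim \<Delta> \<tau> (src \<Delta> k)) * int (vdim \<Delta> \<omega> (tgt \<Delta> k))) + int (card im) * (int (\<tau> im) * int (\<omega> im))"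
    using sum.subset_diff[OF pm_arrs finite_arrs, of "\<lambda>h. int (vd \<tau> (src \<Gamma> h)) * int (vd \<omega> (tgt \<Gamma> h))"] by simp
  show "mOm \<Gamma> \<tau> \<omega> = mOm \<Delta> \<tau> \<omega> + 2 * (int (card im) * (int (\<tau> im) * int (\<omega> im)))"
    "mstarOm \<Gamma> \<tau> \<omega> = mstarOm \<Delta> \<tau> \<omega>"
    unfolding mOm_def mstarOm_def V A by simp_all
qed

lemma mu_star_exponent:
  "(int n)\<^sup>2 * cartan \<Gamma> im im div 2 = int (card im) * (int n)\<^sup>2"
  by (simp add: cartan_def)

text \<open>
  The product structure of cosets over \<open>y\<close>. Surjectivity is \<open>lift_over\<close>: for $Q$ with identity
  matrices on the contracted arrows, for $U$ with block diagonal matrices whose blocks are the given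
  rational points; then the class obtained is rational because its diagonal blocks are fixed.
\<close>

lemma rational_sum_contract:
  fixes y :: "('h, 'k) rep" and \<Phi> :: "('h, 'k) rep \<times> ('h, 'k) rep \<Rightarrow> complex"
  assumes y: "y \<in> EF \<Gamma> pm q (dplus \<tau> \<omega>)"
    and \<Phi>: "\<And>x x'. x \<in> EF \<Gamma> pm q \<tau> \<Longrightarrow> x' \<in> EF \<Gamma> pm q \<omega> \<Longrightarrow>
      \<Phi> (x, x') = \<Phi>' (\<mu> x, \<mu> x')"
  shows "(\<Sum>D\<in>rat False y // eqv False y.
      \<Sum>C\<in>{C \<in> rat True y // eqv True y. eqv False y `` C = D}.
        \<Phi> (p1 \<Gamma> \<tau> \<omega> C)) =
    of_nat (card (levi_points \<tau> \<times> levi_points \<omega>)) *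
    (\<Sum>D\<in>rat\<^sub>\<Delta> False (\<mu> y) // eqv\<^sub>\<Delta> False (\<mu> y).
      \<Sum>C\<in>{C \<in> rat\<^sub>\<Delta> True (\<mu> y) // eqv\<^sub>\<Delta> True (\<mu> y).
          eqv\<^sub>\<Delta> False (\<mu> y) `` C = D}.
        \<Phi>' (p1 \<Delta> \<tau> \<omega> C))"
proof (rule fibred_quotient_sum[where f=proj and l=diag_pm and A="reps y"
      and A'="reps\<^sub>\<Delta> (\<mu> y)"
      and R="\<lambda>b. eqv b y" and R'="\<lambda>b. eqv\<^sub>\<Delta> b (\<mu> y)"
      and Y="\<lambda>b. rat b y" and Y'="\<lambda>b. rat\<^sub>\<Delta> b (\<mu> y)"])
  have yF: "frobE \<Gamma> q y = y" and yE: "y \<in> Esp \<Gamma> pm (dplus \<tau> \<omega>)" using y by (auto simp: EF_def)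
  have ro: "z \<in> reps y" if "z \<in> rat b y" for z b
    using that by (simp add: rational_def)
  show "equiv (reps y) (eqv b y)" for b by (rule equiv_coset_rel)
  show "equiv (reps\<^sub>\<Delta> (\<mu> y)) (eqv\<^sub>\<Delta> b (\<mu> y))" for b
    by (rule con.equiv_coset_rel)
  show "rat b y \<subseteq> reps y" for b by (auto simp: rational_def)
  show "rat\<^sub>\<Delta> b (\<mu> y) \<subseteq> reps\<^sub>\<Delta> (\<mu> y)" for b
    by (auto simp: rational_def)
  show "rat True y \<subseteq> rat False y"
    by (auto simp: rational_def intro: coset_rel_True_False)
  show "rat\<^sub>\<Delta> True (\<mu> y) \<subseteq> rat\<^sub>\<Delta> False (\<mu> y)"
    by (auto simp: rational_def intro: con.coset_rel_True_False)
  show "eqv False y `` (eqv True y `` {z}) = eqv False y `` {z}"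
    if "z \<in> rat True y" for z
    by (rule p2_class(2)[OF ro[OF that]])
  show "eqv\<^sub>\<Delta> False (\<mu> y) `` (eqv\<^sub>\<Delta> True (\<mu> y) `` {z}) =
      eqv\<^sub>\<Delta> False (\<mu> y) `` {z}"
    if "z \<in> rat\<^sub>\<Delta> True (\<mu> y)" for z
    using that by (intro con.p2_class(2)) (simp add: rational_def)
  show "proj z \<in> rat\<^sub>\<Delta> b (\<mu> y)" if "z \<in> rat b y" for b z
    using rational_proj[OF yF ro[OF that]] that by blast
  show "diag_pm z \<in> levi_points \<tau> \<times> levi_points \<omega>" if "z \<in> rat True y" for z
    by (rule rational_diag_pm[OF that])
  show "(z, z') \<in> eqv False y \<longleftrightarrow> (proj z, proj z') \<in> eqv\<^sub>\<Delta> False (\<mu> y)"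
    if "z \<in> rat False y" "z' \<in> rat False y" for z z'
    using coset_rel_proj[OF ro[OF that(1)] ro[OF that(2)], of False] by simp
  show "(z, z') \<in> eqv True y \<longleftrightarrow>
      (proj z, proj z') \<in> eqv\<^sub>\<Delta> True (\<mu> y) \<and> diag_pm z = diag_pm z'"
    if "z \<in> rat True y" "z' \<in> rat True y" for z z'
    using coset_rel_proj[OF ro[OF that(1)] ro[OF that(2)], of True] by simp
  show "\<exists>z\<in>rat False y. proj z = u" if u: "u \<in> rat\<^sub>\<Delta> False (\<mu> y)" for u
  proof -
    obtain g x where gx: "u = (g, x)" "(g, x) \<in> reps\<^sub>\<Delta> (\<mu> y)"
      using u by (cases u) (auto simp: rational_def)
    obtain z where z: "z \<in> reps y" "proj z = (g, x)"
      using lift_over[OF yE gx(2), of "\<lambda>_. 1\<^sub>m (\<tau> im + \<omega> im)"] by (auto simp: invertible_one low_one)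
    then show ?thesis using rational_proj[OF yF z(1), of False] u gx by (intro bexI[of _ z]) auto
  qed
  show "\<exists>z\<in>rat True y. proj z = u \<and> diag_pm z = b"
    if u: "u \<in> rat\<^sub>\<Delta> True (\<mu> y)" and b: "b \<in> levi_points \<tau> \<times> levi_points \<omega>" for u b
  proof -
    obtain g x where gx: "u = (g, x)" "(g, x) \<in> reps\<^sub>\<Delta> (\<mu> y)"
      using u by (cases u) (auto simp: rational_def)
    obtain b1 b2 where b12: "b = (b1, b2)" "b1 \<in> levi_points \<tau>" "b2 \<in> levi_points \<omega>" using b by auto
    have b1: "dim_row (b1 h) = \<tau> im" "dim_col (b1 h) = \<tau> im" "invertible_mat (b1 h)" "b1 (haut \<Gamma> h) = fr (b1 h)"
      and b2: "dim_row (b2 h) = \<omega> im" "dim_col (b2 h) = \<omega> im" "invertible_mat (b2 h)" "b2 (haut \<Gamma> h) = fr (b2 h)"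
      if "h \<in> pm" for h using b12(2,3) that by (auto simp: levi_points_def fixed_families_def PiE_iff)
    have bext: "b1 \<in> extensional pm" "b2 \<in> extensional pm"
      using b12(2,3) by (auto simp: levi_points_def fixed_families_def PiE_iff)
    let ?c = "\<lambda>h. block_lower (b1 h) (0\<^sub>m (\<omega> im) (\<tau> im)) (b2 h)"
    have cl: "low (\<tau> im) (\<tau> im) (?c h)" "diagT (\<tau> im) (\<tau> im) (?c h) = b1 h"
      "diagW (\<tau> im) (\<omega> im) (\<tau> im) (\<omega> im) (?c h) = b2 h" if "h \<in> pm" for h
      using low_block_lower[of "b1 h" "\<tau> im" "\<tau> im" "b2 h" "\<omega> im" "\<omega> im" "0\<^sub>m (\<omega> im) (\<tau> im)"] b1[OF that] b2[OF that] by auto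
    have c: "dim_row (?c h) = \<tau> im + \<omega> im \<and> invertible_mat (?c h) \<and> low (\<tau> im) (\<tau> im) (?c h)" if "h \<in> pm" for h
      using cl[OF that] b1[OF that] b2[OF that]
      by (subst low_invertible_iff[OF cl(1)[OF that], of "\<omega> im"]) auto
    obtain z where z: "z \<in> reps y" "proj z = (g, x)" "\<forall>h\<in>pm. snd z h = ?c h"
      using lift_over[OF yE gx(2), of ?c] c by auto
    obtain g' x' where z': "z = (g', x')" by (cases z)
    have T: "xT \<Gamma> \<tau> x' h = b1 h" "xW \<Gamma> \<tau> \<omega> x' h = b2 h" if "h \<in> pm" for h
      using z(3) z' that pm_arrs cl[OF that] vdim_pm[where \<nu>=\<tau>, OF \<tau> that] vdim_pm[where \<nu>=\<omega>, OF \<omega> that]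
      by (auto simp: xT_def xW_def)
    have d: "diag_pm z = b"
      using bext T by (auto simp: diag_pm_def z' b12(1) intro!: extensionalityI[of _ pm])
    have "frobE \<Gamma> q (xT \<Gamma> \<tau> x') h = xT \<Gamma> \<tau> x' h \<and> frobE \<Gamma> q (xW \<Gamma> \<tau> \<omega> x') h = xW \<Gamma> \<tau> \<omega> x' h" if h: "h \<in> pm" for h
    proof -
      obtain h' where h': "h' \<in> pm" "h = haut \<Gamma> h'" using haut_pm h by blast
      then show ?thesis using frobE_haut[of h'] pm_arrs T h b1(4) b2(4) by auto
    qed
    then have "diag_pm (heart.frob z) = diag_pm z"
      using frobE_xT[OF reps_overD(4)[OF z(1)[unfolded z']]]
      by (auto simp: diag_pm_def z' intro!: restrict_ext)
    then show ?thesis using rational_proj[OF yF z(1), of True] u gx z(2) d by (intro bexI[of _ z]) auto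
  qed
  show "\<Phi> (p1 \<Gamma> \<tau> \<omega> (eqv True y `` {z})) =
      \<Phi>' (p1 \<Delta> \<tau> \<omega> (eqv\<^sub>\<Delta> True (\<mu> y) `` {proj z}))"
    if z: "z \<in> rat True y" for z
  proof -
    obtain g x where gx: "z = (g, x)" by (cases z)
    note zo = ro[OF z, unfolded gx]
    have "p1 \<Delta> \<tau> \<omega> (eqv\<^sub>\<Delta> True (\<mu> y) `` {proj z}) =
        (xT \<Delta> \<tau> (\<mu> x), xW \<Delta> \<tau> \<omega> (\<mu> x))"
      using con.p1_class proj_over[OF zo] by (simp add: gx proj_def)
    then show ?thesis
      using \<Phi>[OF rational_diag[OF z[unfolded gx]]] p1_class[OF zo] mu_xT_xW[OF reps_overD(2)[OF zo]] by (simp add: gx)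
  qed
qed

text \<open>
  The number of Levi points from \<open>rational_sum_contract\<close> cancels against the orders of the groups, and
  the powers of \<open>s\<close> match by \<open>mOm_contract\<close>.
\<close>

lemma mu_star_Ind:
  assumes s: "s \<noteq> 0"
  shows "mu_star_nu \<Gamma> ip im q s (dplus \<tau> \<omega>) (Ind \<Delta> {} q s \<tau> \<omega> (tens F G)) =
    (Ind \<Gamma> pm q s \<tau> \<omega> (tens (mu_star_nu \<Gamma> ip im q s \<tau> F) (mu_star_nu \<Gamma> ip im q s \<omega> G)) :: ('h, 'k) rep \<Rightarrow> complex)"
proof
  fix y :: "('h, 'k) rep"
  let ?e = "\<lambda>n. int (card im) * (int n)\<^sup>2"
  let ?\<Phi> = "tens (mu_star_nu \<Gamma> ip im q s \<tau> F) (mu_star_nu \<Gamma> ip im q s \<omega> G) :: ('h, 'k) rep \<times> ('h, 'k) rep \<Rightarrow> complex"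
  show "mu_star_nu \<Gamma> ip im q s (dplus \<tau> \<omega>) (Ind \<Delta> {} q s \<tau> \<omega> (tens F G)) y = Ind \<Gamma> pm q s \<tau> \<omega> ?\<Phi> y"
  proof (cases "y \<in> EF \<Gamma> pm q (dplus \<tau> \<omega>)")
    case False
    then show ?thesis by (simp add: mu_star_nu_def heart.Ind_eq_0)
  next
    case True
    note muy = mu_EF[OF \<tau>\<omega> True]
    have \<Phi>: "?\<Phi> (x, x') = s powi (- ?e (\<tau> im) - ?e (\<omega> im)) * tens F G (\<mu> x, \<mu> x')"
      if "x \<in> EF \<Gamma> pm q \<tau>" "x' \<in> EF \<Gamma> pm q \<omega>" for x x'
      using that s by (simp add: tens_def mu_star_nu_def pull_def mu_star_exponent)
        (simp add: power_int_diff power_int_minus field_simps)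
    have GF: "card (GF \<Gamma> q \<tau> \<times> GF \<Gamma> q \<omega> :: (('v \<Rightarrow> 'k mat) \<times> ('v \<Rightarrow> 'k mat)) set) =
        card (GF \<Delta> q \<tau> \<times> GF \<Delta> q \<omega> :: (('v \<Rightarrow> 'k mat) \<times> ('v \<Rightarrow> 'k mat)) set) * card (levi_points \<tau> \<times> levi_points \<omega>)"
      by (simp add: card_cartesian_product card_GF[OF \<tau>] card_GF[OF \<omega>])
    have levi_points: "card (levi_points \<tau> \<times> levi_points \<omega>) \<noteq> 0"
      using card_levi_points(2)[of \<tau>] card_levi_points(2)[of \<omega>] by (auto simp: card_cartesian_product)
    define S where "S = (\<Sum>D\<in>rat\<^sub>\<Delta> False (\<mu> y) // eqv\<^sub>\<Delta> False (\<mu> y).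
      \<Sum>C\<in>{C \<in> rat\<^sub>\<Delta> True (\<mu> y) // eqv\<^sub>\<Delta> True (\<mu> y).
          eqv\<^sub>\<Delta> False (\<mu> y) `` C = D}. tens F G (p1 \<Delta> \<tau> \<omega> C))"
    define N where "N = card (GF \<Delta> q \<tau> \<times> GF \<Delta> q \<omega> :: (('v \<Rightarrow> 'k mat) \<times> ('v \<Rightarrow> 'k mat)) set)"
    have "Ind \<Gamma> pm q s \<tau> \<omega> ?\<Phi> y = s powi (- mOm \<Gamma> \<tau> \<omega>) * (1 / of_nat (N * card (levi_points \<tau> \<times> levi_points \<omega>))) *
        (of_nat (card (levi_points \<tau> \<times> levi_points \<omega>)) * (s powi (- ?e (\<tau> im) - ?e (\<omega> im)) * S))"
      unfolding heart.Ind_eq[OF True] GF N_def[symmetric]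
      by (subst rational_sum_contract[where \<Phi>="?\<Phi>" and \<Phi>'="\<lambda>z. s powi (- ?e (\<tau> im) - ?e (\<omega> im)) * tens F G z", OF True \<Phi>])
        (simp_all only: S_def sum_distrib_left)
    also have "\<dots> = s powi (- mOm \<Gamma> \<tau> \<omega> - ?e (\<tau> im) - ?e (\<omega> im)) * (1 / of_nat N * S)"
      using levi_points s by (simp add: power_int_diff power_int_minus power_int_add field_simps)
    also have "- mOm \<Gamma> \<tau> \<omega> - ?e (\<tau> im) - ?e (\<omega> im) = - ?e (dplus \<tau> \<omega> im) - mOm \<Delta> \<tau> \<omega>"
      unfolding mOm_contract(1) by (simp add: dplus_def power2_eq_square algebra_simps)
    also have "s powi (- ?e (dplus \<tau> \<omega> im) - mOm \<Delta> \<tau> \<omega>) * (1 / of_nat N * S) =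
        s powi (- ?e (dplus \<tau> \<omega> im)) * (s powi (- mOm \<Delta> \<tau> \<omega>) * (1 / of_nat N) * S)"
      using s by (simp add: power_int_diff power_int_minus field_simps)
    also have "\<dots> = s powi (- ?e (dplus \<tau> \<omega> im)) * Ind \<Delta> {} q s \<tau> \<omega> (tens F G) (\<mu> y)"
      unfolding con.Ind_eq[OF muy] S_def N_def ..
    finally show ?thesis using True by (simp add: mu_star_nu_def pull_def mu_star_exponent)
  qed
qed

end

section \<open>Tensor products of spaces of invariant functions\<close>

lemma Qadj_0: "0 \<in> Qadj s"
  using Qadj.diff[OF Qadj.one Qadj.one] by simp

lemma Qadj_add: "a \<in> Qadj s \<Longrightarrow> b \<in> Qadj s \<Longrightarrow> a + b \<in> Qadj s"
  using Qadj.diff[of a s "0 - b"] Qadj.diff[OF Qadj_0, of b] by simp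

lemma Qadj_sum: "(\<And>x. x \<in> A \<Longrightarrow> f x \<in> Qadj s) \<Longrightarrow> (\<Sum>x\<in>A. f x) \<in> Qadj s"
  by (induction A rule: infinite_finite_induct) (auto simp: Qadj_0 Qadj_add)

lemma Qadj_power: "a \<in> Qadj s \<Longrightarrow> a ^ n \<in> Qadj s"
  by (induction n) (auto intro: Qadj.intros)

lemma Qadj_powi: "s powi n \<in> Qadj s"
  by (auto simp: power_int_def intro!: Qadj_power intro: Qadj.inv Qadj.gen)

text \<open>
  The value of the tensor product of two weighted pullbacks depends only on \<open>\<Phi>\<close> and not on the way
  in which \<open>\<Phi>\<close> is written as a sum of products; this makes the description in \<open>tens_map\<close> definite.
\<close>

lemma tens_map_eq:
  assumes S: "\<And>f x. S f x = v x * f (m x)" and T: "\<And>g y. T g y = w y * g (n y)"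
    and dec: "\<exists>(N::nat) f g. (\<forall>k<N. f k \<in> A \<and> g k \<in> B) \<and> \<Phi> = (\<lambda>z. \<Sum>k<N. tens (f k) (g k) z)"
  shows "tens_map A B S T \<Phi> = (\<lambda>(x, y). v x * w y * \<Phi> (m x, n y))"
proof -
  have *: "(\<lambda>z. \<Sum>k<N. tens (S (f k)) (T (g k)) z) = (\<lambda>(x, y). v x * w y * \<Phi> (m x, n y))"
    if "\<Phi> = (\<lambda>z. \<Sum>k<N. tens (f k) (g k) z)" for N :: nat and f g
    by (auto simp: that tens_def S T sum_distrib_left intro!: ext sum.cong)
  show ?thesis
    unfolding tens_map_def
  proof (rule the_equality)
    obtain N :: nat and f g where d: "\<forall>k<N. f k \<in> A \<and> g k \<in> B" "\<Phi> = (\<lambda>z. \<Sum>k<N. tens (f k) (g k) z)"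
      using dec by blast
    show "\<exists>(N::nat) f g. (\<forall>k<N. f k \<in> A \<and> g k \<in> B) \<and> \<Phi> = (\<lambda>z. \<Sum>k<N. tens (f k) (g k) z) \<and>
        (\<lambda>(x, y). v x * w y * \<Phi> (m x, n y)) = (\<lambda>z. \<Sum>k<N. tens (S (f k)) (T (g k)) z)"
      by (rule exI[of _ N], rule exI[of _ f], rule exI[of _ g], rule conjI[OF d(1) conjI[OF d(2) *[OF d(2), symmetric]]])
  next
    fix \<Psi> assume "\<exists>(N::nat) f g. (\<forall>k<N. f k \<in> A \<and> g k \<in> B) \<and> \<Phi> = (\<lambda>z. \<Sum>k<N. tens (f k) (g k) z) \<and>
        \<Psi> = (\<lambda>z. \<Sum>k<N. tens (S (f k)) (T (g k)) z)"
    then obtain N :: nat and f g where d: "\<Phi> = (\<lambda>z. \<Sum>k<N. tens (f k) (g k) z)"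
      "\<Psi> = (\<lambda>z. \<Sum>k<N. tens (S (f k)) (T (g k)) z)" by blast
    show "\<Psi> = (\<lambda>(x, y). v x * w y * \<Phi> (m x, n y))" unfolding d(2) by (rule *[OF d(1)])
  qed
qed

context hall_space
begin

lemma act_EF:
  fixes x :: "('h, 'k) rep"
  assumes "g \<in> GF \<Gamma> q \<nu>" "x \<in> EF \<Gamma> J q \<nu>"
  shows "act \<Gamma> g x \<in> EF \<Gamma> J q \<nu>"
proof -
  have g: "g \<in> Grp \<Gamma> \<nu>" "frobG \<Gamma> q g = g" and x: "x \<in> Esp \<Gamma> J \<nu>" "frobE \<Gamma> q x = x"
    using assms by (auto simp: GF_def EF_def)
  have x0: "x \<in> Esp \<Gamma> {} \<nu>" using x(1) by (auto simp: Esp_open_subset[of _ _ J])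
  show ?thesis using act_Esp[OF g(1) x0 J(2)] frobE_act[OF g(1) x0] g x by (simp add: EF_def)
qed

text \<open>
  Group the points \<open>x\<close> by the function \<open>\<Phi> (x, _)\<close>. There are finitely many such functions \<open>e k\<close>, each
  invariant in the second argument, and the indicator functions \<open>f k\<close> of the groups are invariant by
  invariance in the first argument.
\<close>

lemma tensor_decomposition:
  fixes \<Phi> :: "('h, 'k) rep \<times> ('h, 'k) rep \<Rightarrow> complex"
  assumes Q: "\<And>z. \<Phi> z \<in> Qadj s"
    and supp: "\<And>x y. \<Phi> (x, y) \<noteq> 0 \<Longrightarrow> x \<in> EF \<Gamma> J q \<tau> \<and> y \<in> EF \<Gamma> J q \<omega>"
    and inv1: "\<And>g x y. g \<in> GF \<Gamma> q \<tau> \<Longrightarrow> x \<in> EF \<Gamma> J q \<tau> \<Longrightarrow> y \<in> EF \<Gamma> J q \<omega> \<Longrightarrow> \<Phi> (act \<Gamma> g x, y) = \<Phi> (x, y)"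
    and inv2: "\<And>g x y. g \<in> GF \<Gamma> q \<omega> \<Longrightarrow> x \<in> EF \<Gamma> J q \<tau> \<Longrightarrow> y \<in> EF \<Gamma> J q \<omega> \<Longrightarrow> \<Phi> (x, act \<Gamma> g y) = \<Phi> (x, y)"
  shows "\<exists>(N::nat) f g. (\<forall>k<N. f k \<in> Hsp \<Gamma> J q s \<tau> \<and> g k \<in> Hsp \<Gamma> J q s \<omega>) \<and> \<Phi> = (\<lambda>z. \<Sum>k<N. tens (f k) (g k) z)"
proof -
  let ?E = "EF \<Gamma> J q \<tau> :: ('h, 'k) rep set"
  define V where "V = (\<lambda>x y. \<Phi> (x, y)) ` ?E"
  have "finite V" unfolding V_def using finite_EF by blast
  then obtain e where e: "bij_betw e {..<card V} V" using ex_bij_betw_nat_finite lessThan_atLeast0 by metis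
  define f where "f k x = (if x \<in> ?E \<and> (\<lambda>y. \<Phi> (x, y)) = e k then 1 else 0 :: complex)" for k x
  have "f k \<in> Hsp \<Gamma> J q s \<tau>" for k
  proof -
    have "(\<lambda>y. \<Phi> (act \<Gamma> g x, y)) = (\<lambda>y. \<Phi> (x, y))" if "g \<in> GF \<Gamma> q \<tau>" "x \<in> ?E" for g x
      using inv1[OF that] supp by (metis (no_types))
    then show ?thesis using act_EF by (auto simp: Hsp_def f_def Qadj_0 intro: Qadj.one)
  qed
  moreover have "e k \<in> Hsp \<Gamma> J q s \<omega>" if "k < card V" for k
  proof -
    have "e k \<in> V" using e that by (auto simp: bij_betw_def)
    then obtain x where "x \<in> ?E" "e k = (\<lambda>y. \<Phi> (x, y))" by (auto simp: V_def)
    moreover have "\<Phi> (x, y) = 0" if "y \<notin> EF \<Gamma> J q \<omega>" for y using supp that by blast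
    ultimately show ?thesis using Q inv2 by (auto simp: Hsp_def)
  qed
  moreover have "\<Phi> (x, y) = (\<Sum>k<card V. f k x * e k y)" for x y
  proof (cases "x \<in> ?E")
    case True
    then have "(\<lambda>y. \<Phi> (x, y)) \<in> e ` {..<card V}" using e by (simp add: V_def bij_betw_def)
    then obtain k where k: "k < card V" "e k = (\<lambda>y. \<Phi> (x, y))" by (elim imageE) simp
    have "f j x = (if j = k then 1 else 0)" if "j < card V" for j
    proof -
      have "e j = e k \<longleftrightarrow> j = k" using inj_on_eq_iff[OF bij_betw_imp_inj_on[OF e]] that k(1) by simp
      then show ?thesis unfolding f_def k(2)[symmetric] using True by auto
    qed
    then have "(\<Sum>j<card V. f j x * e j y) = (\<Sum>j<card V. if j = k then e j y else 0)"
      by (intro sum.cong) auto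
    then show ?thesis using k by simp
  next
    case False
    then show ?thesis using supp by (auto simp: f_def)
  qed
  ultimately show ?thesis by (intro exI[of _ "card V"] exI[of _ f] exI[of _ e]) (auto simp: tens_def)
qed

text \<open>
  Taking diagonal blocks is multiplicative on block triangular matrices, so it intertwines the action
  of the parabolic subgroup with that of its Levi quotient.
\<close>

lemma levi_act:
  fixes x :: "('h, 'k) rep"
  assumes G: "G \<in> Grp \<Gamma> (dplus \<tau> \<omega>)" and low: "\<And>v. v \<in> verts \<Gamma> \<Longrightarrow> low (vd \<tau> v) (vd \<tau> v) (G v)"
    and x: "x \<in> SW \<Gamma> J \<tau> \<omega>"
  shows "act \<Gamma> G x \<in> SW \<Gamma> J \<tau> \<omega>"
    "xT \<Gamma> \<tau> (act \<Gamma> G x) = act \<Gamma> (\<lambda>v\<in>verts \<Gamma>. diagT (vd \<tau> v) (vd \<tau> v) (G v)) (xT \<Gamma> \<tau> x)"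
    "xW \<Gamma> \<tau> \<omega> (act \<Gamma> G x) = act \<Gamma> (\<lambda>v\<in>verts \<Gamma>. diagW (vd \<tau> v) (vd \<omega> v) (vd \<tau> v) (vd \<omega> v) (G v)) (xW \<Gamma> \<tau> \<omega> x)"
proof -
  have x0: "x \<in> Esp \<Gamma> {} (dplus \<tau> \<omega>)" and xJ: "x \<in> Esp \<Gamma> J (dplus \<tau> \<omega>)"
    using SW_Esp[OF x] x by (auto simp: SW_iff)
  have *: "low (vd \<tau> (tgt \<Gamma> h)) (vd \<tau> (src \<Gamma> h)) (act \<Gamma> G x h) \<and>
      xT \<Gamma> \<tau> (act \<Gamma> G x) h = act \<Gamma> (\<lambda>v\<in>verts \<Gamma>. diagT (vd \<tau> v) (vd \<tau> v) (G v)) (xT \<Gamma> \<tau> x) h \<and>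
      xW \<Gamma> \<tau> \<omega> (act \<Gamma> G x) h = act \<Gamma> (\<lambda>v\<in>verts \<Gamma>. diagW (vd \<tau> v) (vd \<omega> v) (vd \<tau> v) (vd \<omega> v) (G v)) (xW \<Gamma> \<tau> \<omega> x) h"
    if h: "h \<in> arrs \<Gamma>" for h
  proof -
    let ?s = "src \<Gamma> h" and ?t = "tgt \<Gamma> h"
    let ?ts = "vd \<tau> ?s" and ?tt = "vd \<tau> ?t" and ?ws = "vd \<omega> ?s" and ?wt = "vd \<omega> ?t"
    note st = arrD(1)[OF h] arrD(2)[OF h]
    note gd = GrpD[OF G st(1)] GrpD[OF G st(2)] EspD[OF x0 h]
    note l = SW_low[OF x h] low[OF st(1)] low[OF st(2)]
    have sr: "dim_row (G ?s) = ?ts + ?ws" using gd by (simp add: vdim_dplus)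
    note li = low_minv[OF gd(3) l(2) sr] and di = diag_minv[OF gd(3) l(2) sr]
    have l1: "low ?tt ?ts (x h * minv (G ?s))"
      by (rule low_mult[OF l(1) li]) (use gd in \<open>simp_all add: vdim_dplus minv_props\<close>)
    have l2: "low ?tt ?ts (G ?t * (x h * minv (G ?s)))"
      by (rule low_mult[OF l(3) l1]) (use gd in \<open>simp_all add: vdim_dplus minv_props\<close>)
    have e: "act \<Gamma> G x h = G ?t * (x h * minv (G ?s))"
      using gd h by (simp add: act_app mat_assoc minv_props)
    have T: "diagT ?tt ?ts (G ?t * (x h * minv (G ?s))) = diagT ?tt ?tt (G ?t) * (diagT ?tt ?ts (x h) * diagT ?ts ?ts (minv (G ?s)))"
      using gd by (simp add: diagT_mult[OF l(3), where w'="?wt"] diagT_mult[OF l(1), where w'="?ws"] vdim_dplus minv_props)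
    have W: "diagW ?tt ?wt ?ts ?ws (G ?t * (x h * minv (G ?s))) =
        diagW ?tt ?wt ?tt ?wt (G ?t) * (diagW ?tt ?wt ?ts ?ws (x h) * diagW ?ts ?ws ?ts ?ws (minv (G ?s)))"
      using gd by (simp add: diagW_mult[OF l1, where w'="?wt"] diagW_mult[OF li, where w'="?ws"] vdim_dplus minv_props)
    have sc: "dim_col (G ?s) = ?ts + ?ws" using gd by (simp add: vdim_dplus)
    have i: "invertible_mat (diagT ?ts ?ts (G ?s))" "invertible_mat (diagW ?ts ?ws ?ts ?ws (G ?s))"
      using low_invertible_iff[OF l(2) sr sc] gd(3) by auto
    show ?thesis
      using l2 h st i by (simp add: e xT_def xW_def T W di act_app mat_assoc diag_dims minv_props)
  qed
  show "act \<Gamma> G x \<in> SW \<Gamma> J \<tau> \<omega>"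
    using * act_Esp[OF G x0 J(2)] xJ by (auto simp: SW_iff)
  show "xT \<Gamma> \<tau> (act \<Gamma> G x) = act \<Gamma> (\<lambda>v\<in>verts \<Gamma>. diagT (vd \<tau> v) (vd \<tau> v) (G v)) (xT \<Gamma> \<tau> x)"
    by (rule extensionalityI[OF _ act_ext]) (use * in \<open>auto simp: xT_def\<close>)
  show "xW \<Gamma> \<tau> \<omega> (act \<Gamma> G x) = act \<Gamma> (\<lambda>v\<in>verts \<Gamma>. diagW (vd \<tau> v) (vd \<omega> v) (vd \<tau> v) (vd \<omega> v) (G v)) (xW \<Gamma> \<tau> \<omega> x)"
    by (rule extensionalityI[OF _ act_ext]) (use * in \<open>auto simp: xW_def\<close>)
qed

lemma Res_eq:
  "Res \<Gamma> J q s \<tau> \<omega> f (z1, z2) = s powi (- mstarOm \<Gamma> \<tau> \<omega>) *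
     (\<Sum>x\<in>{x \<in> SW \<Gamma> J \<tau> \<omega>. frobE \<Gamma> q x = x \<and> xT \<Gamma> \<tau> x = z1 \<and> xW \<Gamma> \<tau> \<omega> x = z2}. f x)"
  unfolding Res_def push_def pull_def kappa_def by (simp add: conj_assoc)

lemma fr_block_lower:
  fixes a c d :: "'k mat"
  assumes "dim_row a = t'" "dim_col a = t" "dim_row d = w'" "dim_col d = w" "dim_row c = w'" "dim_col c = t"
  shows "fr (block_lower a c d) = block_lower (fr a) (fr c) (fr d)"
  by (rule eq_matI) (use assms q_pos in auto)

text \<open>
  The block diagonal group element \<open>G\<close> with blocks \<open>g\<close> and \<open>g'\<close> permutes the fibres of $\kappa$ in the
  same way as the pair \<open>(g, g')\<close> permutes their base points.
\<close>

lemma Res_invariant: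
  fixes f :: "('h, 'k) rep \<Rightarrow> complex"
  assumes f: "f \<in> Hsp \<Gamma> J q s (dplus \<tau> \<omega>)" and g: "g \<in> GF \<Gamma> q \<tau>" "g' \<in> GF \<Gamma> q \<omega>"
    and z: "z1 \<in> EF \<Gamma> J q \<tau>" "z2 \<in> EF \<Gamma> J q \<omega>"
  shows "Res \<Gamma> J q s \<tau> \<omega> f (act \<Gamma> g z1, act \<Gamma> g' z2) = Res \<Gamma> J q s \<tau> \<omega> f (z1, z2)"
proof -
  define G where "G = (\<lambda>v\<in>verts \<Gamma>. block_lower (g v) (0\<^sub>m (vd \<omega> v) (vd \<tau> v)) (g' v))"
  have gG: "g \<in> Grp \<Gamma> \<tau>" "g' \<in> Grp \<Gamma> \<omega>" "frobG \<Gamma> q g = g" "frobG \<Gamma> q g' = g'" using g by (auto simp: GF_def)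
  have z0: "z1 \<in> Esp \<Gamma> {} \<tau>" "z2 \<in> Esp \<Gamma> {} \<omega>" using z by (auto simp: EF_def Esp_open_subset[of _ _ J])
  have Gv: "low (vd \<tau> v) (vd \<tau> v) (G v)" "diagT (vd \<tau> v) (vd \<tau> v) (G v) = g v"
    "diagW (vd \<tau> v) (vd \<omega> v) (vd \<tau> v) (vd \<omega> v) (G v) = g' v"
    "dim_row (G v) = vd \<tau> v + vd \<omega> v" "dim_col (G v) = vd \<tau> v + vd \<omega> v"
    if v: "v \<in> verts \<Gamma>" for v
    using low_block_lower[of "g v" "vd \<tau> v" "vd \<tau> v" "g' v" "vd \<omega> v" "vd \<omega> v" "0\<^sub>m (vd \<omega> v) (vd \<tau> v)"]
      GrpD[OF gG(1) v] GrpD[OF gG(2) v] v by (simp_all add: G_def)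
  have G: "G \<in> Grp \<Gamma> (dplus \<tau> \<omega>)"
  proof (rule GrpI)
    show "G \<in> extensional (verts \<Gamma>)" by (simp add: G_def)
    show "dim_row (G v) = vd (dplus \<tau> \<omega>) v \<and> invertible_mat (G v)" if v: "v \<in> verts \<Gamma>" for v
      using Gv[OF v] low_invertible_iff[OF Gv(1,4,5)[OF v]] GrpD[OF gG(1) v] GrpD[OF gG(2) v] by (simp add: vdim_dplus)
  qed
  have diagG: "(\<lambda>v\<in>verts \<Gamma>. diagT (vd \<tau> v) (vd \<tau> v) (G v)) = g"
    "(\<lambda>v\<in>verts \<Gamma>. diagW (vd \<tau> v) (vd \<omega> v) (vd \<tau> v) (vd \<omega> v) (G v)) = g'"
    using Gv Grp_ext[OF gG(1)] Grp_ext[OF gG(2)] by (auto intro!: extensionalityI[of _ "verts \<Gamma>"])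
  have "frobG \<Gamma> q G = G"
  proof (rule grp_eqI_vaut[OF frobG_ext Grp_ext[OF G]])
    fix v assume v: "v \<in> verts \<Gamma>"
    have "g (vaut \<Gamma> v) = fr (g v)" "g' (vaut \<Gamma> v) = fr (g' v)"
      using gG(3,4) frobG_vaut[OF v, of g] frobG_vaut[OF v, of g'] by auto
    moreover have fr0: "fr (0\<^sub>m r c) = 0\<^sub>m r c" for r c by (rule eq_matI) (use q_pos in auto)
    ultimately have "G (vaut \<Gamma> v) = block_lower (fr (g v)) (fr (0\<^sub>m (vd \<omega> v) (vd \<tau> v))) (fr (g' v))"
      using v vaut_in[OF v] fr0 by (simp add: G_def vdim_vaut)
    also have "\<dots> = fr (G v)"
      using GrpD[OF gG(1) v] GrpD[OF gG(2) v] v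
      by (subst fr_block_lower[symmetric, where t'="vd \<tau> v" and w'="vd \<omega> v"]) (simp_all add: G_def)
    finally show "frobG \<Gamma> q G (vaut \<Gamma> v) = G (vaut \<Gamma> v)" by (simp add: frobG_vaut[OF v])
  qed
  then have GGF: "G \<in> GF \<Gamma> q (dplus \<tau> \<omega>)" using G by (simp add: GF_def)
  have Gi: "low (vd \<tau> v) (vd \<tau> v) (ginv \<Gamma> G v)" if v: "v \<in> verts \<Gamma>" for v
    using low_minv[OF _ Gv(1,4)[OF v]] GrpD[OF G v] v by (simp add: ginv_def)
  let ?A = "\<lambda>a b. {x \<in> SW \<Gamma> J \<tau> \<omega>. frobE \<Gamma> q x = x \<and> xT \<Gamma> \<tau> x = a \<and> xW \<Gamma> \<tau> \<omega> x = b}"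
  have "(\<Sum>x\<in>?A z1 z2. f x) = (\<Sum>x\<in>?A (act \<Gamma> g z1) (act \<Gamma> g' z2). f x)"
  proof (rule sum.reindex_bij_witness[of _ "act \<Gamma> (ginv \<Gamma> G)" "act \<Gamma> G"])
    fix x assume x: "x \<in> ?A z1 z2"
    then have xS: "x \<in> SW \<Gamma> J \<tau> \<omega>" and xF: "frobE \<Gamma> q x = x" by auto
    show "act \<Gamma> (ginv \<Gamma> G) (act \<Gamma> G x) = x" by (rule act_ginv_cancel(1)[OF G SW_Esp[OF xS]])
    show "act \<Gamma> G x \<in> ?A (act \<Gamma> g z1) (act \<Gamma> g' z2)"
      using levi_act[OF G Gv(1) xS] x diagG frobE_act[OF G SW_Esp[OF xS]] \<open>frobG \<Gamma> q G = G\<close> by auto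
    have "x \<in> EF \<Gamma> J q (dplus \<tau> \<omega>)" using xS xF by (simp add: EF_def SW_iff)
    then show "f (act \<Gamma> G x) = f x" using f GGF by (simp add: Hsp_def)
  next
    fix x assume x: "x \<in> ?A (act \<Gamma> g z1) (act \<Gamma> g' z2)"
    then have xS: "x \<in> SW \<Gamma> J \<tau> \<omega>" and xF: "frobE \<Gamma> q x = x" by auto
    show c: "act \<Gamma> G (act \<Gamma> (ginv \<Gamma> G) x) = x" by (rule act_ginv_cancel(2)[OF G SW_Esp[OF xS]])
    let ?u = "act \<Gamma> (ginv \<Gamma> G) x"
    have uS: "?u \<in> SW \<Gamma> J \<tau> \<omega>" by (rule levi_act(1)[OF ginv_Grp[OF G] Gi xS])
    have uT: "xT \<Gamma> \<tau> ?u \<in> Esp \<Gamma> {} \<tau>" "xW \<Gamma> \<tau> \<omega> ?u \<in> Esp \<Gamma> {} \<omega>"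
      by (auto intro!: EspI simp: xT_def xW_def diag_dims)
    have "act \<Gamma> g (xT \<Gamma> \<tau> ?u) = act \<Gamma> g z1" "act \<Gamma> g' (xW \<Gamma> \<tau> \<omega> ?u) = act \<Gamma> g' z2"
      using levi_act(2,3)[OF G Gv(1) uS] c x diagG by auto
    then have "xT \<Gamma> \<tau> ?u = z1" "xW \<Gamma> \<tau> \<omega> ?u = z2"
      using act_ginv_cancel(1)[OF gG(1) uT(1)] act_ginv_cancel(1)[OF gG(1) z0(1)]
        act_ginv_cancel(1)[OF gG(2) uT(2)] act_ginv_cancel(1)[OF gG(2) z0(2)] by metis+
    moreover have "frobE \<Gamma> q ?u = ?u"
    proof -
      have fu: "frobE \<Gamma> q ?u \<in> Esp \<Gamma> {} (dplus \<tau> \<omega>)"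
        using frobE_SW[OF Esp_ext[OF SW_Esp[OF uS]] J, of \<tau> \<omega>] uS SW_Esp by blast
      have "act \<Gamma> G (frobE \<Gamma> q ?u) = act \<Gamma> G ?u"
        using frobE_act[OF G SW_Esp[OF uS]] c xF \<open>frobG \<Gamma> q G = G\<close> by simp
      then show ?thesis using act_ginv_cancel(1)[OF G fu] act_ginv_cancel(1)[OF G SW_Esp[OF uS]] by metis
    qed
    ultimately show "?u \<in> ?A z1 z2" using uS by simp
  qed
  then show ?thesis by (simp add: Res_eq)
qed

lemma one_GF: "(\<lambda>v\<in>verts \<Gamma>. 1\<^sub>m (vd \<nu> v) :: 'k mat) \<in> GF \<Gamma> q \<nu>"
  using vaut_in vdim_vaut by (auto simp: GF_fixed_families fixed_families_def invertible_one fr_one)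

lemma act_one:
  fixes x :: "('h, 'k) rep"
  assumes "x \<in> Esp \<Gamma> {} \<nu>"
  shows "act \<Gamma> (\<lambda>v\<in>verts \<Gamma>. 1\<^sub>m (vd \<nu> v)) x = x"
  by (rule extensionalityI[OF act_ext Esp_ext[OF assms]])
    (use EspD[OF assms] arrD in \<open>auto simp: act_app invertible_one mat_one_mult\<close>)

text \<open>
  This is why \<open>Res f\<close> vanishes off the rational points of the open parts.
\<close>

lemma kappa_EF:
  fixes x :: "('h, 'k) rep"
  assumes x: "x \<in> SW \<Gamma> J \<tau> \<omega>" "frobE \<Gamma> q x = x"
    and sq: "\<And>h. h \<in> J \<Longrightarrow> vd \<tau> (src \<Gamma> h) = vd \<tau> (tgt \<Gamma> h)"
      "\<And>h. h \<in> J \<Longrightarrow> vd \<omega> (src \<Gamma> h) = vd \<omega> (tgt \<Gamma> h)"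
  shows "xT \<Gamma> \<tau> x \<in> EF \<Gamma> J q \<tau>" "xW \<Gamma> \<tau> \<omega> x \<in> EF \<Gamma> J q \<omega>"
proof -
  have x0: "x \<in> SW \<Gamma> {} \<tau> \<omega>" using x(1) by (auto simp: SW_iff Esp_open_subset[of _ _ J])
  show "xT \<Gamma> \<tau> x \<in> EF \<Gamma> J q \<tau>" "xW \<Gamma> \<tau> \<omega> x \<in> EF \<Gamma> J q \<omega>"
    using xT_xW_Esp[OF admissible_graph_axioms x0 J(2) sq] frobE_xT[OF SW_Esp[OF x0]] x by (auto simp: EF_def)
qed

lemma Res_decomposition:
  fixes f :: "('h, 'k) rep \<Rightarrow> complex"
  assumes f: "f \<in> Hsp \<Gamma> J q s (dplus \<tau> \<omega>)"
    and sq: "\<And>h. h \<in> J \<Longrightarrow> vd \<tau> (src \<Gamma> h) = vd \<tau> (tgt \<Gamma> h)"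
      "\<And>h. h \<in> J \<Longrightarrow> vd \<omega> (src \<Gamma> h) = vd \<omega> (tgt \<Gamma> h)"
  shows "\<exists>(N::nat) u v. (\<forall>k<N. u k \<in> Hsp \<Gamma> J q s \<tau> \<and> v k \<in> Hsp \<Gamma> J q s \<omega>) \<and>
     Res \<Gamma> J q s \<tau> \<omega> f = (\<lambda>z. \<Sum>k<N. tens (u k) (v k) z)"
proof (rule tensor_decomposition)
  show "Res \<Gamma> J q s \<tau> \<omega> f z \<in> Qadj s" for z
    using f by (cases z) (auto simp: Res_eq Hsp_def intro!: Qadj.mult Qadj_powi Qadj_sum)
next
  fix x y :: "('h, 'k) rep" assume "Res \<Gamma> J q s \<tau> \<omega> f (x, y) \<noteq> 0"
  then have "{u \<in> SW \<Gamma> J \<tau> \<omega>. frobE \<Gamma> q u = u \<and> xT \<Gamma> \<tau> u = x \<and> xW \<Gamma> \<tau> \<omega> u = y} \<noteq> {}"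
    unfolding Res_eq by (metis mult_zero_right sum.empty)
  then show "x \<in> EF \<Gamma> J q \<tau> \<and> y \<in> EF \<Gamma> J q \<omega>" using kappa_EF sq by blast
next
  fix g and x y :: "('h, 'k) rep" assume z: "x \<in> EF \<Gamma> J q \<tau>" "y \<in> EF \<Gamma> J q \<omega>"
  have z0: "x \<in> Esp \<Gamma> {} \<tau>" "y \<in> Esp \<Gamma> {} \<omega>" using z by (auto simp: EF_def Esp_open_subset[of _ _ J])
  show "Res \<Gamma> J q s \<tau> \<omega> f (act \<Gamma> g x, y) = Res \<Gamma> J q s \<tau> \<omega> f (x, y)" if "g \<in> GF \<Gamma> q \<tau>"
    using Res_invariant[OF f that one_GF z] act_one[OF z0(2)] by simp
  show "Res \<Gamma> J q s \<tau> \<omega> f (x, act \<Gamma> g y) = Res \<Gamma> J q s \<tau> \<omega> f (x, y)" if "g \<in> GF \<Gamma> q \<omega>"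
    using Res_invariant[OF f one_GF that z] act_one[OF z0(1)] by simp
qed

end

section \<open>Contraction and restriction\<close>

context contraction
begin

sublocale full: hall_space \<Gamma> q K "{}"
  by unfold_locales auto

text \<open>
  The contracted arrows correspond to their sources, which form one orbit.
\<close>

lemma pm_transitive:
  assumes "h0 \<in> pm" "h \<in> pm"
  shows "\<exists>k. (haut \<Gamma> ^^ k) h0 = h"
proof -
  have k: "(haut \<Gamma> ^^ k) h0 \<in> pm \<and> src \<Gamma> ((haut \<Gamma> ^^ k) h0) = (vaut \<Gamma> ^^ k) (src \<Gamma> h0)" for k
  proof (induction k)
    case (Suc k)
    then show ?case using haut_in_pm pm_arrs arrD(4) by (auto simp: subset_eq)
  qed (use assms in auto)
  have "vorbit \<Gamma> (src \<Gamma> h0) = ip" "src \<Gamma> h \<in> ip"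
    using orbit_of[OF orbits(1)] pmD[OF assms(1)] pmD[OF assms(2)] by auto
  then obtain n where "src \<Gamma> h = (vaut \<Gamma> ^^ n) (src \<Gamma> h0)"
    by (auto simp: vorbit_def orbit_altdef)
  then have "src \<Gamma> h = src \<Gamma> ((haut \<Gamma> ^^ n) h0)" using k by simp
  then have "h = (haut \<Gamma> ^^ n) h0"
    using pm_bij(1) k[of n] assms(2) by (auto simp: bij_betw_def inj_on_def)
  then show ?thesis by auto
qed

end

context contraction_pair
begin

text \<open>
  The possible lower left blocks of a rational representation on the contracted arrows.
\<close>

abbreviation corners :: "('h \<Rightarrow> 'k mat) set" where
  "corners \<equiv> fixed_families pm (haut \<Gamma>) (\<lambda>_. \<omega> im) (\<lambda>_. \<tau> im)"

lemma card_corners: "card corners = q ^ (card im * (\<tau> im * \<omega> im))"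
proof -
  obtain h0 where h0: "h0 \<in> pm" using card_pm by (metis card.empty ex_in_conv less_nat_zero_code)
  show ?thesis
    using card_fixed_families[OF finite_pm haut_bij_pm h0 pm_transitive[OF h0], of "\<omega> im" "\<tau> im"]
    by (simp add: card_pm mult.commute)
qed

text \<open>
  On a contracted arrow the diagonal blocks of \<open>x\<close> are prescribed by \<open>z1\<close> and \<open>z2\<close>, and only the lower
  left block is free. It and \<open>\<mu> x\<close> together determine \<open>x\<close>.
\<close>

lemma restriction_fibre_bij:
  fixes z1 z2 :: "('h, 'k) rep"
  assumes z1: "z1 \<in> EF \<Gamma> pm q \<tau>" and z2: "z2 \<in> EF \<Gamma> pm q \<omega>"
  shows "bij_betw (\<lambda>x. (\<mu> x, \<lambda>h\<in>pm. lowerleft (\<tau> im) (\<omega> im) (\<tau> im) (x h)))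
    {x \<in> SW \<Gamma> pm \<tau> \<omega>. frobE \<Gamma> q x = x \<and> xT \<Gamma> \<tau> x = z1 \<and> xW \<Gamma> \<tau> \<omega> x = z2}
    ({u \<in> SW \<Delta> {} \<tau> \<omega>. frobE \<Delta> q u = u \<and> xT \<Delta> \<tau> u = \<mu> z1 \<and> xW \<Delta> \<tau> \<omega> u = \<mu> z2} \<times> corners)"
    (is "bij_betw ?f ?A (?B \<times> corners)")
proof -
  let ?\<nu> = "dplus \<tau> \<omega>"
  have z1E: "z1 \<in> Esp \<Gamma> pm \<tau>" "frobE \<Gamma> q z1 = z1" and z2E: "z2 \<in> Esp \<Gamma> pm \<omega>" "frobE \<Gamma> q z2 = z2"
    using z1 z2 by (auto simp: EF_def)
  define b where "b c h = block_lower (z1 h) (c h) (z2 h)" for c h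
  note v\<tau> = vdim_pm[where \<nu>=\<tau>, OF \<tau>] and v\<omega> = vdim_pm[where \<nu>=\<omega>, OF \<omega>]
  have bl: "low (\<tau> im) (\<tau> im) (b c h)" "diagT (\<tau> im) (\<tau> im) (b c h) = z1 h"
      "diagW (\<tau> im) (\<omega> im) (\<tau> im) (\<omega> im) (b c h) = z2 h" "lowerleft (\<tau> im) (\<omega> im) (\<tau> im) (b c h) = c h"
      "dim_row (b c h) = ?\<nu> im" "invertible_mat (b c h)"
    if h: "h \<in> pm" and c: "dim_row (c h) = \<omega> im" "dim_col (c h) = \<tau> im" for c h
  proof -
    note d = Esp_pmD[OF \<tau> z1E(1) h] Esp_pmD[OF \<omega> z2E(1) h]
    show *: "low (\<tau> im) (\<tau> im) (b c h)" "diagT (\<tau> im) (\<tau> im) (b c h) = z1 h"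
      "diagW (\<tau> im) (\<omega> im) (\<tau> im) (\<omega> im) (b c h) = z2 h" "lowerleft (\<tau> im) (\<omega> im) (\<tau> im) (b c h) = c h"
      unfolding b_def using low_block_lower[of "z1 h" "\<tau> im" "\<tau> im" "z2 h" "\<omega> im" "\<omega> im" "c h"] d c by simp_all
    show "dim_row (b c h) = ?\<nu> im" using d by (simp add: b_def dplus_def)
    show "invertible_mat (b c h)"
      using low_invertible_iff[OF *(1), of "\<omega> im"] d * by (simp add: b_def)
  qed
  have lift_props: "lift ?\<nu> u (b c) \<in> Esp \<Gamma> pm ?\<nu>" "\<mu> (lift ?\<nu> u (b c)) = u"
    if "u \<in> Esp \<Delta> {} ?\<nu>" "c \<in> corners" for u c
    using lift[OF \<tau>\<omega> that(1), of "b c"] bl(5,6)[of _ c] that(2) by (auto simp: fixed_families_def PiE_iff)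
  have B_E: "u \<in> Esp \<Delta> {} ?\<nu>" if "u \<in> ?B" for u using that SW_Esp by blast
  show ?thesis
  proof (rule bij_betwI[where g="\<lambda>(u, c). lift ?\<nu> u (b c)"])
    show "?f \<in> ?A \<rightarrow> ?B \<times> corners"
    proof (rule Pi_I)
      fix x assume x: "x \<in> ?A"
      then have xS: "x \<in> SW \<Gamma> pm \<tau> \<omega>" and xF: "frobE \<Gamma> q x = x" by auto
      have xE: "x \<in> Esp \<Gamma> pm ?\<nu>" using SW_heart[OF xS] by simp
      have "\<mu> x \<in> ?B"
        using mu_SW_imp[OF xS] mu_frob[OF \<tau>\<omega> xE] mu_xT_xW[OF xS] x by auto
      moreover have "x (haut \<Gamma> h) = fr (x h)" if "h \<in> pm" for h
        using frobE_haut[of h x] xF that pm_arrs by auto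
      then have "(\<lambda>h\<in>pm. lowerleft (\<tau> im) (\<omega> im) (\<tau> im) (x h)) \<in> corners"
        using Esp_pmD[OF \<tau>\<omega> xE] haut_in_pm pm_arrs
        by (auto simp: fixed_families_def diag_fr dplus_def subset_eq) (simp_all add: lowerleft_def)
      ultimately show "?f x \<in> ?B \<times> corners" by simp
    qed
    show "(\<lambda>(u, c). lift ?\<nu> u (b c)) \<in> ?B \<times> corners \<rightarrow> ?A"
    proof (rule Pi_I)
      fix uc assume "uc \<in> ?B \<times> corners"
      then obtain u c where uc: "uc = (u, c)" "u \<in> ?B" "c \<in> corners" by auto
      have c: "dim_row (c h) = \<omega> im" "dim_col (c h) = \<tau> im" "c (haut \<Gamma> h) = fr (c h)" if "h \<in> pm" for h
        using uc(3) that by (auto simp: fixed_families_def PiE_iff)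
      define x where "x = lift ?\<nu> u (b c)"
      have x: "x \<in> Esp \<Gamma> pm ?\<nu>" "\<mu> x = u" using lift_props[OF B_E[OF uc(2)] uc(3)] by (auto simp: x_def)
      have xpm: "x h = b c h" if "h \<in> pm" for h using lift_pm[OF that] by (simp add: x_def)
      have xS: "x \<in> SW \<Gamma> pm \<tau> \<omega>"
        using mu_SW[OF x(1)] x(2) uc(2) xpm bl(1)[OF _ c(1,2)] by (simp add: v\<tau>)
      have "frobE \<Gamma> q x = x"
      proof (rule mu_inj[OF \<tau>\<omega> _ x(1)])
        show "frobE \<Gamma> q x \<in> Esp \<Gamma> pm ?\<nu>" using frobE_Esp[OF Esp_ext[OF x(1)] haut_pm pm_arrs] x(1) by simp
        show "\<mu> (frobE \<Gamma> q x) = \<mu> x" using mu_frob[OF \<tau>\<omega> x(1)] x(2) uc(2) by simp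
        show "frobE \<Gamma> q x h = x h" if h: "h \<in> pm" for h
        proof -
          obtain h' where h': "h' \<in> pm" "h = haut \<Gamma> h'" using haut_pm h by blast
          have "h' \<in> arrs \<Gamma>" using h' pm_arrs by auto
          then have "frobE \<Gamma> q x h = fr (b c h')" using frobE_haut xpm[OF h'(1)] h'(2) by simp
          also have "\<dots> = block_lower (fr (z1 h')) (fr (c h')) (fr (z2 h'))"
            unfolding b_def using Esp_pmD[OF \<tau> z1E(1) h'(1)] Esp_pmD[OF \<omega> z2E(1) h'(1)] c[OF h'(1)]
            by (intro heart.fr_block_lower[where t'="\<tau> im" and w'="\<omega> im" and t="\<tau> im" and w="\<omega> im"]) simp_all
          also have "\<dots> = b c h"
            using frobE_haut[OF \<open>h' \<in> arrs \<Gamma>\<close>, of z1] frobE_haut[OF \<open>h' \<in> arrs \<Gamma>\<close>, of z2] z1E(2) z2E(2) c(3)[OF h'(1)] h'(2)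
            by (simp add: b_def)
          finally show ?thesis using xpm[OF h] by simp
        qed
      qed
      moreover have T: "xT \<Gamma> \<tau> x \<in> Esp \<Gamma> pm \<tau>" "xW \<Gamma> \<tau> \<omega> x \<in> Esp \<Gamma> pm \<omega>"
        using xT_xW_heart SW_heart[OF xS] xS by auto
      have "xT \<Gamma> \<tau> x = z1"
        by (rule mu_inj[OF \<tau> T(1) z1E(1)])
          (use mu_xT_xW[OF xS] x(2) uc(2) xpm bl(2)[OF _ c(1,2)] pm_arrs in \<open>auto simp: xT_def v\<tau> subset_eq\<close>)
      moreover have "xW \<Gamma> \<tau> \<omega> x = z2"
        by (rule mu_inj[OF \<omega> T(2) z2E(1)])
          (use mu_xT_xW[OF xS] x(2) uc(2) xpm bl(3)[OF _ c(1,2)] pm_arrs in \<open>auto simp: xW_def v\<tau> v\<omega> subset_eq\<close>)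
      ultimately show "(case uc of (u, c) \<Rightarrow> lift ?\<nu> u (b c)) \<in> ?A" using xS uc(1) by (simp add: x_def)
    qed
    show "(case ?f x of (u, c) \<Rightarrow> lift ?\<nu> u (b c)) = x" if x: "x \<in> ?A" for x
    proof -
      have xS: "x \<in> SW \<Gamma> pm \<tau> \<omega>" using x by auto
      have xE: "x \<in> Esp \<Gamma> pm ?\<nu>" using SW_heart[OF xS] by simp
      let ?c = "\<lambda>h\<in>pm. lowerleft (\<tau> im) (\<omega> im) (\<tau> im) (x h)"
      have c: "dim_row (?c h) = \<omega> im \<and> dim_col (?c h) = \<tau> im" if "h \<in> pm" for h using that by (simp add: diag_dims)
      have l: "lift ?\<nu> (\<mu> x) (b ?c) \<in> Esp \<Gamma> pm ?\<nu>" "\<mu> (lift ?\<nu> (\<mu> x) (b ?c)) = \<mu> x"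
        using lift[OF \<tau>\<omega> mu_Esp[OF \<tau>\<omega> xE], of "b ?c"] bl(5,6)[of _ ?c] c by auto
      have "lift ?\<nu> (\<mu> x) (b ?c) = x"
      proof (rule mu_inj[OF \<tau>\<omega> l(1) xE l(2)])
        fix h assume h: "h \<in> pm"
        have "low (\<tau> im) (\<tau> im) (x h)" using SW_low[OF xS, of h] h pm_arrs v\<tau>[OF h] by auto
        then have "x h = block_lower (diagT (\<tau> im) (\<tau> im) (x h)) (lowerleft (\<tau> im) (\<omega> im) (\<tau> im) (x h)) (diagW (\<tau> im) (\<omega> im) (\<tau> im) (\<omega> im) (x h))"
          by (rule low_eq_block_lower) (use Esp_pmD[OF \<tau>\<omega> xE h] in \<open>auto simp: dplus_def\<close>)
        moreover have "z1 h = diagT (\<tau> im) (\<tau> im) (x h)" "z2 h = diagW (\<tau> im) (\<omega> im) (\<tau> im) (\<omega> im) (x h)"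
          using x h pm_arrs v\<tau>[OF h] v\<omega>[OF h] by (auto simp: xT_def xW_def subset_eq)
        ultimately show "lift ?\<nu> (\<mu> x) (b ?c) h = x h"
          using h by (simp add: lift_pm b_def)
      qed
      then show ?thesis by simp
    qed
    show "?f (case uc of (u, c) \<Rightarrow> lift ?\<nu> u (b c)) = uc" if uc0: "uc \<in> ?B \<times> corners" for uc
    proof -
      obtain u c where uc: "uc = (u, c)" "u \<in> ?B" "c \<in> corners" using uc0 by auto
      have c: "dim_row (c h) = \<omega> im" "dim_col (c h) = \<tau> im" if "h \<in> pm" for h
        using uc(3) that by (auto simp: fixed_families_def PiE_iff)
      have "(\<lambda>h\<in>pm. lowerleft (\<tau> im) (\<omega> im) (\<tau> im) (lift ?\<nu> u (b c) h)) = c"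
        using uc(3) bl(4)[OF _ c] by (intro extensionalityI[of _ pm]) (auto simp: lift_pm fixed_families_def PiE_iff)
      then show ?thesis using lift_props(2)[OF B_E[OF uc(2)] uc(3)] uc(1) by simp
    qed
  qed
qed

text \<open>
  By \<open>card_corners\<close> the fibres differ in size by the factor $q^{\#i_-\tau_{i_-}\omega_{i_-}}$, the power
  of \<open>s\<close> with exponent $2\#i_-\tau_{i_-}\omega_{i_-}$.
\<close>

lemma Res_mu_star:
  fixes z1 z2 :: "('h, 'k) rep"
  assumes s: "s\<^sup>2 = of_nat q"
  shows "Res \<Gamma> pm q s \<tau> \<omega> (mu_star_nu \<Gamma> ip im q s (dplus \<tau> \<omega>) f) (z1, z2) =
    (if z1 \<in> EF \<Gamma> pm q \<tau> then s powi (- (((int (\<tau> im))\<^sup>2 * cartan \<Gamma> im im) div 2)) else 0) *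
    (if z2 \<in> EF \<Gamma> pm q \<omega> then s powi (- (((int (\<omega> im))\<^sup>2 * cartan \<Gamma> im im) div 2)) else 0) *
    Res \<Delta> {} q s \<tau> \<omega> f (\<mu> z1, \<mu> z2)"
proof -
  have s0: "s \<noteq> 0" using s q_pos by auto
  let ?A = "{x \<in> SW \<Gamma> pm \<tau> \<omega>. frobE \<Gamma> q x = x \<and> xT \<Gamma> \<tau> x = z1 \<and> xW \<Gamma> \<tau> \<omega> x = z2}"
  let ?B = "{u \<in> SW \<Delta> {} \<tau> \<omega>. frobE \<Delta> q u = u \<and> xT \<Delta> \<tau> u = \<mu> z1 \<and> xW \<Delta> \<tau> \<omega> u = \<mu> z2}"
  let ?e = "\<lambda>n. int (card im) * (int n)\<^sup>2"
  show ?thesis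
  proof (cases "z1 \<in> EF \<Gamma> pm q \<tau> \<and> z2 \<in> EF \<Gamma> pm q \<omega>")
    case False
    have "?A = {}" using False heart.kappa_EF[where \<tau>=\<tau> and \<omega>=\<omega>] by (auto simp: vdim_pm \<tau> \<omega>)
    then have "Res \<Gamma> pm q s \<tau> \<omega> (mu_star_nu \<Gamma> ip im q s (dplus \<tau> \<omega>) f) (z1, z2) = 0"
      unfolding heart.Res_eq by (simp only: sum.empty mult_zero_right)
    then show ?thesis using False by auto
  next
    case True
    have "(\<Sum>x\<in>?A. mu_star_nu \<Gamma> ip im q s (dplus \<tau> \<omega>) f x) = (\<Sum>x\<in>?A. s powi (- ?e (dplus \<tau> \<omega> im)) * f (\<mu> x))"
      by (rule sum.cong) (auto simp: mu_star_nu_def EF_def SW_iff pull_def mu_star_exponent)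
    also have "\<dots> = s powi (- ?e (dplus \<tau> \<omega> im)) * (\<Sum>x\<in>?A. f (\<mu> x))" by (simp add: sum_distrib_left)
    also have "(\<Sum>x\<in>?A. f (\<mu> x)) = (\<Sum>(u, c)\<in>?B \<times> corners. f u)"
      using sum.reindex_bij_betw[OF restriction_fibre_bij, of z1 z2 "\<lambda>(u, c). f u"] True by simp
    also have "\<dots> = of_nat (card corners) * (\<Sum>u\<in>?B. f u)"
      by (simp add: sum.cartesian_product[symmetric] sum_distrib_left)
    also have "of_nat (card corners) = s powi (2 * (int (card im) * (int (\<tau> im) * int (\<omega> im))))"
    proof -
      have "of_nat (card corners) = (s\<^sup>2) ^ (card im * (\<tau> im * \<omega> im))" by (simp add: card_corners s)
      also have "\<dots> = s ^ (2 * (card im * (\<tau> im * \<omega> im)))" by (simp add: power_mult)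
      also have "\<dots> = s powi (int (2 * (card im * (\<tau> im * \<omega> im))))" by (simp only: power_int_of_nat)
      finally show ?thesis by simp
    qed
    finally have "(\<Sum>x\<in>?A. mu_star_nu \<Gamma> ip im q s (dplus \<tau> \<omega>) f x) =
        (s powi (- ?e (dplus \<tau> \<omega> im)) * s powi (2 * (int (card im) * (int (\<tau> im) * int (\<omega> im))))) * (\<Sum>u\<in>?B. f u)"
      by simp
    also have "s powi (- ?e (dplus \<tau> \<omega> im)) * s powi (2 * (int (card im) * (int (\<tau> im) * int (\<omega> im)))) =
        s powi (- ?e (dplus \<tau> \<omega> im) + 2 * (int (card im) * (int (\<tau> im) * int (\<omega> im))))"
      using s0 by (intro power_int_add[symmetric]) simp
    also have "- ?e (dplus \<tau> \<omega> im) + 2 * (int (card im) * (int (\<tau> im) * int (\<omega> im))) = - ?e (\<tau> im) + - ?e (\<omega> im)"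
      by (simp add: dplus_def power2_eq_square algebra_simps)
    also have "s powi (- ?e (\<tau> im) + - ?e (\<omega> im)) = s powi (- ?e (\<tau> im)) * s powi (- ?e (\<omega> im))"
      using s0 by (intro power_int_add) simp
    finally show ?thesis
      using True unfolding heart.Res_eq con.Res_eq mOm_contract(2) mu_star_exponent by simp
  qed
qed

section \<open>Extension by zero\<close>

lemma reps_over_heart:
  fixes y :: "('h, 'k) rep"
  assumes "y \<in> Esp \<Gamma> pm (dplus \<tau> \<omega>)"
  shows "reps_over \<Gamma> {} \<tau> \<omega> y = reps y"
proof -
  have "x \<in> SW \<Gamma> pm \<tau> \<omega>" if "g \<in> Grp \<Gamma> (dplus \<tau> \<omega>)" "x \<in> SW \<Gamma> {} \<tau> \<omega>" "act \<Gamma> g x = y" for g x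
    using act_Esp[OF that(1) SW_Esp[OF that(2)] pm_arrs] that assms by (auto simp: SW_iff)
  then show ?thesis using SW_heart by (auto simp: reps_over_def)
qed

text \<open>
  Over a point of the open part both inductions run over the same classes. Over any other point \<open>y\<close>
  each term vanishes, for if both diagonal parts of \<open>x\<close> were in the open parts, then \<open>x\<close> would be in
  the open part, and so would \<open>y\<close>.
\<close>

lemma j_shriek_Ind:
  fixes F G :: "('h, 'k) rep \<Rightarrow> complex"
  assumes F: "\<And>x. x \<notin> EF \<Gamma> pm q \<tau> \<Longrightarrow> F x = 0" and G: "\<And>x. x \<notin> EF \<Gamma> pm q \<omega> \<Longrightarrow> G x = 0"
  shows "j_shriek_nu \<Gamma> ip im q (dplus \<tau> \<omega>) (Ind \<Gamma> pm q s \<tau> \<omega> (tens F G)) = Ind \<Gamma> {} q s \<tau> \<omega> (tens F G)"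
proof
  fix y :: "('h, 'k) rep"
  consider (heart) "y \<in> EF \<Gamma> pm q (dplus \<tau> \<omega>)" | (out) "y \<notin> EF \<Gamma> {} q (dplus \<tau> \<omega>)"
    | (rest) "y \<in> EF \<Gamma> {} q (dplus \<tau> \<omega>)" "y \<notin> EF \<Gamma> pm q (dplus \<tau> \<omega>)" by blast
  then show "j_shriek_nu \<Gamma> ip im q (dplus \<tau> \<omega>) (Ind \<Gamma> pm q s \<tau> \<omega> (tens F G)) y = Ind \<Gamma> {} q s \<tau> \<omega> (tens F G) y"
  proof cases
    case heart
    then have y0: "y \<in> EF \<Gamma> {} q (dplus \<tau> \<omega>)" and yE: "y \<in> Esp \<Gamma> pm (dplus \<tau> \<omega>)"
      by (auto simp: EF_def Esp_open_subset[of _ _ pm])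
    have c: "coset_rel \<Gamma> {} \<tau> \<omega> b y = eqv b y" for b
      by (simp add: coset_rel_def reps_over_heart[OF yE])
    have r: "rational \<Gamma> {} q \<tau> \<omega> b y = rat b y" for b
      by (simp add: rational_def c reps_over_heart[OF yE])
    show ?thesis using heart by (simp add: j_shriek_nu_def heart.Ind_eq[OF heart] full.Ind_eq[OF y0] c r)
  next
    case out
    then have "y \<notin> EF \<Gamma> pm q (dplus \<tau> \<omega>)" by (auto simp: EF_def Esp_open_subset[of _ _ pm])
    then show ?thesis using out by (simp add: j_shriek_nu_def full.Ind_eq_0)
  next
    case rest
    have "tens F G (p1 \<Gamma> \<tau> \<omega> C) = 0" if C: "C \<in> rational \<Gamma> {} q \<tau> \<omega> True y // coset_rel \<Gamma> {} \<tau> \<omega> True y" for C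
    proof (rule ccontr)
      assume nz: "tens F G (p1 \<Gamma> \<tau> \<omega> C) \<noteq> 0"
      obtain g x where gx: "C = coset_rel \<Gamma> {} \<tau> \<omega> True y `` {(g, x)}" "(g, x) \<in> reps_over \<Gamma> {} \<tau> \<omega> y"
        using C by (auto elim!: quotientE simp: rational_def)
      note o = reps_overD[OF gx(2)]
      have "xT \<Gamma> \<tau> x \<in> EF \<Gamma> pm q \<tau>" "xW \<Gamma> \<tau> \<omega> x \<in> EF \<Gamma> pm q \<omega>"
        using nz F G unfolding gx(1) p1_class[OF gx(2)] by (auto simp: tens_def)
      then have "x \<in> Esp \<Gamma> pm (dplus \<tau> \<omega>)"
        using xT_xW_heart[OF o(2)] by (auto simp: EF_def SW_iff)
      then have "y \<in> Esp \<Gamma> pm (dplus \<tau> \<omega>)" using act_Esp[OF o(1,4) pm_arrs] o(3) by simp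
      then show False using rest by (auto simp: EF_def)
    qed
    then have "Ind \<Gamma> {} q s \<tau> \<omega> (tens F G) y = 0"
      unfolding full.Ind_eq[OF rest(1)] by (intro mult_zero_right[THEN trans[rotated]] arg_cong[of _ _ "(*) _"] sum.neutral ballI) auto
    then show ?thesis using rest(2) by (simp add: j_shriek_nu_def)
  qed
qed

lemma Res_j_shriek:
  fixes z1 z2 :: "('h, 'k) rep"
  shows "Res \<Gamma> {} q s \<tau> \<omega> (j_shriek_nu \<Gamma> ip im q (dplus \<tau> \<omega>) f) (z1, z2) =
    (if z1 \<in> EF \<Gamma> pm q \<tau> then 1 else 0) * (if z2 \<in> EF \<Gamma> pm q \<omega> then 1 else 0) * Res \<Gamma> pm q s \<tau> \<omega> f (z1, z2)"
proof (cases "z1 \<in> EF \<Gamma> pm q \<tau> \<and> z2 \<in> EF \<Gamma> pm q \<omega>")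
  case True
  have *: "x \<in> SW \<Gamma> {} \<tau> \<omega> \<longleftrightarrow> x \<in> SW \<Gamma> pm \<tau> \<omega>" if "xT \<Gamma> \<tau> x = z1" "xW \<Gamma> \<tau> \<omega> x = z2" for x
    using xT_xW_heart[of x] SW_heart[of x] that True by (auto simp: EF_def)
  have "(\<Sum>x\<in>{x \<in> SW \<Gamma> {} \<tau> \<omega>. frobE \<Gamma> q x = x \<and> xT \<Gamma> \<tau> x = z1 \<and> xW \<Gamma> \<tau> \<omega> x = z2}. j_shriek_nu \<Gamma> ip im q (dplus \<tau> \<omega>) f x) =
    (\<Sum>x\<in>{x \<in> SW \<Gamma> pm \<tau> \<omega>. frobE \<Gamma> q x = x \<and> xT \<Gamma> \<tau> x = z1 \<and> xW \<Gamma> \<tau> \<omega> x = z2}. f x)"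
    by (rule sum.cong) (use * SW_heart in \<open>auto simp: j_shriek_nu_def EF_def\<close>)
  then show ?thesis using True by (simp add: heart.Res_eq full.Res_eq)
next
  case False
  have "j_shriek_nu \<Gamma> ip im q (dplus \<tau> \<omega>) f x = 0"
    if x: "x \<in> SW \<Gamma> {} \<tau> \<omega>" "frobE \<Gamma> q x = x" "xT \<Gamma> \<tau> x = z1" "xW \<Gamma> \<tau> \<omega> x = z2" for x
  proof -
    have "x \<notin> SW \<Gamma> pm \<tau> \<omega>"
      using heart.kappa_EF[of x \<tau> \<omega>] x False by (auto simp: vdim_pm \<tau> \<omega>)
    then show ?thesis using x(1) by (auto simp: j_shriek_nu_def EF_def SW_iff)
  qed
  then have "(\<Sum>x\<in>{x \<in> SW \<Gamma> {} \<tau> \<omega>. frobE \<Gamma> q x = x \<and> xT \<Gamma> \<tau> x = z1 \<and> xW \<Gamma> \<tau> \<omega> x = z2}. j_shriek_nu \<Gamma> ip im q (dplus \<tau> \<omega>) f x) = 0"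
    by (intro sum.neutral) auto
  then show ?thesis using False unfolding full.Res_eq by auto
qed

end

section \<open>The algebraic closure of a finite prime field\<close>

text \<open>
  The polynomial $X^N-X$ has derivative $-1$, so it has no multiple roots.
\<close>

lemma card_roots_frobenius:
  assumes N: "1 < N" "of_nat N = (0 :: 'k::alg_closed_field)"
  shows "card {z :: 'k. z ^ N = z} = N"
proof -
  define P :: "'k poly" where "P = monom 1 N - [:0, 1:]"
  have deg: "degree P = N"
    unfolding P_def diff_conv_add_uminus using N by (subst degree_add_eq_left) (auto simp: degree_monom_eq)
  then have P0: "P \<noteq> 0" using N by auto
  obtain A where A: "size A = degree P" "P = smult (lead_coeff P) (\<Prod>x\<in>#A. [:-x, 1:])"
    using alg_closed_imp_factorization[OF P0] by blast
  have roots: "set_mset A = {z. z ^ N = z}"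
  proof -
    have "poly P z = 0 \<longleftrightarrow> z \<in># A" for z
      using P0 by (subst A(2)) (auto simp: poly_prod_mset prod_mset_zero_iff)
    then show ?thesis by (auto simp: P_def poly_monom)
  qed
  have "count A z \<le> 1" for z
  proof (rule ccontr)
    assume "\<not> count A z \<le> 1"
    then have "{#z, z#} \<subseteq># A" by (auto simp: subseteq_mset_def)
    then obtain B where B: "A = {#z, z#} + B" by (auto simp: subset_mset.le_iff_add)
    define R where "R = smult (lead_coeff P) (\<Prod>x\<in>#B. [:-x, 1:])"
    have P: "P = [:-z, 1:] * ([:-z, 1:] * R)"
      by (subst A(2)) (simp add: B R_def)
    have "poly (pderiv P) z = 0"
      unfolding P by (simp only: pderiv_mult poly_add poly_mult) simp
    moreover have "pderiv P = - 1"
      unfolding P_def using N(2) by (simp add: pderiv_diff pderiv_monom pderiv_pCons one_pCons)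
    ultimately show False by simp
  qed
  then have "size A = card (set_mset A)"
    by (subst size_multiset_overloaded_eq) (simp add: sum.cong[of "set_mset A" "set_mset A" "count A" "\<lambda>_. 1"] le_antisym Suc_le_eq)
  then show ?thesis using A(1) deg roots by simp
qed

lemma frobenius_Fbar:
  assumes "0 < e" "q = CARD('p::prime_card) ^ e"
  shows "frobenius TYPE('p Fbar) q"
proof
  have p: "prime CARD('p)" by (rule prime_card)
  then have p1: "1 < CARD('p)" by (rule prime_gt_1_nat)
  show "0 < q" using assms p1 by simp
  show "(a + b) ^ q = a ^ q + b ^ q" for a b :: "'p Fbar"
    using freshmans_dream'[where ?'a="'p Fbar", of q e a b] p assms by simp
  show "\<exists>w. w ^ q = z" for z :: "'p Fbar"
    using nth_root_exists[of q z] \<open>0 < q\<close> by auto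
  show "card {z :: 'p Fbar. z ^ (q ^ n) = z} = q ^ n" if "0 < n" for n
  proof (rule card_roots_frobenius)
    have "1 < q" unfolding assms(2) using p1 assms(1) by (rule one_less_power)
    then show "1 < q ^ n" using that by (rule one_less_power)
    have "CARD('p) dvd q ^ n" using assms that by (simp add: dvd_power_same power_mult[symmetric])
    then show "of_nat (q ^ n) = (0 :: 'p Fbar)"
      by (simp add: of_nat_eq_0_iff_char_dvd del: of_nat_power)
  qed
qed

section \<open>Homomorphisms of Hall algebras\<close>

lemma finite_decompositions:
  assumes "finite (vorbits \<Gamma>)"
  shows "finite {(\<tau>, \<omega>). \<tau> \<in> dimvecs \<Gamma> \<and> \<omega> \<in> dimvecs \<Gamma> \<and> dplus \<tau> \<omega> = \<nu>}"
proof -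
  let ?S = "{f :: _ \<Rightarrow> nat. \<forall>i. (i \<in> vorbits \<Gamma> \<longrightarrow> f i \<in> {..sum \<nu> (vorbits \<Gamma>)}) \<and> (i \<notin> vorbits \<Gamma> \<longrightarrow> f i = 0)}"
  have "\<nu> i \<le> sum \<nu> (vorbits \<Gamma>)" if "i \<in> vorbits \<Gamma>" for i
    by (rule member_le_sum) (use that assms in auto)
  then have "{(\<tau>, \<omega>). \<tau> \<in> dimvecs \<Gamma> \<and> \<omega> \<in> dimvecs \<Gamma> \<and> dplus \<tau> \<omega> = \<nu>} \<subseteq> ?S \<times> ?S"
    by (fastforce simp: dimvecs_def dplus_def)
  moreover have "finite ?S" using assms by (intro finite_set_of_finite_funs) auto
  ultimately show ?thesis by (meson finite_SigmaI finite_subset)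
qed

lemma alg_hom_compose:
  assumes "\<phi> \<in> alg_hom K A B" "\<psi> \<in> alg_hom K B C"
  shows "\<psi> \<circ> \<phi> \<in> alg_hom K A C"
  using assms by (auto simp: alg_hom_def Ring.ring_hom_def Pi_iff)

context contraction
begin

lemma cdimvecsD: "\<nu> \<in> cdimvecs \<Gamma> ip im \<Longrightarrow> \<nu> ip = \<nu> im"
  by (simp add: cdimvecs_def)

lemma contraction_pairI: "\<tau> \<in> cdimvecs \<Gamma> ip im \<Longrightarrow> \<omega> \<in> cdimvecs \<Gamma> ip im \<Longrightarrow> contraction_pair TYPE('k) \<Gamma> q ip im \<tau> \<omega>"
  by unfold_locales (auto dest: cdimvecsD)

lemma forget_GF:
  fixes g :: "'v \<Rightarrow> 'k mat"
  assumes "g \<in> GF \<Gamma> q \<nu>"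
  shows "forget g \<in> GF \<Delta> q \<nu>"
  using assms con.vaut_in by (auto simp: GF_fixed_families con.GF_fixed_families fixed_families_def PiE_iff)

text \<open>
  Identity matrices on the contracted arrows give a rational lift.
\<close>

lemma mu_surj_EF:
  fixes u :: "('h carrow, 'k) rep"
  assumes \<nu>: "\<nu> ip = \<nu> im" and u: "u \<in> EF \<Delta> {} q \<nu>"
  shows "\<exists>x\<in>EF \<Gamma> pm q \<nu>. \<mu> x = u"
proof -
  define x where "x = lift \<nu> u (\<lambda>_. 1\<^sub>m (\<nu> im))"
  have uE: "u \<in> Esp \<Delta> {} \<nu>" "frobE \<Delta> q u = u" using u by (auto simp: EF_def)
  have x: "x \<in> Esp \<Gamma> pm \<nu>" "\<mu> x = u"
    using lift[OF \<nu> uE(1), of "\<lambda>_. 1\<^sub>m (\<nu> im)"] by (auto simp: x_def invertible_one)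
  have "frobE \<Gamma> q x = x"
  proof (rule mu_inj[OF \<nu> _ x(1)])
    show "frobE \<Gamma> q x \<in> Esp \<Gamma> pm \<nu>" using frobE_Esp[OF Esp_ext[OF x(1)] haut_pm pm_arrs] x(1) by simp
    show "\<mu> (frobE \<Gamma> q x) = \<mu> x" using mu_frob[OF \<nu> x(1)] x(2) uE by simp
    show "frobE \<Gamma> q x h = x h" if h: "h \<in> pm" for h
    proof -
      obtain h' where h': "h' \<in> pm" "h = haut \<Gamma> h'" using haut_pm h by blast
      then show ?thesis using frobE_haut[of h' x] pm_arrs h by (auto simp: x_def lift_pm fr_one)
    qed
  qed
  then show ?thesis using x by (auto simp: EF_def)
qed

text \<open>
  Invariance is inherited because \<open>\<mu>\<close> intertwines the actions along the restriction of group elements.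
\<close>

lemma mu_star_Hsp:
  fixes f :: "('h carrow, 'k) rep \<Rightarrow> complex"
  assumes \<nu>: "\<nu> ip = \<nu> im" and f: "f \<in> Hsp \<Delta> {} q s \<nu>"
  shows "(mu_star_nu \<Gamma> ip im q s \<nu> f :: ('h, 'k) rep \<Rightarrow> complex) \<in> Hsp \<Gamma> pm q s \<nu>"
proof -
  have "f (\<mu> (act \<Gamma> g x)) = f (\<mu> x)"
    if g: "g \<in> GF \<Gamma> q \<nu>" and x: "x \<in> EF \<Gamma> pm q \<nu>" for g and x :: "('h, 'k) rep"
  proof -
    have "\<mu> (act \<Gamma> g x) = act \<Delta> (forget g) (\<mu> x)"
      using g x by (intro mu_act[OF \<nu>]) (auto simp: GF_def EF_def)
    then show ?thesis using f forget_GF[OF g] mu_EF[OF \<nu> x] by (simp add: Hsp_def)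
  qed
  then show ?thesis
    using f heart.act_EF
    by (auto simp: Hsp_def mu_star_nu_def pull_def Qadj_0 intro!: Qadj.mult Qadj_powi)
qed

text \<open>
  Functions on the open part are represented by functions that vanish elsewhere, so extension by zero
  does not change the representing function.
\<close>

lemma j_shriek_Hsp:
  fixes f :: "('h, 'k) rep \<Rightarrow> complex"
  assumes f: "f \<in> Hsp \<Gamma> pm q s \<nu>"
  shows "j_shriek_nu \<Gamma> ip im q \<nu> f = f" "f \<in> Hsp \<Gamma> {} q s \<nu>"
proof -
  show "j_shriek_nu \<Gamma> ip im q \<nu> f = f" using f by (auto simp: j_shriek_nu_def Hsp_def)
  have "f (act \<Gamma> g x) = f x" if g: "g \<in> GF \<Gamma> q \<nu>" and x: "x \<in> EF \<Gamma> {} q \<nu>" for g x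
  proof (cases "x \<in> EF \<Gamma> pm q \<nu>")
    case True
    then show ?thesis using f g by (simp add: Hsp_def)
  next
    case False
    have "x \<in> Esp \<Gamma> {} \<nu>" "g \<in> Grp \<Gamma> \<nu>" using g x by (auto simp: GF_def EF_def)
    then have "act \<Gamma> g x \<notin> EF \<Gamma> pm q \<nu>"
      using act_Esp[of g \<nu> x pm] pm_arrs False x by (auto simp: EF_def)
    then show ?thesis using f False by (simp add: Hsp_def)
  qed
  then show "f \<in> Hsp \<Gamma> {} q s \<nu>"
    using f by (auto simp: Hsp_def EF_def Esp_open_subset[of _ _ pm])
qed

lemma mu_star_zero: "mu_star_nu \<Gamma> ip im q s \<nu> (\<lambda>_. 0) = (\<lambda>_. 0)"
  by (auto simp: mu_star_nu_def pull_def)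

lemma j_shriek_zero: "j_shriek_nu \<Gamma> ip im q \<nu> (\<lambda>_. 0) = (\<lambda>_. 0)"
  by (auto simp: j_shriek_nu_def)

lemma mu_star_alg_hom:
  assumes s: "s \<noteq> 0"
  shows "(mu_star \<Gamma> ip im q s :: ('v, 'h carrow, 'k) hall \<Rightarrow> ('v, 'h, 'k) hall)
    \<in> alg_hom (Qadj s) (H_contr \<Gamma> ip im q s) (H_heart \<Gamma> ip im q s)"
proof -
  let ?D = "cdimvecs \<Gamma> ip im"
  let ?m = "mu_star \<Gamma> ip im q s :: ('v, 'h carrow, 'k) hall \<Rightarrow> ('v, 'h, 'k) hall"
  have carrier: "?m f \<in> carrier (H_heart \<Gamma> ip im q s)" if f: "f \<in> carrier (H_contr \<Gamma> ip im q s)" for f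
  proof -
    have "{\<nu>. ?m f \<nu> \<noteq> (\<lambda>_. 0)} \<subseteq> {\<nu>. f \<nu> \<noteq> (\<lambda>_. 0)}"
      by (auto simp: mu_star_def mu_star_zero)
    then show ?thesis
      using f mu_star_Hsp cdimvecsD finite_subset
      by (auto simp: H_contr_def H_heart_def hall_algebra_def mu_star_def mu_star_zero)
  qed
  have mult: "?m (f \<otimes>\<^bsub>H_contr \<Gamma> ip im q s\<^esub> g) = ?m f \<otimes>\<^bsub>H_heart \<Gamma> ip im q s\<^esub> ?m g" for f g
  proof (intro ext)
    fix \<nu> and x :: "('h, 'k) rep"
    let ?S = "{(\<tau>, \<omega>). \<tau> \<in> ?D \<and> \<omega> \<in> ?D \<and> dplus \<tau> \<omega> = \<nu>}"
    have "?m (f \<otimes>\<^bsub>H_contr \<Gamma> ip im q s\<^esub> g) \<nu> x =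
        (\<Sum>(\<tau>, \<omega>)\<in>?S. mu_star_nu \<Gamma> ip im q s \<nu> (Ind \<Delta> {} q s \<tau> \<omega> (tens (f \<tau>) (g \<omega>))) x)"
      by (auto simp: mu_star_def H_contr_def hall_algebra_def mu_star_nu_def pull_def sum_distrib_left case_prod_unfold
          intro!: sum.cong)
    also have "\<dots> = (\<Sum>(\<tau>, \<omega>)\<in>?S. Ind \<Gamma> pm q s \<tau> \<omega> (tens (?m f \<tau>) (?m g \<omega>)) x)"
      using contraction_pair.mu_star_Ind[OF contraction_pairI s] by (auto simp: mu_star_def intro!: sum.cong)
    finally show "?m (f \<otimes>\<^bsub>H_contr \<Gamma> ip im q s\<^esub> g) \<nu> x = (?m f \<otimes>\<^bsub>H_heart \<Gamma> ip im q s\<^esub> ?m g) \<nu> x"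
      by (simp add: H_heart_def hall_algebra_def)
  qed
  have one: "?m \<one>\<^bsub>H_contr \<Gamma> ip im q s\<^esub> = \<one>\<^bsub>H_heart \<Gamma> ip im q s\<^esub>"
  proof (intro ext)
    fix \<nu> and x :: "('h, 'k) rep"
    show "?m \<one>\<^bsub>H_contr \<Gamma> ip im q s\<^esub> \<nu> x = \<one>\<^bsub>H_heart \<Gamma> ip im q s\<^esub> \<nu> x"
      using mu_EF[of "\<lambda>_. 0" x]
      by (cases "\<nu> = (\<lambda>_. 0)") (auto simp: mu_star_def H_contr_def H_heart_def hall_algebra_def mu_star_nu_def pull_def)
  qed
  have add: "?m (f \<oplus>\<^bsub>H_contr \<Gamma> ip im q s\<^esub> g) = ?m f \<oplus>\<^bsub>H_heart \<Gamma> ip im q s\<^esub> ?m g" for f g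
    by (auto simp: mu_star_def H_contr_def H_heart_def hall_algebra_def mu_star_nu_def pull_def fun_eq_iff distrib_left)
  have smult: "?m (c \<odot>\<^bsub>H_contr \<Gamma> ip im q s\<^esub> f) = c \<odot>\<^bsub>H_heart \<Gamma> ip im q s\<^esub> ?m f" for c f
    by (auto simp: mu_star_def H_contr_def H_heart_def hall_algebra_def mu_star_nu_def pull_def fun_eq_iff)
  show ?thesis using carrier mult one add smult by (auto simp: alg_hom_def Ring.ring_hom_def)
qed

text \<open>
  A product in the full algebra has summands for all decompositions of the dimension vector. Those
  that are not made of two vectors with equal entries at $i_+$ and $i_-$ vanish for functions from the
  open part.
\<close>

lemma j_shriek_alg_hom:
  "(j_shriek \<Gamma> ip im q :: ('v, 'h, 'k) hall \<Rightarrow> ('v, 'h, 'k) hall)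
    \<in> alg_hom (Qadj s) (H_heart \<Gamma> ip im q s) (H_full \<Gamma> q s)"
proof -
  let ?D = "cdimvecs \<Gamma> ip im"
  let ?j = "j_shriek \<Gamma> ip im q :: ('v, 'h, 'k) hall \<Rightarrow> ('v, 'h, 'k) hall"
  have D: "?D \<subseteq> dimvecs \<Gamma>" by (auto simp: cdimvecs_def)
  have id: "?j f = f" if f: "f \<in> carrier (H_heart \<Gamma> ip im q s)" for f
  proof
    fix \<nu> show "?j f \<nu> = f \<nu>"
      using f j_shriek_Hsp(1)[of "f \<nu>" s \<nu>]
      by (cases "\<nu> \<in> ?D") (auto simp: H_heart_def hall_algebra_def j_shriek_def j_shriek_zero)
  qed
  have carrier: "?j f \<in> carrier (H_full \<Gamma> q s)" if f: "f \<in> carrier (H_heart \<Gamma> ip im q s)" for f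
  proof -
    have z: "(\<lambda>_. 0) \<in> Hsp \<Gamma> {} q s \<nu>" for \<nu> by (auto simp: Hsp_def Qadj_0)
    have "f \<nu> \<in> Hsp \<Gamma> {} q s \<nu>" for \<nu>
      using f j_shriek_Hsp(2)[of "f \<nu>" s \<nu>] z by (cases "\<nu> \<in> ?D") (auto simp: H_heart_def hall_algebra_def)
    then show ?thesis unfolding id[OF f] using f D by (auto simp: H_heart_def H_full_def hall_algebra_def)
  qed
  have mult: "?j (f \<otimes>\<^bsub>H_heart \<Gamma> ip im q s\<^esub> g) = ?j f \<otimes>\<^bsub>H_full \<Gamma> q s\<^esub> ?j g"
    if f: "f \<in> carrier (H_heart \<Gamma> ip im q s)" and g: "g \<in> carrier (H_heart \<Gamma> ip im q s)" for f g
  proof (intro ext)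
    fix \<nu> and x :: "('h, 'k) rep"
    let ?S = "{(\<tau>, \<omega>). \<tau> \<in> ?D \<and> \<omega> \<in> ?D \<and> dplus \<tau> \<omega> = \<nu>}"
    let ?S' = "{(\<tau>, \<omega>). \<tau> \<in> dimvecs \<Gamma> \<and> \<omega> \<in> dimvecs \<Gamma> \<and> dplus \<tau> \<omega> = \<nu>}"
    have f0: "f \<tau> = (\<lambda>_. 0)" "g \<tau> = (\<lambda>_. 0)" if "\<tau> \<notin> ?D" for \<tau>
      using f g that by (auto simp: H_heart_def hall_algebra_def)
    have fz: "f \<tau> u = 0" "g \<tau> u = 0" if "u \<notin> EF \<Gamma> pm q \<tau>" "\<tau> \<in> ?D" for \<tau> u
      using f g that by (auto simp: H_heart_def hall_algebra_def Hsp_def)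
    have Ind0: "Ind \<Gamma> {} q s \<tau> \<omega> (\<lambda>_. 0) x = 0" for \<tau> \<omega>
      by (simp add: Ind_def push_def pull_def)
    have "?j (f \<otimes>\<^bsub>H_heart \<Gamma> ip im q s\<^esub> g) \<nu> x =
        (\<Sum>(\<tau>, \<omega>)\<in>?S. j_shriek_nu \<Gamma> ip im q \<nu> (Ind \<Gamma> pm q s \<tau> \<omega> (tens (f \<tau>) (g \<omega>))) x)"
      by (auto simp: j_shriek_def H_heart_def hall_algebra_def j_shriek_nu_def intro!: sum.cong)
    also have "\<dots> = (\<Sum>(\<tau>, \<omega>)\<in>?S. Ind \<Gamma> {} q s \<tau> \<omega> (tens (f \<tau>) (g \<omega>)) x)"
      using contraction_pair.j_shriek_Ind[OF contraction_pairI] fz by (auto intro!: sum.cong)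
    also have "\<dots> = (\<Sum>(\<tau>, \<omega>)\<in>?S'. Ind \<Gamma> {} q s \<tau> \<omega> (tens (f \<tau>) (g \<omega>)) x)"
    proof (rule sum.mono_neutral_left)
      show "finite ?S'" using finite_decompositions[of \<Gamma> \<nu>] finite_verts by (simp add: vorbits_def)
      show "?S \<subseteq> ?S'" using D by auto
      show "\<forall>i\<in>?S' - ?S. (case i of (\<tau>, \<omega>) \<Rightarrow> Ind \<Gamma> {} q s \<tau> \<omega> (tens (f \<tau>) (g \<omega>)) x) = 0"
      proof
        fix i assume "i \<in> ?S' - ?S"
        then obtain \<tau> \<omega> where i: "i = (\<tau>, \<omega>)" "\<tau> \<notin> ?D \<or> \<omega> \<notin> ?D" by auto
        then have "tens (f \<tau>) (g \<omega>) = (\<lambda>_. 0)" using f0[of \<tau>] f0[of \<omega>] by (auto simp: tens_def)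
        then show "(case i of (\<tau>, \<omega>) \<Rightarrow> Ind \<Gamma> {} q s \<tau> \<omega> (tens (f \<tau>) (g \<omega>)) x) = 0" using i Ind0 by simp
      qed
    qed
    finally show "?j (f \<otimes>\<^bsub>H_heart \<Gamma> ip im q s\<^esub> g) \<nu> x = (?j f \<otimes>\<^bsub>H_full \<Gamma> q s\<^esub> ?j g) \<nu> x"
      unfolding id[OF f] id[OF g] by (simp add: H_full_def hall_algebra_def)
  qed
  have "x \<in> EF \<Gamma> {} q (\<lambda>_. 0) \<Longrightarrow> x \<in> EF \<Gamma> pm q (\<lambda>_. 0)" for x :: "('h, 'k) rep"
  proof -
    assume x: "x \<in> EF \<Gamma> {} q (\<lambda>_. 0)"
    have "invertible_mat (x h)" if "h \<in> pm" for h
    proof -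
      have "x h \<in> carrier_mat 0 0" using x that pm_arrs by (auto simp: EF_def Esp_def vdim_def)
      then show ?thesis by (intro invertibleI[of _ "x h"]) auto
    qed
    then show "x \<in> EF \<Gamma> pm q (\<lambda>_. 0)" using x by (auto simp: EF_def Esp_open_subset[of _ _ pm])
  qed
  moreover have "x \<in> EF \<Gamma> pm q \<nu> \<Longrightarrow> x \<in> EF \<Gamma> {} q \<nu>" for x :: "('h, 'k) rep" and \<nu>
    by (auto simp: EF_def Esp_open_subset[of _ _ pm])
  ultimately have EF0: "x \<in> EF \<Gamma> pm q (\<lambda>_. 0) \<longleftrightarrow> x \<in> EF \<Gamma> {} q (\<lambda>_. 0)" for x :: "('h, 'k) rep" by blast
  have one: "?j \<one>\<^bsub>H_heart \<Gamma> ip im q s\<^esub> = \<one>\<^bsub>H_full \<Gamma> q s\<^esub>"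
  proof (intro ext)
    fix \<nu> and x :: "('h, 'k) rep"
    show "?j \<one>\<^bsub>H_heart \<Gamma> ip im q s\<^esub> \<nu> x = \<one>\<^bsub>H_full \<Gamma> q s\<^esub> \<nu> x"
      by (cases "\<nu> = (\<lambda>_. 0)") (auto simp: j_shriek_def H_full_def H_heart_def hall_algebra_def j_shriek_nu_def EF0)
  qed
  have add: "?j (f \<oplus>\<^bsub>H_heart \<Gamma> ip im q s\<^esub> g) = ?j f \<oplus>\<^bsub>H_full \<Gamma> q s\<^esub> ?j g" for f g
    by (auto simp: j_shriek_def H_full_def H_heart_def hall_algebra_def j_shriek_nu_def fun_eq_iff)
  have smult: "?j (c \<odot>\<^bsub>H_heart \<Gamma> ip im q s\<^esub> f) = c \<odot>\<^bsub>H_full \<Gamma> q s\<^esub> ?j f" for c f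
    by (auto simp: j_shriek_def H_full_def H_heart_def hall_algebra_def j_shriek_nu_def fun_eq_iff)
  show ?thesis using carrier mult one add smult by (auto simp: alg_hom_def Ring.ring_hom_def)
qed

lemma psi_inj:
  assumes s: "s \<noteq> 0"
  shows "inj_on (psi \<Gamma> ip im q s :: ('v, 'h carrow, 'k) hall \<Rightarrow> ('v, 'h, 'k) hall) (carrier (H_contr \<Gamma> ip im q s))"
proof (rule inj_onI, intro ext)
  fix f g :: "('v, 'h carrow, 'k) hall" and \<nu> u
  assume f: "f \<in> carrier (H_contr \<Gamma> ip im q s)" and g: "g \<in> carrier (H_contr \<Gamma> ip im q s)"
    and eq: "(psi \<Gamma> ip im q s f :: ('v, 'h, 'k) hall) = psi \<Gamma> ip im q s g"
  show "f \<nu> u = g \<nu> u"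
  proof (cases "\<nu> \<in> cdimvecs \<Gamma> ip im \<and> u \<in> EF \<Delta> {} q \<nu>")
    case True
    then obtain x where x: "x \<in> EF \<Gamma> pm q \<nu>" "\<mu> x = u" using mu_surj_EF cdimvecsD by blast
    have "psi \<Gamma> ip im q s f \<nu> x = psi \<Gamma> ip im q s g \<nu> x" by (simp add: eq)
    then show ?thesis using x s by (simp add: psi_def j_shriek_def j_shriek_nu_def mu_star_def mu_star_nu_def pull_def)
  next
    case False
    then show ?thesis using f g by (cases "\<nu> \<in> cdimvecs \<Gamma> ip im") (auto simp: H_contr_def hall_algebra_def Hsp_def)
  qed
qed

lemma Res_mu_star_tensor:
  fixes f :: "('h carrow, 'k) rep \<Rightarrow> complex"
  assumes s: "s\<^sup>2 = of_nat q" and D: "\<tau> \<in> cdimvecs \<Gamma> ip im" "\<omega> \<in> cdimvecs \<Gamma> ip im"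
    and f: "f \<in> Hsp \<Delta> {} q s (dplus \<tau> \<omega>)"
  shows "(Res \<Gamma> pm q s \<tau> \<omega> (mu_star_nu \<Gamma> ip im q s (dplus \<tau> \<omega>) f) :: ('h, 'k) rep \<times> ('h, 'k) rep \<Rightarrow> complex) =
    tens_map (Hsp \<Delta> {} q s \<tau>) (Hsp \<Delta> {} q s \<omega>) (mu_star_nu \<Gamma> ip im q s \<tau>) (mu_star_nu \<Gamma> ip im q s \<omega>)
      (Res \<Delta> {} q s \<tau> \<omega> f)"
proof -
  let ?v = "\<lambda>\<nu> (x :: ('h, 'k) rep). if x \<in> EF \<Gamma> pm q \<nu> then s powi (- (((int (\<nu> im))\<^sup>2 * cartan \<Gamma> im im) div 2)) else 0"
  have m: "mu_star_nu \<Gamma> ip im q s \<nu> F x = ?v \<nu> x * F (\<mu> x)" for \<nu> F x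
    by (simp add: mu_star_nu_def pull_def)
  have "tens_map (Hsp \<Delta> {} q s \<tau>) (Hsp \<Delta> {} q s \<omega>) (mu_star_nu \<Gamma> ip im q s \<tau>) (mu_star_nu \<Gamma> ip im q s \<omega>)
      (Res \<Delta> {} q s \<tau> \<omega> f) = (\<lambda>(x, y). ?v \<tau> x * ?v \<omega> y * Res \<Delta> {} q s \<tau> \<omega> f (\<mu> x, \<mu> y))"
    by (rule tens_map_eq[OF m m con.Res_decomposition[OF f]]) auto
  then show ?thesis using contraction_pair.Res_mu_star[OF contraction_pairI[OF D] s] by (simp add: fun_eq_iff)
qed

lemma Res_j_shriek_tensor:
  fixes f :: "('h, 'k) rep \<Rightarrow> complex"
  assumes D: "\<tau> \<in> cdimvecs \<Gamma> ip im" "\<omega> \<in> cdimvecs \<Gamma> ip im" and f: "f \<in> Hsp \<Gamma> pm q s (dplus \<tau> \<omega>)"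
  shows "Res \<Gamma> {} q s \<tau> \<omega> (j_shriek_nu \<Gamma> ip im q (dplus \<tau> \<omega>) f) =
    tens_map (Hsp \<Gamma> pm q s \<tau>) (Hsp \<Gamma> pm q s \<omega>) (j_shriek_nu \<Gamma> ip im q \<tau>) (j_shriek_nu \<Gamma> ip im q \<omega>)
      (Res \<Gamma> pm q s \<tau> \<omega> f)"
proof -
  let ?v = "\<lambda>\<nu> (x :: ('h, 'k) rep). if x \<in> EF \<Gamma> pm q \<nu> then 1 else 0 :: complex"
  have m: "j_shriek_nu \<Gamma> ip im q \<nu> F x = ?v \<nu> x * F x" for \<nu> F x
    by (simp add: j_shriek_nu_def)
  have "tens_map (Hsp \<Gamma> pm q s \<tau>) (Hsp \<Gamma> pm q s \<omega>) (j_shriek_nu \<Gamma> ip im q \<tau>) (j_shriek_nu \<Gamma> ip im q \<omega>)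
      (Res \<Gamma> pm q s \<tau> \<omega> f) = (\<lambda>(x, y). ?v \<tau> x * ?v \<omega> y * Res \<Gamma> pm q s \<tau> \<omega> f (x, y))"
    by (rule tens_map_eq[OF m m heart.Res_decomposition[OF f]]) (use D cdimvecsD in \<open>auto simp: vdim_pm\<close>)
  then show ?thesis using contraction_pair.Res_j_shriek[OF contraction_pairI[OF D]] by (simp add: fun_eq_iff)
qed

end

theorem theorem2p3p1:
  fixes \<Gamma> :: "('v, 'h) agraph" and ip im :: "'v set"
    and q e :: nat and s :: complex
  assumes "admissible \<Gamma>"
    and "contractible_pair \<Gamma> ip im"
    and "0 < e" and "q = CARD('p::prime_card) ^ e"
    and "s\<^sup>2 = of_nat q"
  shows
    "(mu_star \<Gamma> ip im q s :: ('v, 'h carrow, 'p Fbar) hall \<Rightarrow> ('v, 'h, 'p Fbar) hall)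
       \<in> alg_hom (Qadj s) (H_contr \<Gamma> ip im q s) (H_heart \<Gamma> ip im q s) \<and>
     (j_shriek \<Gamma> ip im q :: ('v, 'h, 'p Fbar) hall \<Rightarrow> ('v, 'h, 'p Fbar) hall)
       \<in> alg_hom (Qadj s) (H_heart \<Gamma> ip im q s) (H_full \<Gamma> q s) \<and>
     (psi \<Gamma> ip im q s :: ('v, 'h carrow, 'p Fbar) hall \<Rightarrow> ('v, 'h, 'p Fbar) hall)
       \<in> alg_hom (Qadj s) (H_contr \<Gamma> ip im q s) (H_full \<Gamma> q s) \<and>
     inj_on (psi \<Gamma> ip im q s :: ('v, 'h carrow, 'p Fbar) hall \<Rightarrow> ('v, 'h, 'p Fbar) hall)
       (carrier (H_contr \<Gamma> ip im q s)) \<and>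
     (\<forall>\<nu>\<in>cdimvecs \<Gamma> ip im. \<forall>\<tau>\<in>cdimvecs \<Gamma> ip im. \<forall>\<omega>\<in>cdimvecs \<Gamma> ip im. dplus \<tau> \<omega> = \<nu> \<longrightarrow>
        (\<forall>f \<in> (Hsp (contract \<Gamma> ip im) {} q s \<nu> :: (('h carrow, 'p Fbar) rep \<Rightarrow> complex) set).
           Res \<Gamma> (arrs_pm \<Gamma> ip im) q s \<tau> \<omega> (mu_star_nu \<Gamma> ip im q s \<nu> f) =
           tens_map (Hsp (contract \<Gamma> ip im) {} q s \<tau>) (Hsp (contract \<Gamma> ip im) {} q s \<omega>)
             (mu_star_nu \<Gamma> ip im q s \<tau>) (mu_star_nu \<Gamma> ip im q s \<omega>)
             (Res (contract \<Gamma> ip im) {} q s \<tau> \<omega> f)) \<and>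
        (\<forall>f \<in> (Hsp \<Gamma> (arrs_pm \<Gamma> ip im) q s \<nu> :: (('h, 'p Fbar) rep \<Rightarrow> complex) set).
           Res \<Gamma> {} q s \<tau> \<omega> (j_shriek_nu \<Gamma> ip im q \<nu> f) =
           tens_map (Hsp \<Gamma> (arrs_pm \<Gamma> ip im) q s \<tau>) (Hsp \<Gamma> (arrs_pm \<Gamma> ip im) q s \<omega>)
             (j_shriek_nu \<Gamma> ip im q \<tau>) (j_shriek_nu \<Gamma> ip im q \<omega>)
             (Res \<Gamma> (arrs_pm \<Gamma> ip im) q s \<tau> \<omega> f)))"
proof -
  interpret frobenius q "TYPE('p Fbar)" by (rule frobenius_Fbar[OF assms(3,4)])
  interpret contraction \<Gamma> q "TYPE('p Fbar)" ip im
    by unfold_locales (use assms(1,2) in auto)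
  have s0: "s \<noteq> 0" using assms(5) q_pos by auto
  show ?thesis
    using mu_star_alg_hom[OF s0] j_shriek_alg_hom[of s] alg_hom_compose[OF mu_star_alg_hom[OF s0] j_shriek_alg_hom]
      psi_inj[OF s0] Res_mu_star_tensor[OF assms(5)] Res_j_shriek_tensor
    by (auto simp: psi_def)
qed

end
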